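(* Let $X$ be a connected quartic half-arc-transitive weak $(m,n)$-metacirculant of Class II. Then the following hold: (i) $X$ is a Cayley graph for the group $\langle\rho,\sigma\rangle$, where $(\rho,\sigma)$ is some pair of automorphisms of $X$ such that $X$ is a weak $(m,n)$-metacirculant of Class II relative to $(\rho,\sigma)$; (ii) $(\mathrm{Aut}\,X)_v\cong\mathbb{Z}_2$ for all $v\in V(X)$; (iii) $m$ divides $n$ and $d_m=\frac{n}{m}>2$; (iv) there exist $r\in\mathbb{Z}_n^*$ and $t\in\mathbb{Z}_n$ such that $X\cong\mathcal{Y}(m,n;r,t)$, where the parameters $r$ and $t$ satisfy the following conditions (all equalities in $\mathbb{Z}_n$): - $r^m=1$, - $m(r-1)=t(r-1)=(r-1)^2=0$, - $\langle m\rangle=\langle t\rangle$ in $\mathbb{Z}_n$, - there exists a unique $c\in\{0,1,\ldots,d_m-1\}$ such that $t=cm$ and $m=ct$, and - there exists a unique $a\in\{0,1,\ldots,d_m-1\}$ such that $at=-am=r-1$; (v) $X$ is tightly attached unless $m$ and $d_m$ are both even, and $n=8n_1$ for some integer $n_1>2$, where $n_1$ is even or not squarefree.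
   Context: All graphs are finite, simple and undirected. Quartic means regular of valency $4$. A graph $X$ is half-arc-transitive if $\mathrm{Aut}\,X$ is transitive on vertices and on edges but not on arcs. Automorphisms act on the right. $\mathbb{Z}_n$ is the ring of residues modulo $n$ (also its additive group); $\langle x\rangle$ for $x\in\mathbb{Z}_n$ is the additive subgroup generated by $x$. Weak metacirculants. For integers $m\ge 1$, $n\ge 2$, an automorphism of a graph is $(m,n)$-semiregular if it has $m$ orbits of length $n$ on vertices and no other orbit. $X$ is a weak $(m,n)$-metacirculant relative to the ordered pair $(\rho,\sigma)$ of automorphisms if $\rho$ is $(m,n)$-semiregular, $\sigma^{-1}\rho\sigma=\rho^r$ for some $r\in\mathbb{Z}_n^*$, and $\sigma$ cyclically permutes the orbits of $\rho$. Class II. A connected quartic half-arc-transitive weak $(m,n)$-metacirculant $X$ relative to $(\rho,\sigma)$ is of Class II (relative to $(\rho,\sigma)$) if each orbit of $\rho$ induces a subgraph of valency $2$, and each orbit of $\rho$ is joined to exactly two other orbits, in such a way that each vertex has exactly one neighbour in each of these two other orbits. $X$ is a weak $(m,n)$-metacirculant of Class II if this holds for some pair $(\rho,\sigma)$. The graph $\mathcal{Y}(m,n;r,t)$. For $m\ge3$, $n\ge3$, $r\in\mathbb{Z}_n^*$ with $r^m=1$, and $t\in\mathbb{Z}_n$ with $t(r-1)=0$, it has vertex set $\{u_i^j : i\in\mathbb{Z}_m,\ j\in\mathbb{Z}_n\}$ and edges given by $u_i^j\sim u_i^{j+r^i},\ u_{i+1}^j$ for $i\in\mathbb{Z}_m\setminus\{m-1\}$,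 $j\in\mathbb{Z}_n$, and $u_{m-1}^j\sim u_{m-1}^{j+r^{m-1}},\ u_0^{j+t}$ for $j\in\mathbb{Z}_n$. Tight attachment. Fix one of the two $\mathrm{Aut}\,X$-invariant orientations of the edges of a connected quartic half-arc-transitive graph $X$. An even-length cycle $C$ is an alternating cycle if every other vertex of $C$ is the tail, and every other vertex is the head, of its two incident edges on $C$. All alternating cycles have the same length, half of which is the radius; any two adjacent (distinct, intersecting) alternating cycles meet in the same number of vertices, the attachment number. $X$ is tightly attached if its attachment number equals its radius. *)

theory Defs
  imports
    "Graph_Theory.Graph_Theory"
    "HOL-Combinatorics.Orbits"
    "HOL-Algebra.Elementary_Groups"
    "HOL-Computational_Algebra.Squarefree"
    "HOL-Number_Theory.Cong"
begin

text \<open>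
  Finite simple undirected graphs are \<^locale>\<open>pair_graph\<close>s: an undirected edge is a pair of
  opposite arcs \<open>(u, v)\<close>, \<open>(v, u)\<close>, and the valency of a vertex is its out-degree.
  The set \<^term>\<open>parcs X\<close> is thus exactly the set of arcs of the undirected graph \<open>X\<close>.
\<close>

definition regular :: "'a pair_pre_digraph \<Rightarrow> nat \<Rightarrow> bool" where
  "regular X k \<longleftrightarrow> (\<forall>v\<in>pverts X. out_degree (with_proj X) v = k)"

definition automorphisms :: "'a pair_pre_digraph \<Rightarrow> ('a \<Rightarrow> 'a) set" where
  "automorphisms X = {f. f permutes pverts X \<and>
     (\<forall>u\<in>pverts X. \<forall>v\<in>pverts X. (u, v) \<in> parcs X \<longleftrightarrow> (f u, f v) \<in> parcs X)}"

text \<open>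
  Automorphisms act on the right: \<open>f \<otimes> g\<close> is ``first \<open>f\<close>, then \<open>g\<close>''.
\<close>

definition aut_group :: "'a pair_pre_digraph \<Rightarrow> ('a \<Rightarrow> 'a) monoid" where
  "aut_group X = \<lparr>carrier = automorphisms X, monoid.mult = (\<lambda>f g. g \<circ> f), one = id\<rparr>"

definition vertex_stabilizer :: "'a pair_pre_digraph \<Rightarrow> 'a \<Rightarrow> ('a \<Rightarrow> 'a) monoid" where
  "vertex_stabilizer X v = (aut_group X)\<lparr>carrier := {f \<in> automorphisms X. f v = v}\<rparr>"

definition vertex_transitive :: "'a pair_pre_digraph \<Rightarrow> bool" where
  "vertex_transitive X \<longleftrightarrow> (\<forall>u\<in>pverts X. \<forall>v\<in>pverts X. \<exists>f\<in>automorphisms X. f u = v)"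

definition edge_transitive :: "'a pair_pre_digraph \<Rightarrow> bool" where
  "edge_transitive X \<longleftrightarrow> (\<forall>(u, v)\<in>parcs X. \<forall>(x, y)\<in>parcs X.
     \<exists>f\<in>automorphisms X. {f u, f v} = {x, y})"

definition arc_transitive :: "'a pair_pre_digraph \<Rightarrow> bool" where
  "arc_transitive X \<longleftrightarrow> (\<forall>(u, v)\<in>parcs X. \<forall>(x, y)\<in>parcs X.
     \<exists>f\<in>automorphisms X. f u = x \<and> f v = y)"

definition half_arc_transitive :: "'a pair_pre_digraph \<Rightarrow> bool" where
  "half_arc_transitive X \<longleftrightarrow> vertex_transitive X \<and> edge_transitive X \<and> \<not> arc_transitive X"

definition connected_quartic_hat_graph :: "'a pair_pre_digraph \<Rightarrow> bool" where
  "connected_quartic_hat_graph X \<longleftrightarrow> pair_graph X \<and> Digraph_Component.connected (with_proj X) \<and>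
     regular X 4 \<and> half_arc_transitive X"


definition vertex_orbits :: "'a pair_pre_digraph \<Rightarrow> ('a \<Rightarrow> 'a) \<Rightarrow> 'a set set" where
  "vertex_orbits X \<rho> = orbit \<rho> ` pverts X"

definition semiregular :: "'a pair_pre_digraph \<Rightarrow> nat \<Rightarrow> nat \<Rightarrow> ('a \<Rightarrow> 'a) \<Rightarrow> bool" where
  "semiregular X m n \<rho> \<longleftrightarrow> 1 \<le> m \<and> 2 \<le> n \<and> \<rho> \<in> automorphisms X \<and>
     card (vertex_orbits X \<rho>) = m \<and> (\<forall>B\<in>vertex_orbits X \<rho>. card B = n)"

text \<open>
  Here and below, elements of \<open>\<int>\<^sub>n\<close> are the integers in \<open>{0..<n}\<close> and equalities in \<open>\<int>\<^sub>n\<close>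
  are congruences modulo \<open>n\<close>.
\<close>

definition weak_metacirculant_rel ::
    "'a pair_pre_digraph \<Rightarrow> nat \<Rightarrow> nat \<Rightarrow> ('a \<Rightarrow> 'a) \<Rightarrow> ('a \<Rightarrow> 'a) \<Rightarrow> bool" where
  "weak_metacirculant_rel X m n \<rho> \<sigma> \<longleftrightarrow>
     semiregular X m n \<rho> \<and> \<sigma> \<in> automorphisms X \<and>
     (\<exists>r\<in>{0..<int n}. coprime r (int n) \<and>
        inv\<^bsub>aut_group X\<^esub> \<sigma> \<otimes>\<^bsub>aut_group X\<^esub> \<rho> \<otimes>\<^bsub>aut_group X\<^esub> \<sigma> = \<rho> [^]\<^bsub>aut_group X\<^esub> r) \<and>
     cyclic_on (\<lambda>B. \<sigma> ` B) (vertex_orbits X \<rho>)"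

definition joined_orbits :: "'a pair_pre_digraph \<Rightarrow> ('a \<Rightarrow> 'a) \<Rightarrow> 'a set \<Rightarrow> 'a set set" where
  "joined_orbits X \<rho> B =
     {B' \<in> vertex_orbits X \<rho>. B' \<noteq> B \<and> (\<exists>u\<in>B. \<exists>v\<in>B'. (u, v) \<in> parcs X)}"

definition class_II_rel ::
    "'a pair_pre_digraph \<Rightarrow> nat \<Rightarrow> nat \<Rightarrow> ('a \<Rightarrow> 'a) \<Rightarrow> ('a \<Rightarrow> 'a) \<Rightarrow> bool" where
  "class_II_rel X m n \<rho> \<sigma> \<longleftrightarrow>
     connected_quartic_hat_graph X \<and> weak_metacirculant_rel X m n \<rho> \<sigma> \<and>
     (\<forall>B\<in>vertex_orbits X \<rho>.
        (\<forall>v\<in>B. card {w \<in> B. (v, w) \<in> parcs X} = 2) \<and>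
        card (joined_orbits X \<rho> B) = 2 \<and>
        (\<forall>B'\<in>joined_orbits X \<rho> B. \<forall>v\<in>B. card {w \<in> B'. (v, w) \<in> parcs X} = 1))"

definition class_II :: "'a pair_pre_digraph \<Rightarrow> nat \<Rightarrow> nat \<Rightarrow> bool" where
  "class_II X m n \<longleftrightarrow> (\<exists>\<rho> \<sigma>. class_II_rel X m n \<rho> \<sigma>)"


definition cayley_graph :: "('g, 'b) monoid_scheme \<Rightarrow> 'g set \<Rightarrow> 'g pair_pre_digraph" where
  "cayley_graph G S =
     \<lparr>pverts = carrier G, parcs = {(g, s \<otimes>\<^bsub>G\<^esub> g) | g s. g \<in> carrier G \<and> s \<in> S}\<rparr>"

definition is_cayley_graph_for :: "'a pair_pre_digraph \<Rightarrow> ('g, 'b) monoid_scheme \<Rightarrow> bool" where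
  "is_cayley_graph_for X G \<longleftrightarrow>
     (\<exists>S \<subseteq> carrier G - {\<one>\<^bsub>G\<^esub>}. (\<forall>s\<in>S. inv\<^bsub>G\<^esub> s \<in> S) \<and>
        digraph_iso (with_proj X) (with_proj (cayley_graph G S)))"


text \<open>The vertex \<open>u\<^sub>i\<^sup>j\<close> is the pair \<open>(i, j)\<close>.\<close>

definition y_half_arcs :: "nat \<Rightarrow> nat \<Rightarrow> int \<Rightarrow> int \<Rightarrow> (nat \<times> int) rel" where
  "y_half_arcs m n r t =
     {((i, j), (i, (j + r ^ i) mod int n)) | i j. i < m \<and> j \<in> {0..<int n}} \<union>
     {((i, j), (i + 1, j)) | i j. i < m - 1 \<and> j \<in> {0..<int n}} \<union>
     {((m - 1, j), (0, (j + t) mod int n)) | j. j \<in> {0..<int n}}"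

definition y_graph :: "nat \<Rightarrow> nat \<Rightarrow> int \<Rightarrow> int \<Rightarrow> (nat \<times> int) pair_pre_digraph" where
  "y_graph m n r t =
     \<lparr>pverts = {0..<m} \<times> {0..<int n}, parcs = y_half_arcs m n r t \<union> (y_half_arcs m n r t)\<inverse>\<rparr>"

text \<open>The parameters for which \<^const>\<open>y_graph\<close> is meant.\<close>

definition y_params :: "nat \<Rightarrow> nat \<Rightarrow> int \<Rightarrow> int \<Rightarrow> bool" where
  "y_params m n r t \<longleftrightarrow> 3 \<le> m \<and> 3 \<le> n \<and>
     r \<in> {0..<int n} \<and> coprime r (int n) \<and> [r ^ m = 1] (mod int n) \<and>
     t \<in> {0..<int n} \<and> [t * (r - 1) = 0] (mod int n)"


definition invariant_orientation :: "'a pair_pre_digraph \<Rightarrow> 'a rel \<Rightarrow> bool" where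
  "invariant_orientation X D \<longleftrightarrow> D \<subseteq> parcs X \<and>
     (\<forall>(u, v)\<in>parcs X. (u, v) \<in> D \<longleftrightarrow> (v, u) \<notin> D) \<and>
     (\<forall>f\<in>automorphisms X. \<forall>(u, v)\<in>D. (f u, f v) \<in> D)"

text \<open>
  An alternating cycle is represented by its set of (oriented) edges, since distinct alternating
  cycles might have the same vertex set. The list \<open>vs\<close> runs once around the cycle, starting at a
  tail; vertices at even positions are tails and those at odd positions are heads.
\<close>

definition alternating_cycle :: "'a rel \<Rightarrow> 'a rel \<Rightarrow> bool" where
  "alternating_cycle D C \<longleftrightarrow>
     (\<exists>vs. 4 \<le> length vs \<and> even (length vs) \<and> distinct vs \<and> C \<subseteq> D \<and>
        C = {(vs ! i, vs ! ((i + 1) mod length vs)) | i. i < length vs \<and> even i} \<union>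
            {(vs ! ((i + 1) mod length vs), vs ! i) | i. i < length vs \<and> odd i})"

definition adjacent_alternating_cycles :: "'a rel \<Rightarrow> 'a rel \<Rightarrow> 'a rel \<Rightarrow> bool" where
  "adjacent_alternating_cycles D C C' \<longleftrightarrow>
     alternating_cycle D C \<and> alternating_cycle D C' \<and> C \<noteq> C' \<and> Field C \<inter> Field C' \<noteq> {}"

definition has_radius :: "'a rel \<Rightarrow> nat \<Rightarrow> bool" where
  "has_radius D k \<longleftrightarrow>
     (\<exists>C. alternating_cycle D C) \<and> (\<forall>C. alternating_cycle D C \<longrightarrow> card C = 2 * k)"

definition has_attachment_number :: "'a rel \<Rightarrow> nat \<Rightarrow> bool" where
  "has_attachment_number D k \<longleftrightarrow>
     (\<exists>C C'. adjacent_alternating_cycles D C C') \<and>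
     (\<forall>C C'. adjacent_alternating_cycles D C C' \<longrightarrow> card (Field C \<inter> Field C') = k)"

text \<open>
  The two invariant orientations are opposite to each other and give the same radius and
  attachment number, so it does not matter which one is used.
\<close>

definition tightly_attached :: "'a pair_pre_digraph \<Rightarrow> bool" where
  "tightly_attached X \<longleftrightarrow>
     (\<exists>D k. invariant_orientation X D \<and> has_radius D k \<and> has_attachment_number D k)"

end

theory Submission
  imports Defs
begin

text \<open>
  Fix one of the two orientations \<open>D\<close> that all automorphisms preserve. As \<open>\<rho>\<close> preserves it, every
  vertex has one out-neighbour inside its \<open>\<rho>\<close>-orbit, along an inner arc, and one outside it, along
  an outer arc. Replacing \<open>\<sigma>\<close> by a suitable \<open>\<rho>\<^sup>j\<sigma>\<^sup>i\<close>, one may assume that \<open>\<sigma>\<close> moves some vertex along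
  its outer arc. Then the vertices are \<open>u i j\<close> for integers \<open>i\<close>, \<open>j\<close>, where \<open>u i j\<close> is the image of
  \<open>u 0 0\<close> under \<open>\<rho>\<^sup>j\<sigma>\<^sup>i\<close>; row \<open>i + m\<close> is row \<open>i\<close> shifted by \<open>t\<close>, outer arcs go from \<open>u i j\<close> to
  \<open>u (i + 1) j\<close>, and inner arcs from \<open>u i j\<close> to \<open>u i (j + s r\<^sup>i)\<close> (\<open>class_II_pair_exists\<close>,
  \<open>coordinates\<close>). The group generated by \<open>\<rho>\<close> and \<open>\<sigma>\<close> respects the two colours of arcs, inner and
  outer, and so it acts regularly on vertices (\<open>is_cayley\<close>).

  The stabilizer. At each vertex an automorphism \<open>g\<close> keeps or swaps the colours of the two arcs that
  leave it. Two inner arcs of neighbouring rows span a closed walk of length 8. The image of this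
  octagon under \<open>g\<close> is closed too, and counting rows along it modulo \<open>m\<close> shows that \<open>g\<close> swaps
  everywhere or nowhere, except that for \<open>m = 4\<close> the swaps might alternate (\<open>octagon_pattern\<close>). In
  that case the closed images of the octagons and of one further relation yield \<open>2 (r - 1) = 0\<close> and
  \<open>r\<^sup>2 = 1\<close> modulo \<open>n\<close> (\<open>no_alternation\<close>); but if \<open>r\<^sup>2 = 1\<close>, then \<open>u i j \<mapsto> u (- i) (- j)\<close> is an
  automorphism that reverses all arcs (\<open>r_square\<close>). So an automorphism is determined by the image of
  one vertex and by one bit, and vertex stabilizers have order 2, as edge-transitivity supplies an
  automorphism that fixes a vertex and swaps its out-neighbours.

  The parameters. The automorphism that fixes \<open>u 0 0\<close> and swaps colours turns each relation between
  walks of inner and outer arcs into another one. That inner and outer directed cycles have the same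
  length makes \<open>s\<close> a unit, so that \<open>s = 1\<close> after rescaling, and gives \<open>m | n\<close> and \<open>m | t\<close>; the
  images of the relations for \<open>m\<close> outer arcs and for an outer arc followed by an inner one give the
  remaining conditions (\<open>swap_orders\<close>, \<open>rescale\<close>, \<open>parameters\<close>).

  Attachment. The tails of an alternating cycle form an orbit of the map \<open>turn\<close>, which goes forward
  along an inner arc and back along an outer one, and the cycles are attached tightly if the shift
  of rows by \<open>r - 1\<close> is a power of \<open>turn\<close> (\<open>tightly_attachedI\<close>). With \<open>n = m d\<close>, \<open>t = c m\<close> and
  \<open>r - 1 = m q\<close> this is a divisibility condition, and its failure leads to the stated conditions on
  \<open>m\<close> and \<open>n\<close> (\<open>non_tight_parameters\<close>) or to \<open>m = 4\<close>, \<open>n = 16\<close>. The latter graphs are arc-transitive,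
  by an explicit automorphism (\<open>not_exceptional\<close>).
\<close>

section \<open>Divisibility\<close>

lemma coprime_two_odd: "odd (g::int) \<Longrightarrow> coprime g 2"
  using coprime_right_2_iff_odd by blast

text \<open>
  Modulo an odd divisor \<open>g\<close> the number 2 is invertible. So \<open>w = 0\<close> and \<open>m q = 0\<close> imply \<open>c = 1\<close>, and
  then \<open>(c + 1) q = 0\<close> says that \<open>2 q = 0\<close>.
\<close>
lemma odd_divisor_cancels:
  fixes g m c q w :: int
  assumes "odd g" "g dvd w" "g dvd (c + 1) * q" "g dvd m * q"
    and w: "2 * w = 2 * (1 - c) - q * m * (m - 1)"
  shows "g dvd q"
proof -
  have "g dvd 2 * w + (m * q) * (m - 1)"
    using assms(2,4) by (meson dvd_add dvd_mult dvd_mult2)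
  then have "g dvd 2 * (1 - c)"
    unfolding w by (simp add: algebra_simps)
  then have *: "g dvd 1 - c"
    using \<open>odd g\<close> coprime_two_odd coprime_dvd_mult_right_iff by blast
  have "g dvd (1 - c) * q + (c + 1) * q"
    using * assms(3) by (intro dvd_add) (auto intro: dvd_mult2)
  then have "g dvd 2 * q" by (simp add: algebra_simps)
  then show ?thesis
    using \<open>odd g\<close> coprime_two_odd coprime_dvd_mult_right_iff by blast
qed

lemma two_power_odd_part:
  fixes d :: int
  assumes "d > 0"
  obtains k d' where "d = 2 ^ k * d'" "odd d'" "d' > 0"
proof -
  obtain d' where d': "d = 2 ^ multiplicity 2 d * d'" "\<not> 2 dvd d'"
    using multiplicity_decompose'[of d 2] assms by auto
  moreover have "d' > 0" using d' assms
    by (metis zero_less_mult_pos zero_less_numeral zero_less_power)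
  ultimately show thesis using that by blast
qed

lemma two_power_dvd_mult_odd:
  fixes q m :: int
  shows "2 ^ k dvd m * q \<Longrightarrow> odd m \<Longrightarrow> 2 ^ k dvd q"
  by (metis coprime_dvd_mult_right_iff coprime_power_left_iff coprime_left_2_iff_odd)

text \<open>
  In the application \<open>n = m d\<close>, \<open>t = c m\<close>, \<open>r - 1 = m q\<close>, and going once round the rows along an
  alternating cycle is a shift by \<open>m w\<close>; the cycles are tightly attached if the greatest common
  divisor of \<open>w\<close> and \<open>d\<close> divides \<open>q\<close>. The odd part of this divisor always divides \<open>q\<close>, so only its
  2-part can fail to. This makes \<open>m\<close>, \<open>d\<close> and \<open>w\<close> even and \<open>m d\<close> divisible by 8. If the odd part of
  \<open>d\<close> does not divide \<open>q\<close>, then it has a common prime divisor with \<open>m\<close>, whose square divides \<open>m d\<close>;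
  otherwise both \<open>m\<close> and \<open>d\<close> are divisible by 4.
\<close>
lemma non_tight_parameters:
  fixes m d q c w :: int
  assumes "m > 0" "d > 0"
    and mq: "d dvd m * q" and cc: "d dvd c * c - 1" and cq: "d dvd (c + 1) * q"
    and q2: "\<not> d dvd 2 * q"
    and w: "2 * w = 2 * (1 - c) - q * m * (m - 1)"
    and nt: "\<not> gcd w d dvd q"
  shows "even m \<and> even d \<and> (m = 4 \<and> d = 4 \<or>
      (\<exists>n\<^sub>1::nat. n\<^sub>1 > 2 \<and> m * d = 8 * int n\<^sub>1 \<and> (even n\<^sub>1 \<or> \<not> squarefree n\<^sub>1)))"
proof -
  have "gcd w d > 0" using \<open>d > 0\<close> by simp
  then obtain a g where g: "gcd w d = 2 ^ a * g" "odd g" "g > 0"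
    by (rule two_power_odd_part)
  have "g dvd q"
  proof (rule odd_divisor_cancels[OF \<open>odd g\<close> _ _ _ w])
    have "g dvd gcd w d" by (simp add: g)
    then show "g dvd w" "g dvd (c + 1) * q" "g dvd m * q"
      using mq cq by (auto intro: dvd_trans)
  qed
  then have a: "\<not> 2 ^ a dvd q"
    using nt g by (metis coprime_left_2_iff_odd coprime_power_left_iff divides_mult)
  have ad: "2 ^ a dvd d" "2 ^ a dvd w"
    by (metis dvd_triv_left g(1) gcd_dvd2 dvd_trans) (metis dvd_triv_left g(1) gcd_dvd1 dvd_trans)
  \<comment> \<open>The failure is at 2, so \<open>m\<close> and \<open>d\<close> are even; parity of \<open>w\<close> excludes that neither is divisible by 4.\<close>
  have "a \<noteq> 0" using a by (metis one_dvd power_0)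
  have "even m" using a ad mq two_power_dvd_mult_odd dvd_trans by blast
  have "(2::int) dvd 2 ^ a" using \<open>a \<noteq> 0\<close> by simp
  then have "even d" "even w" using ad by (blast intro: dvd_trans)+
  have "even (c * c - 1)" using cc \<open>even d\<close> by (rule dvd_trans[rotated])
  then have "odd c" by auto
  have "4 dvd m \<or> 4 dvd d"
  proof (rule ccontr)
    assume no: "\<not> ?thesis"
    have "a = 1"
    proof (rule ccontr)
      assume "a \<noteq> 1"
      then have "(2::int) ^ 2 dvd 2 ^ a" using \<open>a \<noteq> 0\<close> by (intro le_imp_power_dvd) simp
      then have "4 dvd d" using ad(1) by (auto intro: dvd_trans)
      then show False using no by blast
    qed
    then have "odd q" using a by simp
    obtain m' where m': "m = 2 * m'" using \<open>even m\<close> by blast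
    have "odd m'" using no m' by auto
    have "w = (1 - c) - q * m' * (m - 1)" using w m' by simp
    then show False using \<open>even w\<close> \<open>odd c\<close> \<open>odd q\<close> \<open>odd m'\<close> \<open>even m\<close> by simp
  qed
  then have "8 dvd m * d"
  proof
    assume "4 dvd m" then have "4 * 2 dvd m * d" using \<open>even d\<close> by (rule mult_dvd_mono)
    then show ?thesis by simp
  next
    assume "4 dvd d" then have "2 * 4 dvd m * d" using \<open>even m\<close> by (intro mult_dvd_mono)
    then show ?thesis by simp
  qed
  then obtain n1' where "m * d = 8 * n1'" by blast
  moreover have "n1' > 0" using calculation assms(1,2) by (smt (verit) mult_pos_pos)
  ultimately obtain n1 where n1: "m * d = 8 * int n1" "n1 > 0"
    by (metis zero_less_imp_eq_int)
  obtain k d' where d': "d = 2 ^ k * d'" "odd d'" "d' > 0"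
    using two_power_odd_part \<open>d > 0\<close> by blast
  have "m = 4 \<and> d = 4 \<or> (n1 > 2 \<and> (even n1 \<or> \<not> squarefree n1))"
  proof (cases "d' dvd q")
    case False
    have "d' dvd m * q" using d' mq by (metis dvd_mult_right)
    then have "\<not> coprime d' m" using False coprime_dvd_mult_right_iff by blast
    then obtain p where p: "prime p" "p dvd d'" "p dvd m"
      using \<open>m > 0\<close> prime_divisor_exists[of "gcd d' m"] by (auto simp: coprime_iff_gcd_eq_1)
    have p0: "p > 0" using p prime_gt_0_int by blast
    have "odd p" using d' p dvd_trans by blast
    have "p * p dvd m * d" using p d' by (intro mult_dvd_mono) auto
    then have "p * p dvd 2 ^ 3 * int n1" using n1 by simp
    moreover have "coprime (p * p) (2 ^ 3)"
      using \<open>odd p\<close> by (intro coprime_power_right_iff[THEN iffD2]) simp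
    ultimately have "p * p dvd int n1" using coprime_dvd_mult_right_iff by blast
    then have pn: "nat p * nat p dvd n1"
      by (metis p0 int_dvd_int_iff int_nat_eq less_le_not_le of_nat_mult)
    have "nat p \<ge> 3" using \<open>odd p\<close> p(1) prime_ge_2_int[of p] by (cases "p = 2") auto
    then have "n1 > 2" using dvd_imp_le[OF pn \<open>n1 > 0\<close>] mult_le_mono[of 3 "nat p" 3 "nat p"] by linarith
    moreover have "\<not> squarefree n1"
      using pn \<open>nat p \<ge> 3\<close> by (auto simp: squarefree_def power2_eq_square)
    ultimately show ?thesis by blast
  next
    case True
    have k: "\<not> 2 ^ k dvd 2 * q"
    proof
      assume "2 ^ k dvd 2 * q"
      then have "2 ^ k * d' dvd 2 * q" using True d'
        by (metis coprime_left_2_iff_odd coprime_power_left_iff divides_mult dvd_mult)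
      then show False using q2 d' by simp
    qed
    have "k \<ge> 2"
    proof (rule ccontr)
      assume "\<not> k \<ge> 2" then have "k = 0 \<or> k = 1" by auto
      then show False using k by auto
    qed
    then have "(2::int) ^ 2 dvd 2 ^ k" by (rule le_imp_power_dvd)
    then have d4: "4 dvd d" using d' by auto
    have m4: "4 dvd m"
    proof (rule ccontr)
      assume no: "\<not> 4 dvd m"
      obtain m' where m': "m = 2 * m'" using \<open>even m\<close> by blast
      then have "odd m'" using no by auto
      have "2 ^ k dvd m' * (2 * q)" using mq d' m' by (metis dvd_mult_left mult.assoc mult.commute)
      then show False using k two_power_dvd_mult_odd \<open>odd m'\<close> by blast
    qed
    obtain m' d'' where md: "m = 4 * m'" "d = 4 * d''" using m4 d4 by blast
    have "int n1 = 2 * (m' * d'')" using n1 md by (simp add: mult.commute)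
    then have e: "even n1" by (metis dvd_triv_left even_of_nat)
    show ?thesis
    proof (cases "n1 > 2")
      case False
      then have "n1 = 2" using e n1 by (metis dvd_imp_le le_antisym not_le_imp_less)
      then have "m' * d'' = 1" using \<open>int n1 = _\<close> by simp
      then have "m' = 1 \<and> d'' = 1" using md assms(1,2) by (smt (verit) zmult_eq_1_iff)
      then show ?thesis using md by simp
    qed (use e in blast)
  qed
  then show ?thesis using n1 \<open>even m\<close> \<open>even d\<close> by blast
qed

lemma generate_integer_mod_group_eq:
  assumes "int n > 0" "x \<in> {0..<int n}" "y \<in> {0..<int n}" "[x = a * y] (mod int n)" "[y = b * x] (mod int n)"
  shows "generate (integer_mod_group n) {x} = generate (integer_mod_group n) {y}"
proof -
  interpret group "integer_mod_group n" by simp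
  have *: "generate (integer_mod_group n) {x} \<subseteq> generate (integer_mod_group n) {y}"
    if "x \<in> {0..<int n}" "y \<in> {0..<int n}" "[x = a * y] (mod int n)" for x y a
  proof (rule generate_subgroup_incl)
    have yc: "y \<in> carrier (integer_mod_group n)" using that(2) by (simp add: carrier_integer_mod_group)
    show "subgroup (generate (integer_mod_group n) {y}) (integer_mod_group n)"
      by (rule generate_is_subgroup) (use yc in simp)
    have "y [^]\<^bsub>integer_mod_group n\<^esub> a = x"
      using that by (simp add: int_pow_integer_mod_group cong_def)
    then show "{x} \<subseteq> generate (integer_mod_group n) {y}"
      using generate_pow[OF yc] by auto
  qed
  show ?thesis using *[OF assms(2,3,4)] *[OF assms(3,2,5)] by blast
qed

section \<open>Automorphisms, orbits and orientations\<close>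

lemma aut_in: "g \<in> automorphisms X \<Longrightarrow> v \<in> pverts X \<Longrightarrow> g v \<in> pverts X"
  unfolding automorphisms_def by (auto dest: permutes_in_image)

lemma aut_permutes: "g \<in> automorphisms X \<Longrightarrow> g permutes pverts X"
  unfolding automorphisms_def by blast

lemma aut_inj: "g \<in> automorphisms X \<Longrightarrow> g v = g w \<longleftrightarrow> v = w"
  using permutes_inj[OF aut_permutes, of g X] by (auto simp: inj_eq)

lemma aut_outside: "g \<in> automorphisms X \<Longrightarrow> v \<notin> pverts X \<Longrightarrow> g v = v"
  unfolding automorphisms_def by (auto simp: permutes_def)

lemma aut_arcs:
  "g \<in> automorphisms X \<Longrightarrow> v \<in> pverts X \<Longrightarrow> w \<in> pverts X \<Longrightarrow>
    (g v, g w) \<in> parcs X \<longleftrightarrow> (v, w) \<in> parcs X"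
  unfolding automorphisms_def by blast

lemma aut_surj:
  assumes "g \<in> automorphisms X" "v \<in> pverts X"
  obtains w where "w \<in> pverts X" "g w = v"
  using permutes_image[OF aut_permutes[OF assms(1)]] assms(2) by (metis imageE)

lemma id_aut: "id \<in> automorphisms X"
  by (simp add: automorphisms_def permutes_id)

lemma comp_aut:
  assumes "g \<in> automorphisms X" "h \<in> automorphisms X"
  shows "g \<circ> h \<in> automorphisms X"
proof -
  have "g \<circ> h permutes pverts X"
    using assms unfolding automorphisms_def by (blast intro: permutes_compose)
  moreover have "(v, w) \<in> parcs X \<longleftrightarrow> ((g \<circ> h) v, (g \<circ> h) w) \<in> parcs X"
    if "v \<in> pverts X" "w \<in> pverts X" for v w
    using aut_arcs[OF assms(1)] aut_arcs[OF assms(2)] that aut_in[OF assms(2)] by simp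
  ultimately show ?thesis unfolding automorphisms_def by blast
qed

lemma funpow_aut: "g \<in> automorphisms X \<Longrightarrow> g ^^ k \<in> automorphisms X"
  by (induction k) (simp_all add: id_aut[unfolded id_def] id_def[symmetric] id_aut comp_aut)

lemma inv_aut:
  assumes g: "g \<in> automorphisms X"
  shows "Hilbert_Choice.inv g \<in> automorphisms X"
proof -
  note p = aut_permutes[OF g]
  have ip: "Hilbert_Choice.inv g permutes pverts X" using permutes_inv[OF p] .
  have "(v, w) \<in> parcs X \<longleftrightarrow> (Hilbert_Choice.inv g v, Hilbert_Choice.inv g w) \<in> parcs X" if "v \<in> pverts X" "w \<in> pverts X" for v w
  proof -
    have "Hilbert_Choice.inv g v \<in> pverts X" "Hilbert_Choice.inv g w \<in> pverts X"
      using that permutes_in_image[OF ip] by blast+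
    then show ?thesis using aut_arcs[OF g] by (metis permutes_inverses(1)[OF p])
  qed
  then show ?thesis using ip unfolding automorphisms_def by blast
qed

lemma aut_group_simps [simp]:
  "carrier (aut_group X) = automorphisms X" "\<one>\<^bsub>aut_group X\<^esub> = id"
  "f \<otimes>\<^bsub>aut_group X\<^esub> g = g \<circ> f"
  by (simp_all add: aut_group_def)

lemma group_aut_group: "group (aut_group X)"
proof (rule groupI)
  fix g assume "g \<in> carrier (aut_group X)"
  then have g: "g \<in> automorphisms X" by simp
  have "Hilbert_Choice.inv g \<otimes>\<^bsub>aut_group X\<^esub> g = id"
    using permutes_inv_o(1)[OF aut_permutes[OF g]] by simp
  then show "\<exists>h\<in>carrier (aut_group X). h \<otimes>\<^bsub>aut_group X\<^esub> g = \<one>\<^bsub>aut_group X\<^esub>"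
    using inv_aut[OF g] by auto
qed (auto simp: comp_aut id_aut comp_assoc)

lemma aut_group_inv:
  assumes "g \<in> automorphisms X" shows "inv\<^bsub>aut_group X\<^esub> g = Hilbert_Choice.inv g"
proof (rule group.inv_equality[OF group_aut_group])
  show "Hilbert_Choice.inv g \<otimes>\<^bsub>aut_group X\<^esub> g = \<one>\<^bsub>aut_group X\<^esub>"
    using permutes_inv_o(1)[OF aut_permutes[OF assms]] by simp
qed (use assms inv_aut in auto)

lemma aut_group_pow: "g [^]\<^bsub>aut_group X\<^esub> (k::nat) = g ^^ k"
proof (induction k)
  case (Suc k)
  have "g [^]\<^bsub>aut_group X\<^esub> Suc k = g [^]\<^bsub>aut_group X\<^esub> k \<otimes>\<^bsub>aut_group X\<^esub> g"
    by (rule monoid.nat_pow_Suc) (rule group.is_monoid[OF group_aut_group])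
  then show ?case using Suc by simp
qed (simp add: monoid.nat_pow_0[OF group.is_monoid[OF group_aut_group]])

text \<open>
  Products in \<^const>\<open>aut_group\<close> are read from left to right; on functions, the relation between
  \<open>\<rho>\<close> and \<open>\<sigma>\<close> says how a power of \<open>\<rho>\<close> passes to the left of \<open>\<sigma>\<close>.
\<close>
lemma conjugation_iff:
  assumes "\<rho> \<in> automorphisms X" "\<sigma> \<in> automorphisms X" "0 \<le> r"
  shows "inv\<^bsub>aut_group X\<^esub> \<sigma> \<otimes>\<^bsub>aut_group X\<^esub> \<rho> \<otimes>\<^bsub>aut_group X\<^esub> \<sigma> = \<rho> [^]\<^bsub>aut_group X\<^esub> (r::int) \<longleftrightarrow>
    \<sigma> \<circ> \<rho> = (\<rho> ^^ nat r) \<circ> \<sigma>"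
proof -
  have r: "\<rho> [^]\<^bsub>aut_group X\<^esub> r = \<rho> ^^ nat r"
    using assms(3) aut_group_pow[of X \<rho> "nat r"] int_pow_int[of "aut_group X" \<rho> "nat r"] by simp
  note p = aut_permutes[OF assms(2)]
  have "\<sigma> \<circ> (\<rho> \<circ> Hilbert_Choice.inv \<sigma>) = \<rho> ^^ nat r \<longleftrightarrow> \<sigma> \<circ> \<rho> = (\<rho> ^^ nat r) \<circ> \<sigma>"
  proof
    assume "\<sigma> \<circ> (\<rho> \<circ> Hilbert_Choice.inv \<sigma>) = \<rho> ^^ nat r"
    then have "(\<rho> ^^ nat r) \<circ> \<sigma> = \<sigma> \<circ> (\<rho> \<circ> Hilbert_Choice.inv \<sigma>) \<circ> \<sigma>" by simp
    also have "\<dots> = \<sigma> \<circ> \<rho> \<circ> (Hilbert_Choice.inv \<sigma> \<circ> \<sigma>)" by (simp only: comp_assoc)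
    finally have "(\<rho> ^^ nat r) \<circ> \<sigma> = \<sigma> \<circ> \<rho> \<circ> (Hilbert_Choice.inv \<sigma> \<circ> \<sigma>)" .
    then show "\<sigma> \<circ> \<rho> = (\<rho> ^^ nat r) \<circ> \<sigma>" using permutes_inv_o(2)[OF p] by simp
  next
    assume "\<sigma> \<circ> \<rho> = (\<rho> ^^ nat r) \<circ> \<sigma>"
    then have "\<sigma> \<circ> (\<rho> \<circ> Hilbert_Choice.inv \<sigma>) = (\<rho> ^^ nat r) \<circ> (\<sigma> \<circ> Hilbert_Choice.inv \<sigma>)" by (metis comp_assoc)
    then show "\<sigma> \<circ> (\<rho> \<circ> Hilbert_Choice.inv \<sigma>) = \<rho> ^^ nat r" using permutes_inv_o(1)[OF p] by simp
  qed
  then show ?thesis unfolding r by (simp add: aut_group_inv[OF assms(2)])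
qed

lemma funpow_eq_iff_cong:
  assumes "x \<in> orbit f x"
  shows "(f ^^ a) x = (f ^^ b) x \<longleftrightarrow> [a = b] (mod card (orbit f x))"
proof -
  define p where "p = (LEAST k. 0 < k \<and> (f ^^ k) x = x)"
  have "\<exists>k. x = (f ^^ k) x \<and> 0 < k"
    using assms by (simp only: orbit_altdef mem_Collect_eq)
  then obtain k where "0 < k \<and> (f ^^ k) x = x" by metis
  then have p: "0 < p" "(f ^^ p) x = x"
    unfolding p_def using LeastI[of "\<lambda>k. 0 < k \<and> (f ^^ k) x = x" k] by blast+
  have least: "p \<le> k" if "0 < k" "(f ^^ k) x = x" for k
    unfolding p_def by (rule Least_le) (use that in blast)
  have inj: "a = b" if "a < p" "b < p" "(f ^^ a) x = (f ^^ b) x" for a b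
  proof -
    have *: False if "a < b" "b < p" "(f ^^ a) x = (f ^^ b) x" for a b
    proof -
      have "(f ^^ (p - b + a)) x = (f ^^ (p - b)) ((f ^^ a) x)" by (simp only: funpow_add comp_apply)
      also have "\<dots> = (f ^^ (p - b)) ((f ^^ b) x)" using that by simp
      also have "\<dots> = (f ^^ (p - b + b)) x" by (simp only: funpow_add comp_apply)
      also have "\<dots> = x" using that p by simp
      finally have "p \<le> p - b + a" using that by (intro least) simp_all
      then show False using that by simp
    qed
    show ?thesis using *[of a b] *[of b a] that by (cases a b rule: linorder_cases) auto
  qed
  have "orbit f x = (\<lambda>k. (f ^^ k) x) ` {..<p}"
    using orbit_altdef_bounded[OF p(2,1)] by auto
  moreover have "inj_on (\<lambda>k. (f ^^ k) x) {..<p}" using inj by (auto simp: inj_on_def)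
  ultimately have card: "card (orbit f x) = p" by (simp add: card_image)
  have "(f ^^ a) x = (f ^^ b) x \<longleftrightarrow> (f ^^ (a mod p)) x = (f ^^ (b mod p)) x"
    using funpow_mod_eq[OF p(2)] by simp
  also have "\<dots> \<longleftrightarrow> a mod p = b mod p" using inj[of "a mod p" "b mod p"] p(1) by auto
  finally show ?thesis by (simp add: card cong_def)
qed

lemma digraph_isoI:
  assumes wf: "wf_digraph (with_proj X)"
    and g: "bij_betw g (pverts Y) (pverts X)"
    and sub: "parcs Y \<subseteq> pverts Y \<times> pverts Y"
    and arcs: "map_prod g g ` parcs Y = parcs X"
  shows "digraph_iso (with_proj X) (with_proj Y)"
proof -
  define f where "f = inv_into (pverts Y) g"
  have fg: "f (g y) = y" if "y \<in> pverts Y" for y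
    using g that by (simp add: f_def bij_betw_inv_into_left)
  have f: "bij_betw f (pverts X) (pverts Y)"
    unfolding f_def using g by (rule bij_betw_inv_into)
  have fgp: "map_prod f f (map_prod g g a) = a" if "a \<in> parcs Y" for a
    using sub that fg by (cases a) auto
  define hom where "hom = \<lparr>iso_verts = f, iso_arcs = map_prod f f, iso_head = snd, iso_tail = fst\<rparr>"
  have img: "map_prod f f ` parcs X = parcs Y"
    unfolding arcs[symmetric] image_image using fgp by simp
  have "inj_on (map_prod f f) (parcs X)"
    unfolding arcs[symmetric] by (rule inj_onI) (metis fgp imageE)
  then have "pre_digraph.digraph_isomorphism (with_proj X) hom"
    using wf f unfolding pre_digraph.digraph_isomorphism_def hom_def
    by (auto simp: bij_betw_def with_proj_def)
  moreover have "with_proj Y = app_iso hom (with_proj X)"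
    using f img by (simp add: app_iso_def hom_def with_proj_def bij_betw_def)
  ultimately show ?thesis unfolding digraph_iso_def by blast
qed

text \<open>
  The invariant orientations are \<open>D\<close> and its converse. Transitivity on the arcs of \<open>D\<close> is what
  edge-transitivity amounts to.
\<close>
locale half_arc_orientation =
  fixes X :: "'a pair_pre_digraph" and D :: "'a rel"
  assumes graph: "pair_graph X" and connected: "Digraph_Component.connected (with_proj X)"
    and arcs: "parcs X = D \<union> D\<inverse>"
    and antisym: "(x, y) \<in> D \<Longrightarrow> (y, x) \<notin> D"
    and invariant: "g \<in> automorphisms X \<Longrightarrow> (x, y) \<in> D \<Longrightarrow> (g x, g y) \<in> D"
    and arc_trans: "(x, y) \<in> D \<Longrightarrow> (x', y') \<in> D \<Longrightarrow> \<exists>g\<in>automorphisms X. g x = x' \<and> g y = y'"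
begin

declare aut_in [simp]

abbreviation "V \<equiv> pverts X"

lemma finite_V: "finite V"
  using graph by (meson pair_fin_digraph.pair_finite_verts pair_graph.axioms(1) pair_digraph.axioms(1))

lemma arcs_V: "(x, y) \<in> parcs X \<Longrightarrow> x \<in> V \<and> y \<in> V"
proof -
  interpret pair_graph X by (rule graph)
  show "(x, y) \<in> parcs X \<Longrightarrow> x \<in> V \<and> y \<in> V" using in_arcsD1 in_arcsD2 by blast
qed

lemma D_V: "(x, y) \<in> D \<Longrightarrow> x \<in> V \<and> y \<in> V"
  using arcs_V arcs by blast

lemma D_iff:
  assumes g: "g \<in> automorphisms X" and xy: "x \<in> V" "y \<in> V"
  shows "(g x, g y) \<in> D \<longleftrightarrow> (x, y) \<in> D"
proof
  assume "(g x, g y) \<in> D"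
  then have "(x, y) \<in> parcs X" using aut_arcs[OF g xy] arcs by blast
  moreover have "(y, x) \<notin> D" using invariant[OF g, of y x] antisym \<open>(g x, g y) \<in> D\<close> by blast
  ultimately show "(x, y) \<in> D" using arcs by blast
qed (rule invariant[OF g])

lemma aut_permutation: "g \<in> automorphisms X \<Longrightarrow> permutation g"
  using aut_permutes finite_V permutation_permutes by blast

lemma connected_closed:
  assumes "S \<subseteq> V" "x \<in> S" "\<And>v w. v \<in> S \<Longrightarrow> (v, w) \<in> parcs X \<Longrightarrow> w \<in> S"
  shows "S = V"
proof -
  interpret pair_graph X by (rule graph)
  have ends: "arcs_ends (mk_symmetric (with_proj X)) \<subseteq> parcs X"
    unfolding mk_symmetric_def arcs_ends_conv with_proj_def by (auto simp: arcs)
  have "v \<in> S" if v: "v \<in> V" for v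
  proof -
    have "strongly_connected (mk_symmetric (with_proj X))"
      using connected by (simp add: Digraph_Component.connected_def)
    then have "x \<rightarrow>\<^sup>*\<^bsub>mk_symmetric (with_proj X)\<^esub> v"
      using assms(1,2) v by (auto simp: strongly_connected_def mk_symmetric_def with_proj_def)
    then have "(x, v) \<in> rtrancl_on (verts (mk_symmetric (with_proj X))) (arcs_ends (mk_symmetric (with_proj X)))"
      unfolding reachable_def .
    then show "v \<in> S"
      by (induction rule: rtrancl_on_induct) (use assms(2,3) ends in blast)+
  qed
  then show ?thesis using assms(1) by blast
qed

end

text \<open>
  The orientation is the orbit of one arc \<open>(a, b)\<close>. If it contained an arc and its reverse, then some
  automorphism would reverse \<open>(a, b)\<close>, and edge-transitivity would become arc-transitivity.
\<close>
lemma hat_orientation: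
  assumes "connected_quartic_hat_graph X"
  obtains D where "half_arc_orientation X D"
proof -
  have graph: "pair_graph X" and conn: "Digraph_Component.connected (with_proj X)"
    and hat: "half_arc_transitive X"
    using assms unfolding connected_quartic_hat_graph_def by auto
  interpret pair_graph X by (rule graph)
  have et: "\<exists>f\<in>automorphisms X. {f a, f b} = {x, y}" if "(a, b) \<in> parcs X" "(x, y) \<in> parcs X" for a b x y
    using hat that unfolding half_arc_transitive_def edge_transitive_def by blast
  obtain a b x y where ab: "(a, b) \<in> parcs X" "(x, y) \<in> parcs X"
    and no: "\<not> (\<exists>f\<in>automorphisms X. f a = x \<and> f b = y)"
    using hat unfolding half_arc_transitive_def arc_transitive_def by blast
  have in_V: "(v, w) \<in> parcs X \<Longrightarrow> v \<in> pverts X \<and> w \<in> pverts X" for v w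
    using in_arcsD1 in_arcsD2 by blast
  define D where "D = {(f a, f b) | f. f \<in> automorphisms X}"
  have D_arcs: "D \<subseteq> parcs X" unfolding D_def using aut_arcs[of _ X a b] ab in_V by blast
  have sym: "(v, w) \<in> parcs X \<Longrightarrow> (w, v) \<in> parcs X" for v w
    using pair_sym_arcs unfolding symmetric_def by (simp add: arcs_ends_conv with_proj_def sym_def)
  have cover: "(p, q) \<in> D \<or> (q, p) \<in> D" if pq: "(p, q) \<in> parcs X" for p q
  proof -
    obtain f where "f \<in> automorphisms X" "{f a, f b} = {p, q}" using et[OF ab(1) pq] by blast
    then show ?thesis unfolding D_def by (auto simp: doubleton_eq_iff)
  qed
  have trans: "\<exists>g\<in>automorphisms X. g p = p' \<and> g q = q'" if pq: "(p, q) \<in> D" "(p', q') \<in> D" for p q p' q'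
  proof -
    obtain f f' where f: "f \<in> automorphisms X" "f' \<in> automorphisms X" "p = f a" "q = f b" "p' = f' a" "q' = f' b"
      using pq unfolding D_def by blast
    have "(f' \<circ> Hilbert_Choice.inv f) p = p'" "(f' \<circ> Hilbert_Choice.inv f) q = q'"
      using f permutes_inverses(2)[OF aut_permutes[OF f(1)]] by simp_all
    then show ?thesis using comp_aut[OF f(2) inv_aut[OF f(1)]] by blast
  qed
  have inv: "(g p, g q) \<in> D" if g: "g \<in> automorphisms X" "(p, q) \<in> D" for g p q
  proof -
    obtain f where "f \<in> automorphisms X" "p = f a" "q = f b" using g(2) unfolding D_def by blast
    then have "(g p, g q) = ((g \<circ> f) a, (g \<circ> f) b)" "g \<circ> f \<in> automorphisms X"
      using comp_aut[OF g(1)] by auto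
    then show ?thesis unfolding D_def by blast
  qed
  have antisym: "(q, p) \<notin> D" if pq: "(p, q) \<in> D" for p q
  proof
    assume "(q, p) \<in> D"
    have "(a, b) \<in> D" unfolding D_def using id_aut[of X] by (intro CollectI exI[of _ id]) simp
    then obtain g where g: "g \<in> automorphisms X" "g a = q" "g b = p" using trans \<open>(q, p) \<in> D\<close> by blast
    obtain g' where g': "g' \<in> automorphisms X" "g' p = a" "g' q = b" using trans[OF pq \<open>(a, b) \<in> D\<close>] by blast
    obtain f where f: "f \<in> automorphisms X" "{f a, f b} = {x, y}" using et[OF ab] by blast
    then have "f a = y" "f b = x" using no by (auto simp: doubleton_eq_iff)
    then have "(f \<circ> (g' \<circ> g)) a = x" "(f \<circ> (g' \<circ> g)) b = y" using g g' by simp_all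
    then show False using no comp_aut[OF f(1) comp_aut[OF g'(1) g(1)]] by blast
  qed
  have "parcs X = D \<union> D\<inverse>" using D_arcs cover sym by auto
  then have "half_arc_orientation X D"
    using graph conn antisym inv trans unfolding half_arc_orientation_def by simp
  then show thesis by (rule that)
qed

text \<open>
  The properties of \<open>(\<rho>, \<sigma>)\<close> that are inherited by every pair \<open>(\<rho>, \<rho>\<^sup>j\<sigma>\<^sup>i)\<close>.
\<close>
locale oriented_metacirculant = half_arc_orientation X D
  for X :: "'a pair_pre_digraph" and D +
  fixes n :: nat and \<rho> \<sigma> :: "'a \<Rightarrow> 'a" and r :: int
  assumes n2: "2 \<le> n"
    and r_range: "0 \<le> r" "r < int n" and r_coprime: "coprime r (int n)"
    and rho: "\<rho> \<in> automorphisms X" and sigma: "\<sigma> \<in> automorphisms X"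
    and orbit_card: "v \<in> pverts X \<Longrightarrow> card (orbit \<rho> v) = n"
    and sigma_rho: "\<sigma> \<circ> \<rho> = (\<rho> ^^ nat r) \<circ> \<sigma>"
begin

lemma n_pos: "int n > 0" using n2 by simp

lemma self_orbit: "v \<in> orbit \<rho> v"
  by (rule permutation_self_in_orbit[OF aut_permutation[OF rho]])

lemma orbit_eq: "w \<in> orbit \<rho> v \<Longrightarrow> orbit \<rho> w = orbit \<rho> v"
  by (rule orbit_cyclic_eq3[OF cyclic_on_orbit'[OF aut_permutation[OF rho]]])

definition R :: "int \<Rightarrow> 'a \<Rightarrow> 'a" where
  "R j = \<rho> ^^ nat (j mod int n)"

lemma rho_pow_eq:
  assumes "v \<in> V" shows "(\<rho> ^^ a) v = (\<rho> ^^ b) v \<longleftrightarrow> [a = b] (mod n)"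
  using funpow_eq_iff_cong[OF self_orbit] orbit_card[OF assms] by simp

lemma R_nat: "v \<in> V \<Longrightarrow> R (int a) v = (\<rho> ^^ a) v"
  unfolding R_def by (simp add: rho_pow_eq nat_mod_distrib cong_def)

lemma R_aut: "R j \<in> automorphisms X"
  unfolding R_def by (rule funpow_aut[OF rho])

lemma sigma_pow_aut: "\<sigma> ^^ i \<in> automorphisms X"
  by (rule funpow_aut[OF sigma])

lemmas R_in [simp] = aut_in[OF R_aut]
lemmas sigma_pow_in [simp] = aut_in[OF sigma_pow_aut]
lemmas sigma_in [simp] = aut_in[OF sigma]

lemma R_eq:
  assumes v: "v \<in> V" shows "R j v = R k v \<longleftrightarrow> [j = k] (mod int n)"
proof -
  have "nat (l mod int n) < n" for l using n_pos by (simp add: nat_less_iff)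
  then have "R j v = R k v \<longleftrightarrow> nat (j mod int n) = nat (k mod int n)"
    by (simp add: R_def rho_pow_eq[OF v] cong_def)
  also have "\<dots> \<longleftrightarrow> j mod int n = k mod int n" using n_pos by (simp add: eq_nat_nat_iff)
  finally show ?thesis by (simp add: cong_def)
qed

lemma R_0: "R 0 v = v" by (simp add: R_def)

lemma R_R:
  assumes v: "v \<in> V" shows "R j (R k v) = R (j + k) v"
proof -
  have "R j (R k v) = (\<rho> ^^ (nat (j mod int n) + nat (k mod int n))) v"
    by (simp add: R_def funpow_add)
  also have "\<dots> = R (int (nat (j mod int n) + nat (k mod int n))) v"
    by (rule R_nat[OF v, symmetric])
  also have "\<dots> = R (j + k) v" using R_eq[OF v] n_pos by (simp add: cong_def mod_simps)
  finally show ?thesis .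
qed

lemma sigma_R:
  assumes v: "v \<in> V" shows "\<sigma> (R j v) = R (r * j) (\<sigma> v)"
proof -
  have "\<sigma> ((\<rho> ^^ a) v) = (\<rho> ^^ (nat r * a)) (\<sigma> v)" for a
  proof (induction a)
    case (Suc a)
    have "\<sigma> ((\<rho> ^^ Suc a) v) = (\<sigma> \<circ> \<rho>) ((\<rho> ^^ a) v)" by simp
    also have "\<dots> = (\<rho> ^^ nat r) (\<sigma> ((\<rho> ^^ a) v))" unfolding sigma_rho by simp
    also have "\<dots> = (\<rho> ^^ (nat r * Suc a)) (\<sigma> v)" using Suc by (simp add: funpow_add)
    finally show ?case .
  qed simp
  then have "\<sigma> (R j v) = (\<rho> ^^ (nat r * nat (j mod int n))) (\<sigma> v)" by (simp add: R_def)
  also have "\<dots> = R (int (nat r * nat (j mod int n))) (\<sigma> v)"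
    using v by (intro R_nat[symmetric]) simp
  also have "\<dots> = R (r * j) (\<sigma> v)"
    using v R_eq n_pos r_range by (simp add: cong_def mod_simps)
  finally show ?thesis .
qed

lemma sigma_pow_R: "v \<in> V \<Longrightarrow> (\<sigma> ^^ i) (R j v) = R (r ^ i * j) ((\<sigma> ^^ i) v)"
  by (induction i) (simp_all add: sigma_R mult.assoc)

lemma orbit_rho: "v \<in> V \<Longrightarrow> orbit \<rho> v = {R j v | j. True}"
proof -
  assume v: "v \<in> V"
  have "orbit \<rho> v = {(\<rho> ^^ k) v | k. True}"
    by (rule orbit_altdef_permutation[OF aut_permutation[OF rho]])
  moreover have "(\<rho> ^^ k) v \<in> {R j v | j. True}" for k
    by (intro CollectI exI[of _ "int k"]) (simp add: R_nat[OF v])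
  moreover have "R j v \<in> {(\<rho> ^^ k) v | k. True}" for j
    unfolding R_def by (intro CollectI exI[of _ "nat (j mod int n)"]) simp
  ultimately show ?thesis by auto
qed

lemma orbit_image_sigma:
  assumes v: "v \<in> V" shows "\<sigma> ` orbit \<rho> v = orbit \<rho> (\<sigma> v)"
proof -
  have "\<exists>k. R j (\<sigma> v) = R (r * k) (\<sigma> v)" for j
  proof -
    obtain r' where "[r * r' = 1] (mod int n)" using r_coprime cong_solve_coprime_int by blast
    then have "[r * (r' * j) = j] (mod int n)"
      using cong_scalar_right[of "r * r'" 1 "int n" j] by (simp add: mult.assoc)
    then have "R j (\<sigma> v) = R (r * (r' * j)) (\<sigma> v)" using R_eq v by (simp add: cong_sym_eq)
    then show ?thesis by blast
  qed
  then show ?thesis using v sigma_R unfolding orbit_rho[OF v] orbit_rho[OF sigma_in[OF v]]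
    by (auto simp: image_iff) metis
qed

lemma orbit_R: "v \<in> V \<Longrightarrow> orbit \<rho> (R j v) = orbit \<rho> v"
  using orbit_eq orbit_rho by blast

lemma orbit_sigma_pow: "v \<in> V \<Longrightarrow> ((`) \<sigma> ^^ i) (orbit \<rho> v) = orbit \<rho> ((\<sigma> ^^ i) v)"
  by (induction i) (simp_all add: orbit_image_sigma)

lemma sigma_period:
  obtains N where "0 < N" "(\<sigma> ^^ N) v = v"
proof -
  have "\<exists>k. v = (\<sigma> ^^ k) v \<and> 0 < k"
    using permutation_self_in_orbit[OF aut_permutation[OF sigma], of v]
    by (simp only: orbit_altdef mem_Collect_eq)
  then show thesis using that by metis
qed

definition move :: "int \<Rightarrow> nat \<Rightarrow> 'a \<Rightarrow> 'a" where
  "move j i = R j \<circ> (\<sigma> ^^ i)"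

lemma move_aut: "move j i \<in> automorphisms X"
  unfolding move_def by (rule comp_aut[OF R_aut sigma_pow_aut])

lemma move_move: "v \<in> V \<Longrightarrow> move j i (move j' i' v) = move (j + r ^ i * j') (i + i') v"
  by (simp add: move_def sigma_pow_R R_R funpow_add)

text \<open>
  As \<open>r\<^sup>i\<close> is invertible modulo \<open>n\<close>, every power of \<open>\<rho>\<close> passes through \<open>\<sigma>\<^sup>i\<close> in either direction.
\<close>
lemma move_orbit:
  assumes "v \<in> V" "w \<in> V" "move j i v \<in> orbit \<rho> (move j i w)"
  shows "v \<in> orbit \<rho> w"
proof -
  have "orbit \<rho> ((\<sigma> ^^ i) v) = orbit \<rho> ((\<sigma> ^^ i) w)"
    using orbit_eq[OF assms(3)] assms(1,2) by (simp add: move_def orbit_R)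
  then have "(\<sigma> ^^ i) v \<in> orbit \<rho> ((\<sigma> ^^ i) w)" using self_orbit by metis
  then obtain k where "(\<sigma> ^^ i) v = R k ((\<sigma> ^^ i) w)"
    using orbit_rho[of "(\<sigma> ^^ i) w"] assms(2) by auto
  moreover obtain k' where "[r ^ i * k' = k] (mod int n)"
  proof -
    have "coprime (r ^ i) (int n)" using r_coprime by simp
    then obtain r' where "[r ^ i * r' = 1] (mod int n)" using cong_solve_coprime_int by blast
    then have "[r ^ i * (r' * k) = k] (mod int n)"
      using cong_scalar_right[of "r ^ i * r'" 1 "int n" k] by (simp add: mult.assoc)
    then show thesis using that by blast
  qed
  ultimately have "(\<sigma> ^^ i) v = (\<sigma> ^^ i) (R k' w)"
    using assms(2) R_eq[of "(\<sigma> ^^ i) w" k "r ^ i * k'"] by (simp add: sigma_pow_R cong_sym_eq)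
  then have "v = R k' w" using aut_inj[OF sigma_pow_aut] by blast
  then show ?thesis using orbit_rho[OF assms(2)] by blast
qed

end

section \<open>Coordinates\<close>

text \<open>
  Inner arcs of row \<open>i\<close> shift by \<open>s r\<^sup>i\<close>. Row numbers are integers, whereas \<open>r\<close> has powers with natural
  exponents only; the exponent is reduced modulo \<open>m\<close>, as \<open>r\<^sup>m = 1\<close>.
\<close>
definition row_power :: "nat \<Rightarrow> int \<Rightarrow> int \<Rightarrow> int" where
  "row_power m r i = r ^ nat (i mod int m)"

definition out_arcs_of :: "nat \<Rightarrow> int \<Rightarrow> int \<Rightarrow> (int \<Rightarrow> int \<Rightarrow> 'a) \<Rightarrow> 'a rel" where
  "out_arcs_of m r s u =
     {(u i j, u (i + 1) j) | i j. True} \<union> {(u i j, u i (j + s * row_power m r i)) | i j. True}"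

text \<open>
  Coordinates are not reduced: the row number \<open>i + m\<close> stands for row \<open>i\<close>, shifted by \<open>t\<close>. The last
  assumption expresses connectedness by directed walks: all vertices are reached from \<open>u 0 0\<close>.
\<close>
locale class_II_coordinates = half_arc_orientation X "out_arcs_of m r s u"
  for X :: "'a pair_pre_digraph" and m n :: nat and r s t :: int and u :: "int \<Rightarrow> int \<Rightarrow> 'a" +
  assumes m3: "3 \<le> m" and n3: "3 \<le> n"
    and r_coprime: "coprime r (int n)"
    and r_power: "[r ^ m = 1] (mod int n)"
    and t_r: "[t * (r - 1) = 0] (mod int n)"
    and u_eq: "u i j = u i' j' \<longleftrightarrow> (\<exists>k. i' = i + k * int m \<and> [j = j' + t * k] (mod int n))"
    and verts: "pverts X = {u i j | i j. True}"
    and generated: "u 0 0 \<in> S \<Longrightarrow> (\<And>i j. u i j \<in> S \<Longrightarrow> u (i + 1) j \<in> S) \<Longrightarrow>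
        (\<And>i j. u i j \<in> S \<Longrightarrow> u i (j + s * row_power m r i) \<in> S) \<Longrightarrow> u i j \<in> S"
begin

abbreviation "D \<equiv> out_arcs_of m r s u"
abbreviation "e \<equiv> row_power m r"

lemma m_pos: "int m > 0" and n_pos: "int n > 0"
  using m3 n3 by auto

lemma u_in [simp]: "u i j \<in> V"
  using verts by blast

lemma V_E: assumes "v \<in> V" obtains i j where "v = u i j"
  using assms verts by blast

lemma u_cong: "[j = j'] (mod int n) \<Longrightarrow> u i j = u i j'"
  unfolding u_eq by (rule exI[of _ 0]) simp

lemma u_wrap: "u (i + int m) j = u i (j + t)"
  unfolding u_eq by (rule exI[of _ "-1"]) simp

lemma u_wrap_mult: "u (i + k * int m) j = u i (j + t * k)"
  unfolding u_eq by (rule exI[of _ "-k"]) simp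

lemma u_same_row: "u i j = u i j' \<longleftrightarrow> [j = j'] (mod int n)"
  unfolding u_eq using m3 by auto

lemma u_row: "u i j = u i' j' \<Longrightarrow> [i = i'] (mod int m)"
  unfolding u_eq by (auto simp: cong_iff_dvd_diff)

lemma e_wrap: "e (i + k * int m) = e i"
  by (simp add: row_power_def)

lemma e_0: "e 0 = 1"
  by (simp add: row_power_def)

lemma e_Suc: "[e (i + 1) = r * e i] (mod int n)"
proof (cases "i mod int m = int m - 1")
  case True
  then have "(i + 1) mod int m = 0"
    by (metis diff_add_cancel mod_add_left_eq mod_self)
  moreover have "r * e i = r ^ m"
    using True m3 by (simp add: row_power_def nat_diff_distrib flip: power_Suc)
  ultimately show ?thesis using r_power by (simp add: row_power_def cong_sym)
next
  case False
  then have "i mod int m + 1 < int m" "0 \<le> i mod int m"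
    using False pos_mod_bound[OF m_pos, of i] pos_mod_sign[OF m_pos, of i] by linarith+
  then have "(i + 1) mod int m = i mod int m + 1"
    by (metis add_nonneg_nonneg mod_add_left_eq mod_pos_pos_trivial zero_le_one)
  then show ?thesis using \<open>0 \<le> i mod int m\<close>
    by (simp add: row_power_def nat_add_distrib)
qed

text \<open>
  The Boolean is the colour of an arc: \<^term>\<open>True\<close> for outer and \<^term>\<open>False\<close> for inner arcs.
\<close>
definition step :: "bool \<Rightarrow> 'a \<Rightarrow> 'a" where
  "step c v = (let (i, j) = SOME (i, j). v = u i j
     in if c then u (i + 1) j else u i (j + s * e i))"

lemma step_u: "step c (u i j) = (if c then u (i + 1) j else u i (j + s * e i))"
proof -
  obtain i' j' where ij: "(SOME (i', j'). u i j = u i' j') = (i', j')"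
    by fastforce
  have "case (i', j') of (i', j') \<Rightarrow> u i j = u i' j'"
    unfolding ij[symmetric] by (rule someI[of _ "(i, j)"]) simp
  then obtain k where k: "i' = i + k * int m" "[j = j' + t * k] (mod int n)"
    unfolding u_eq by auto
  have "u (i + 1) j = u (i' + 1) j'"
    unfolding u_eq using k by (intro exI[of _ k]) auto
  moreover have "[j + s * e i = (j' + s * e i') + t * k] (mod int n)"
    using cong_add[OF k(2) cong_refl[of "s * e i"]] k(1) e_wrap
    by (simp add: algebra_simps)
  then have "u i (j + s * e i) = u i' (j' + s * e i')"
    unfolding u_eq using k by (intro exI[of _ k]) auto
  ultimately show ?thesis unfolding step_def ij by (simp add: Let_def)
qed

lemma step_True [simp]: "step True (u i j) = u (i + 1) j"
  and step_False [simp]: "step False (u i j) = u i (j + s * e i)"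
  by (simp_all add: step_u)

lemma step_in [simp]: "v \<in> V \<Longrightarrow> step c v \<in> V"
  by (erule V_E) (simp add: step_u)

lemma D_step: "D = {(v, step c v) | v c. v \<in> V}"
proof (rule subset_antisym; rule subsetI)
  fix a assume "a \<in> D"
  then consider i j where "a = (u i j, step True (u i j))" | i j where "a = (u i j, step False (u i j))"
    unfolding out_arcs_of_def by auto
  then obtain v c where "a = (v, step c v)" "v \<in> V" by cases (metis u_in)+
  then show "a \<in> {(v, step c v) | v c. v \<in> V}" by blast
next
  fix a assume "a \<in> {(v, step c v) | v c. v \<in> V}"
  then obtain v c where a: "a = (v, step c v)" "v \<in> V" by blast
  from V_E[OF a(2)] obtain i j where "v = u i j" .
  then show "a \<in> D" using a unfolding out_arcs_of_def by (cases c) auto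
qed

lemma step_True_eq: "v \<in> V \<Longrightarrow> step True v = u i j \<longleftrightarrow> v = u (i - 1) j"
proof (erule V_E)
  fix i' j' assume v: "v = u i' j'"
  have "(i = i' + 1 + k * int m) = (i - 1 = i' + k * int m)" for k by auto
  then show "step True v = u i j \<longleftrightarrow> v = u (i - 1) j"
    unfolding v step_True u_eq by simp
qed

lemma step_False_eq: "v \<in> V \<Longrightarrow> step False v = u i j \<longleftrightarrow> v = u i (j - s * e i)"
proof (erule V_E)
  fix i' j' assume v: "v = u i' j'"
  have "(i = i' + k * int m \<and> [j' + s * e i' = j + t * k] (mod int n)) \<longleftrightarrow>
     (i = i' + k * int m \<and> [j' = j - s * e i + t * k] (mod int n))" for k
    using e_wrap[of i' k] by (auto simp: cong_iff_dvd_diff algebra_simps)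
  then show "step False v = u i j \<longleftrightarrow> v = u i (j - s * e i)"
    unfolding v step_False u_eq by simp
qed

lemma step_inj:
  assumes v: "v \<in> V" and w: "w \<in> V"
  shows "step c v = step c w \<longleftrightarrow> v = w"
proof -
  from V_E[OF w] obtain i j where w: "w = u i j" .
  show ?thesis
    using step_True_eq[OF v, of "i + 1" j] step_False_eq[OF v, of i "j + s * e i"]
    by (cases c) (simp_all add: w)
qed

lemma step_surj: assumes "v \<in> V" obtains w where "w \<in> V" "step c w = v"
proof -
  from V_E[OF assms] obtain i j where v: "v = u i j" .
  show thesis
  proof (cases c)
    case True then show thesis using that[of "u (i - 1) j"] v by simp
  next
    case False then show thesis using that[of "u i (j - s * e i)"] v by simp
  qed
qed

definition row :: "'a \<Rightarrow> int" where
  "row v = (SOME i. \<exists>j. v = u i j) mod int m"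

lemma row_u [simp]: "row (u i j) = i mod int m"
proof -
  have "\<exists>j'. u i j = u (SOME i'. \<exists>j'. u i j = u i' j') j'"
    by (rule someI_ex) blast
  then show ?thesis unfolding row_def using u_row by (metis cong_def)
qed

lemma row_step: "v \<in> V \<Longrightarrow> [row (step c v) = row v + of_bool c] (mod int m)"
  by (erule V_E) (simp add: step_u cong_def mod_add_left_eq)

lemma steps_distinct: "v \<in> V \<Longrightarrow> step True v \<noteq> step False v"
proof
  assume "v \<in> V" "step True v = step False v"
  then have "[row v + of_bool True = row v + of_bool False] (mod int m)"
    using row_step[of v True] row_step[of v False] \<open>v \<in> V\<close> by (simp add: cong_def)
  then have "int m dvd 1" by (simp add: cong_iff_dvd_diff)
  then show False using m3 by simp
qed

lemma vertex_induct [consumes 1, case_names base step]: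
  assumes "v \<in> V" "P (u 0 0)" "\<And>v c. v \<in> V \<Longrightarrow> P v \<Longrightarrow> P (step c v)"
  shows "P v"
proof -
  from V_E[OF assms(1)] obtain i j where v: "v = u i j" .
  have "u i j \<in> {v \<in> V. P v}"
  proof (rule generated)
    show "u (i + 1) j \<in> {v \<in> V. P v}" if "u i j \<in> {v \<in> V. P v}" for i j
      using that assms(3)[of "u i j" True] by simp
    show "u i (j + s * e i) \<in> {v \<in> V. P v}" if "u i j \<in> {v \<in> V. P v}" for i j
      using that assms(3)[of "u i j" False] by simp
  qed (use assms(2) in simp)
  then show ?thesis using v by simp
qed

definition swaps :: "('a \<Rightarrow> 'a) \<Rightarrow> 'a \<Rightarrow> bool" where
  "swaps g v \<longleftrightarrow> g (step True v) \<noteq> step True (g v)"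

lemma aut_step:
  assumes g: "g \<in> automorphisms X" and v: "v \<in> V"
  shows "g (step c v) = step (c \<noteq> swaps g v) (g v)"
proof -
  have "\<exists>c'. g (step c v) = step c' (g v)" for c
    using invariant[OF g, of v "step c v"] v unfolding D_step by blast
  then obtain a b where ab: "g (step True v) = step a (g v)" "g (step False v) = step b (g v)"
    by metis
  have "step True v \<noteq> step False v" using v by (rule steps_distinct)
  then have "step a (g v) \<noteq> step b (g v)" using aut_inj[OF g] ab by metis
  then have b: "b = (\<not> a)" by (cases a; cases b) simp_all
  have "step True (g v) \<noteq> step False (g v)" using v g by (simp add: steps_distinct)
  then have "swaps g v = (\<not> a)" unfolding swaps_def ab by (cases a) auto
  then show ?thesis using ab b by (cases c) auto
qed

text \<open>
  The arcs from \<open>v\<close> and \<open>w\<close> to their common head differ in colour, and so do their images. Hence \<open>g\<close>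
  keeps or swaps the colours of an alternating cycle as a whole.
\<close>
lemma swaps_common_head:
  assumes g: "g \<in> automorphisms X" and v: "v \<in> V" "w \<in> V" and "step True w = step False v"
  shows "swaps g w = swaps g v"
proof (rule ccontr)
  assume "swaps g w \<noteq> swaps g v"
  then have "step (\<not> swaps g w) (g w) = step (\<not> swaps g w) (g v)"
    using aut_step[OF g v(1), of False] aut_step[OF g v(2), of True] assms(4) by simp
  then have "w = v" using g v aut_inj[OF g] by (simp add: step_inj)
  then show False using assms(4) v steps_distinct by blast
qed

text \<open>
  Inner arcs of row \<open>i\<close>, and inner arcs of row \<open>i + 1\<close> conjugated by outer ones, act on row \<open>i\<close> as
  shifts, which commute. The resulting closed walk of length 8 passes through \<open>x\<close>.
\<close>
lemma octagon:
  assumes x: "x \<in> V"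
  obtains w where "w \<in> V" "step True w = step False (step True x)"
    "step True (step False w) = step False (step True (step False x))"
proof -
  from V_E[OF x] obtain i j where ij: "x = u i j" .
  show thesis
    by (rule that[of "u i (j + s * e (i + 1))"]) (simp_all add: ij algebra_simps)
qed

lemma octagon_swaps:
  assumes g: "g \<in> automorphisms X" and x: "x \<in> V" and w: "w \<in> V"
    and "step True w = step False (step True x)"
    and "step True (step False w) = step False (step True (step False x))"
  shows "swaps g w = swaps g (step True x)"
    and "swaps g (step False w) = swaps g (step True (step False x))"
  using swaps_common_head[OF g] assms by (metis step_in)+

text \<open>
  The octagon has its edges on four alternating cycles, on each of which \<open>g\<close> either keeps or swaps the
  colours. The four bits determine the walk onto which \<open>g\<close> maps it.
\<close>
lemma octagon_image:
  assumes g: "g \<in> automorphisms X" and x: "x \<in> V"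
    and \<epsilon>: "swaps g (step True x) = \<epsilon>\<^sub>1" "swaps g (step True (step False x)) = \<epsilon>\<^sub>2"
      "swaps g (step False x) = \<epsilon>\<^sub>3" "swaps g x = \<epsilon>\<^sub>4"
  obtains w where "w \<in> V"
    "step (\<not> \<epsilon>\<^sub>1) w = step \<epsilon>\<^sub>1 (step (\<not> \<epsilon>\<^sub>4) (g x))"
    "step (\<not> \<epsilon>\<^sub>2) (step \<epsilon>\<^sub>1 w) = step \<epsilon>\<^sub>2 (step (\<not> \<epsilon>\<^sub>3) (step \<epsilon>\<^sub>4 (g x)))"
proof -
  obtain w where w: "w \<in> V" "step True w = step False (step True x)"
    "step True (step False w) = step False (step True (step False x))"
    using octagon[OF x] .
  note sw = octagon_swaps[OF g x w]
  have "g (step True w) = g (step False (step True x))" using w(2) by simp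
  then have 1: "step (\<not> \<epsilon>\<^sub>1) (g w) = step \<epsilon>\<^sub>1 (step (\<not> \<epsilon>\<^sub>4) (g x))"
    using x w(1) sw(1) \<epsilon> by (simp add: aut_step[OF g])
  have "g (step True (step False w)) = g (step False (step True (step False x)))" using w(3) by simp
  then have "step (\<not> \<epsilon>\<^sub>2) (step \<epsilon>\<^sub>1 (g w)) = step \<epsilon>\<^sub>2 (step (\<not> \<epsilon>\<^sub>3) (step \<epsilon>\<^sub>4 (g x)))"
    using x w(1) sw \<epsilon> by (simp add: aut_step[OF g])
  then show thesis using 1 that[of "g w"] w(1) g by simp
qed

end

section \<open>Colour swaps along the octagon\<close>

context class_II_coordinates begin

text \<open>
  An outer arc changes the row number by one and an inner arc does not change it; the sum of the
  changes along the closed image is a multiple of \<open>m\<close>.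
\<close>
lemma octagon_rows:
  assumes g: "g \<in> automorphisms X" and x: "x \<in> V"
    and \<epsilon>: "swaps g (step True x) = \<epsilon>\<^sub>1" "swaps g (step True (step False x)) = \<epsilon>\<^sub>2"
      "swaps g (step False x) = \<epsilon>\<^sub>3" "swaps g x = \<epsilon>\<^sub>4"
  shows "int m dvd 3 * of_bool \<epsilon>\<^sub>1 - 2 * of_bool \<epsilon>\<^sub>2 + of_bool \<epsilon>\<^sub>3 - 2 * of_bool \<epsilon>\<^sub>4"
proof -
  obtain w where w: "w \<in> V"
    "step (\<not> \<epsilon>\<^sub>1) w = step \<epsilon>\<^sub>1 (step (\<not> \<epsilon>\<^sub>4) (g x))"
    "step (\<not> \<epsilon>\<^sub>2) (step \<epsilon>\<^sub>1 w) = step \<epsilon>\<^sub>2 (step (\<not> \<epsilon>\<^sub>3) (step \<epsilon>\<^sub>4 (g x)))"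
    using octagon_image[OF assms] .
  have gx: "g x \<in> V" using g x by simp
  have d: "int m dvd row (step b (step a v)) - row v - of_bool a - of_bool b" if "v \<in> V" for a b v
  proof -
    have "int m dvd (row (step b (step a v)) - (row (step a v) + of_bool b))
        + (row (step a v) - (row v + of_bool a))"
      using row_step[OF that, of a] row_step[of "step a v" b] that
      by (intro dvd_add) (simp_all add: cong_iff_dvd_diff)
    then show ?thesis by (simp add: algebra_simps)
  qed
  have d1: "int m dvd row (step a v) - row v - of_bool a" if "v \<in> V" for a v
    using row_step[OF that, of a] by (simp add: cong_iff_dvd_diff algebra_simps)
  define A where "A = row (step (\<not> \<epsilon>\<^sub>1) w)"
  define B where "B = row (step (\<not> \<epsilon>\<^sub>2) (step \<epsilon>\<^sub>1 w))"
  define C where "C = row (step \<epsilon>\<^sub>4 (g x))"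
  have 1: "int m dvd A - row w - of_bool (\<not> \<epsilon>\<^sub>1)"
    using d1[OF w(1)] by (simp add: A_def)
  have 2: "int m dvd A - row (g x) - of_bool (\<not> \<epsilon>\<^sub>4) - of_bool \<epsilon>\<^sub>1"
    unfolding A_def w(2) by (rule d[OF gx])
  have 3: "int m dvd B - row w - of_bool \<epsilon>\<^sub>1 - of_bool (\<not> \<epsilon>\<^sub>2)"
    unfolding B_def by (rule d[OF w(1)])
  have 4: "int m dvd B - C - of_bool (\<not> \<epsilon>\<^sub>3) - of_bool \<epsilon>\<^sub>2"
    unfolding B_def C_def w(3) using gx by (intro d) simp
  have 5: "int m dvd C - row (g x) - of_bool \<epsilon>\<^sub>4"
    unfolding C_def by (rule d1[OF gx])
  have "int m dvd (A - row w - of_bool (\<not> \<epsilon>\<^sub>1)) - (A - row (g x) - of_bool (\<not> \<epsilon>\<^sub>4) - of_bool \<epsilon>\<^sub>1)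
     - (B - row w - of_bool \<epsilon>\<^sub>1 - of_bool (\<not> \<epsilon>\<^sub>2)) + (B - C - of_bool (\<not> \<epsilon>\<^sub>3) - of_bool \<epsilon>\<^sub>2)
     + (C - row (g x) - of_bool \<epsilon>\<^sub>4)"
    by (intro dvd_add dvd_diff 1 2 3 4 5)
  also have "\<dots> = 3 * of_bool \<epsilon>\<^sub>1 - 2 * of_bool \<epsilon>\<^sub>2 + of_bool \<epsilon>\<^sub>3 - 2 * of_bool \<epsilon>\<^sub>4"
    by (cases \<epsilon>\<^sub>1; cases \<epsilon>\<^sub>2; cases \<epsilon>\<^sub>3; cases \<epsilon>\<^sub>4) simp_all
  finally show ?thesis .
qed

text \<open>
  The sum lies between \<open>- 4\<close> and 4, and all 16 combinations of bits can be inspected.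
\<close>
lemma octagon_pattern:
  assumes "g \<in> automorphisms X" "x \<in> V"
  shows "swaps g (step True (step False x)) = swaps g x"
    and "m \<noteq> 4 \<Longrightarrow> swaps g (step False x) = swaps g x"
    and "m \<noteq> 3 \<Longrightarrow> swaps g (step True x) = swaps g (step False x)"
proof -
  let ?e1 = "swaps g (step True x)" and ?e2 = "swaps g (step True (step False x))"
    and ?e3 = "swaps g (step False x)" and ?e4 = "swaps g x"
  have *: "int m dvd 3 * of_bool ?e1 - 2 * of_bool ?e2 + of_bool ?e3 - 2 * of_bool ?e4"
    by (rule octagon_rows[OF assms]) simp_all
  have small: "\<not> int m dvd 1" "\<not> int m dvd -1" "\<not> int m dvd 2" "\<not> int m dvd -2"
    "int m dvd 3 \<Longrightarrow> m = 3" "int m dvd -3 \<Longrightarrow> m = 3" "int m dvd 4 \<Longrightarrow> m = 4" "int m dvd -4 \<Longrightarrow> m = 4"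
  proof -
    show "int m dvd 3 \<Longrightarrow> m = 3" "int m dvd -3 \<Longrightarrow> m = 3"
      using m3 zdvd_imp_le[of "int m" 3] by auto
    have "m = 3 \<or> m = 4" if "int m dvd 4" using m3 zdvd_imp_le[OF that] by auto
    then show "int m dvd 4 \<Longrightarrow> m = 4" "int m dvd -4 \<Longrightarrow> m = 4" by auto
    show "\<not> int m dvd 1" "\<not> int m dvd -1" "\<not> int m dvd 2" "\<not> int m dvd -2"
      using m3 zdvd_imp_le[of "int m" 2] by auto
  qed
  show "?e2 = ?e4" using * small m3
    by (cases ?e1; cases ?e2; cases ?e3; cases ?e4) auto
  show "m \<noteq> 4 \<Longrightarrow> ?e3 = ?e4" using * small m3
    by (cases ?e1; cases ?e2; cases ?e3; cases ?e4) auto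
  show "m \<noteq> 3 \<Longrightarrow> ?e1 = ?e3" using * small m3
    by (cases ?e1; cases ?e2; cases ?e3; cases ?e4) auto
qed

text \<open>
  Here \<open>octagon_pattern\<close> makes swapping invariant under inner steps, and under outer steps that follow
  an inner one.
\<close>
lemma swaps_const_off_4:
  assumes "m \<noteq> 4" "g \<in> automorphisms X" "v \<in> V"
  shows "swaps g v = swaps g (u 0 0)"
  using assms(3)
proof (induction rule: vertex_induct)
  case (step v c)
  have F: "swaps g (step False w) = swaps g w" if "w \<in> V" for w
    using octagon_pattern(2) assms that by blast
  from step(1) obtain w where w: "w \<in> V" "step False w = v" by (rule step_surj)
  have "swaps g (step True v) = swaps g v"
    using octagon_pattern(1)[OF assms(2) w(1)] F[OF w(1)] w by simp
  then show ?case using F step by (cases c) auto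
qed simp

text \<open>
  For four rows, \<open>octagon_pattern\<close> makes swapping invariant under any two steps and independent of the
  colour of a single step. So either no step changes it or every step does.
\<close>
lemma swaps_alternate:
  assumes "m = 4" "g \<in> automorphisms X" "x \<in> V" "swaps g x \<noteq> swaps g (u 0 0)" "v \<in> V"
  shows "swaps g (step c v) = (\<not> swaps g v)"
proof -
  note pat = octagon_pattern[OF assms(2)]
  have TF: "swaps g (step True w) = swaps g (step False w)" if "w \<in> V" for w
    using pat(3) that assms(1) by simp
  have FF: "swaps g (step False (step False w)) = swaps g w" if "w \<in> V" for w
    using pat(1) TF that by simp
  have TT: "swaps g (step c' (step True w)) = swaps g w" if "w \<in> V" for w c'
  proof -
    obtain z where z: "z \<in> V" "step True z = step False (step True w)"
      "step True (step False z) = step False (step True (step False w))"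
      using octagon[OF \<open>w \<in> V\<close>] .
    have "swaps g (step False z) = swaps g (step True (step False w))"
      using octagon_swaps(2)[OF assms(2) \<open>w \<in> V\<close> z] .
    then have "swaps g (step False (step True w)) = swaps g w" using TF z(1,2) pat(1) that by metis
    then show ?thesis using TF that by (cases c') auto
  qed
  have alt: "swaps g (step c' (step b w)) = swaps g w" if "w \<in> V" for w b c'
    using TT FF TF that by (cases b; cases c') auto
  define A where "A v \<longleftrightarrow> (\<forall>c. swaps g (step c v) = (\<not> swaps g v))" for v
  have A_step: "A (step c w) \<longleftrightarrow> A w" if "w \<in> V" for c w
    unfolding A_def using alt[OF that] TF[OF that] by (metis (full_types))
  have "A v \<longleftrightarrow> A (u 0 0)"
    using assms(5) by (induction rule: vertex_induct) (simp_all add: A_step)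
  moreover have "A (u 0 0)"
  proof (rule ccontr)
    assume no: "\<not> A (u 0 0)"
    have "A w \<longleftrightarrow> A (u 0 0)" if "w \<in> V" for w
      using that by (induction rule: vertex_induct) (simp_all add: A_step)
    then have const: "swaps g (step c w) = swaps g w" if "w \<in> V" for w c
      using that no TF unfolding A_def by (metis (full_types))
    have "swaps g w = swaps g (u 0 0)" if "w \<in> V" for w
      using that by (induction rule: vertex_induct) (simp_all add: const)
    then show False using assms by blast
  qed
  ultimately show ?thesis unfolding A_def by blast
qed

text \<open>
  Along arcs the second coordinate changes by multiples of \<open>s\<close>, and \<open>t\<close> and \<open>n\<close> are its ambiguity; so
  only multiples of a common divisor can be reached from \<open>u 0 0\<close>.
\<close>
lemma generators_coprime:
  assumes "k dvd s" "k dvd t" "k dvd int n"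
  shows "is_unit k"
proof -
  let ?S = "{u i j | i j. k dvd j}"
  have "u 0 1 \<in> ?S"
  proof (rule generated)
    show "u i (j + s * e i) \<in> ?S" if "u i j \<in> ?S" for i j
    proof -
      from that obtain i' j' where "k dvd j'" "u i j = u i' j'" by blast
      then obtain l where "[j = j' + t * l] (mod int n)"
        unfolding u_eq by blast
      then have "k dvd j - (j' + t * l)"
        using dvd_trans[OF assms(3)] unfolding cong_iff_dvd_diff by blast
      then have "k dvd (j - (j' + t * l)) + j' + t * l + s * e i"
        using \<open>k dvd j'\<close> assms by (intro dvd_add) auto
      then show ?thesis by auto
    qed
  next
    show "u 0 0 \<in> ?S" by (metis (mono_tags, lifting) dvd_0_right mem_Collect_eq)
    show "u (i + 1) j \<in> ?S" if "u i j \<in> ?S" for i j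
    proof -
      from that obtain i' j' where *: "k dvd j'" "u i j = u i' j'" by blast
      then have "u (i + 1) j = u (i' + 1) j'" by (metis step_True)
      then show ?thesis using * by blast
    qed
  qed
  then obtain i' j' where "k dvd j'" "u 0 1 = u i' j'" by blast
  then obtain l where "[1 = j' + t * l] (mod int n)"
    unfolding u_eq by blast
  then have "k dvd 1 - (j' + t * l)"
    using dvd_trans[OF assms(3)] unfolding cong_iff_dvd_diff by blast
  then have "k dvd (1 - (j' + t * l)) + j' + t * l" using \<open>k dvd j'\<close> assms by (intro dvd_add) auto
  then show ?thesis by simp
qed

text \<open>
  Extended by the identity, \<open>h\<close> would be an automorphism that reverses arcs of \<open>D\<close>; that it also
  reflects adjacency follows by counting arcs.
\<close>
lemma no_reversal:
  assumes h: "\<And>v. v \<in> V \<Longrightarrow> h v \<in> V" "inj_on h V"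
    and rev: "\<And>v c. v \<in> V \<Longrightarrow> \<exists>c'. h v = step c' (h (step c v))"
  shows False
proof -
  define g where "g v = (if v \<in> V then h v else v)" for v
  have gV: "g ` V = V"
    using finite_V h by (intro card_subset_eq) (auto simp: g_def card_image inj_on_def)
  have "bij_betw g V V"
    unfolding bij_betw_def using gV h(2) by (auto simp: g_def inj_on_def)
  then have perm: "g permutes V"
    by (rule bij_imp_permutes) (simp add: g_def)
  have D_V: "D \<subseteq> V \<times> V" unfolding D_step by auto
  have sub: "map_prod g g ` D \<subseteq> D\<inverse>"
  proof
    fix a assume "a \<in> map_prod g g ` D"
    then obtain v c where a: "a = (h v, h (step c v))" "v \<in> V"
      unfolding D_step by (auto simp: g_def)
    then show "a \<in> D\<inverse>" using rev[OF a(2), of c] h(1) unfolding D_step by auto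
  qed
  have inj: "inj (map_prod g g)"
    using permutes_inj[OF perm] by (simp add: prod.inj_map)
  have "finite D" using D_V finite_V finite_subset by blast
  then have eq: "map_prod g g ` D = D\<inverse>"
    using sub inj by (intro card_subset_eq) (auto simp: card_image inj_on_subset)
  have D_iff: "(g x, g y) \<in> D\<inverse> \<longleftrightarrow> (x, y) \<in> D" for x y
    using inj_image_mem_iff[OF inj, of "(x, y)" D] unfolding eq by simp
  then have "(g x, g y) \<in> parcs X \<longleftrightarrow> (x, y) \<in> parcs X" for x y
    unfolding arcs using D_iff[of y x] D_iff[of x y] by auto
  then have "g \<in> automorphisms X"
    using perm unfolding automorphisms_def by simp
  moreover have "(u 0 0, step True (u 0 0)) \<in> D" unfolding D_step by (auto simp del: step_True)
  ultimately show False using invariant antisym D_iff by blast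
qed

text \<open>
  If \<open>r\<^sup>2 = 1\<close>, then rows \<open>i\<close> and \<open>- i\<close> have the same inner shifts, and negation of both coordinates
  reverses all arcs.
\<close>
lemma r_square: "\<not> [r\<^sup>2 = 1] (mod int n)"
proof
  assume r2: "[r\<^sup>2 = 1] (mod int n)"
  define h where "h v = (SOME w. \<exists>i j. v = u i j \<and> w = u (- i) (- j))" for v
  have h: "h (u i j) = u (- i) (- j)" for i j
  proof -
    have "\<exists>i' j'. u i j = u i' j' \<and> h (u i j) = u (- i') (- j')"
      unfolding h_def by (rule someI_ex) blast
    then obtain i' j' where ij: "u i j = u i' j'" "h (u i j) = u (- i') (- j')" by blast
    from ij(1) obtain k where k: "i' = i + k * int m" "[j = j' + t * k] (mod int n)"
      unfolding u_eq by blast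
    have "u (- i) (- j) = u (- i') (- j')"
      unfolding u_eq using k
      by (intro exI[of _ "-k"]) (auto simp: cong_iff_dvd_diff algebra_simps dvd_diff_commute)
    then show ?thesis using ij by simp
  qed
  have e_minus: "[e (- i) = e i] (mod int n)" for i
  proof -
    have "[e (- int k) = e (int k)] (mod int n)" for k
    proof (induction k)
      case (Suc k)
      let ?a = "e (- int (Suc k))"
      have "[?a = r\<^sup>2 * ?a] (mod int n)"
        using cong_scalar_right[OF r2, of ?a] by (simp add: cong_sym)
      also have "[r\<^sup>2 * ?a = r * e (- int k)] (mod int n)"
        using cong_scalar_left[OF e_Suc[of "- int (Suc k)"], of r]
        by (simp add: power2_eq_square mult.assoc cong_sym)
      also have "[r * e (- int k) = r * e (int k)] (mod int n)"
        using Suc by (rule cong_scalar_left)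
      also have "[r * e (int k) = e (int (Suc k))] (mod int n)"
        using e_Suc[of "int k"] by (simp add: cong_sym add.commute)
      finally show ?case .
    qed simp
    from this[of "nat i"] this[of "nat (- i)"] show ?thesis
      by (cases "i \<ge> 0") (auto simp: cong_sym)
  qed
  show False
  proof (rule no_reversal[of h])
    show "h v \<in> V" if "v \<in> V" for v using V_E[OF that] h by (metis u_in)
    have "h (h v) = v" if "v \<in> V" for v using V_E[OF that] h by (metis minus_minus)
    then show "inj_on h V" by (metis inj_onI)
    show "\<exists>c'. h v = step c' (h (step c v))" if "v \<in> V" for v c
    proof -
      from V_E[OF that] obtain i j where v: "v = u i j" .
      have "[- j = - j - s * e i + s * e (- i)] (mod int n)"
        using cong_scalar_left[OF e_minus[of i], of s]
        by (simp add: cong_iff_dvd_diff algebra_simps dvd_diff_commute)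
      then have "h v = step False (h (step False v))" unfolding v by (simp add: h u_same_row)
      moreover have "h v = step True (h (step True v))" unfolding v by (simp add: h)
      ultimately show ?thesis by (metis (full_types))
    qed
  qed
qed

end

section \<open>Vertices in four rows, and the vertex stabilizer\<close>

context class_II_coordinates begin

lemma r_t: "int n dvd t * (r - 1)"
  using t_r by (simp add: cong_iff_dvd_diff)

lemma square_zero_imp_double:
  assumes "int n dvd (r - 1)\<^sup>2" shows "\<not> int n dvd 2 * (r - 1)"
proof
  assume "int n dvd 2 * (r - 1)"
  then have "int n dvd (r - 1)\<^sup>2 + 2 * (r - 1)" using assms by (rule dvd_add[rotated])
  then have "int n dvd r\<^sup>2 - 1" by (simp add: power2_eq_square algebra_simps)
  then show False using r_square by (simp add: cong_iff_dvd_diff)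
qed

text \<open>
  If swaps alternate, then the image of the octagon at \<open>x\<close> only depends on whether \<open>g\<close> swaps at \<open>x\<close>.
  Both cases occur with \<open>g x\<close> in row 0, as this row contains inner arcs. Each of the two images is
  closed under one condition on \<open>t\<close>.
\<close>
lemma four_rows_relations:
  assumes m4: "m = 4" and g: "g \<in> automorphisms X"
    and alt: "\<And>v c. v \<in> V \<Longrightarrow> swaps g (step c v) = (\<not> swaps g v)"
  shows "int n dvd t - s * (r\<^sup>2 + 3)" and "int n dvd t - 2 * s * (r + 1)"
    and "\<exists>z\<in>V. swaps g z \<and> (\<exists>j. g z = u 0 j)"
proof -
  have w4: "u (i + 4) j = u i (j + t)" for i j using u_wrap[of i j] m4 by simp
  have ge: "e 0 = 1" "e 1 = r" "e 2 = r\<^sup>2" "e (- 1) = r ^ 3"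
    using m4 by (simp_all add: row_power_def)
  \<comment> \<open>The inner arc from \<open>u 0 0\<close> joins images of two vertices with different swaps.\<close>
  have ex: "\<exists>z\<in>V. swaps g z = b \<and> (\<exists>j. g z = u 0 j)" for b
  proof -
    have "g ` V = V" using g by (auto simp: automorphisms_def permutes_image)
    then obtain z where z: "z \<in> V" "g z = u 0 0" by (metis imageE u_in)
    show ?thesis
    proof (cases "swaps g z = b")
      case False
      then show ?thesis using z alt[OF z(1)] aut_step[OF g z(1), of "swaps g z"]
        by (intro bexI[of _ "step (swaps g z) z"]) (auto simp: z)
    qed (use z in blast)
  qed
  then show "\<exists>z\<in>V. swaps g z \<and> (\<exists>j. g z = u 0 j)" by (metis (full_types))
  obtain z j where z: "z \<in> V" "\<not> swaps g z" "g z = u 0 j" using ex[of False] by auto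
  obtain w where w: "w \<in> V" "step False w = step True (step True (u 0 j))"
    "step True (step True w) = step False (step False (step False (u 0 j)))"
    using octagon_image[OF g z(1), of True False True False] z alt by auto
  have "w = u 2 (j - s * e 2)" using w(1,2) by (simp add: step_False_eq)
  then have "u (0 + 4) (j - s * e 2) = u 0 (j + 3 * s)"
    using w(3) by (simp add: ge algebra_simps)
  then have "int n dvd (j - s * e 2 + t) - (j + 3 * s)"
    unfolding w4 u_same_row cong_iff_dvd_diff .
  then show 1: "int n dvd t - s * (r\<^sup>2 + 3)" by (simp add: ge algebra_simps)
  obtain z j where z: "z \<in> V" "swaps g z" "g z = u 0 j" using ex[of True] by auto
  obtain w where w: "w \<in> V" "step True w = step False (step False (u 0 j))"
    "step False (step False w) = step True (step True (step True (u 0 j)))"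
    using octagon_image[OF g z(1), of False True False True] z alt by auto
  have "w = u (- 1) (j + 2 * s)" using w(1,2) by (simp add: step_True_eq ge algebra_simps)
  then have "u (- 1) (j + 2 * s + 2 * s * e (- 1)) = u (- 1 + 4) j"
    using w(3) by (simp add: algebra_simps)
  then have "int n dvd (j + 2 * s + 2 * s * e (- 1)) - (j + t)"
    unfolding w4 u_same_row cong_iff_dvd_diff .
  then have 2: "int n dvd 2 * s + 2 * s * r ^ 3 - t" by (simp add: ge algebra_simps)
  have 3: "int n dvd r ^ 4 - 1" using r_power m4 by (simp add: cong_iff_dvd_diff)
  have "int n dvd (t * (r - 1)) * (- 1) - r * (2 * s + 2 * s * r ^ 3 - t) + 2 * s * (r ^ 4 - 1)"
    by (intro dvd_add dvd_diff dvd_mult2[OF r_t] dvd_mult[OF 2] dvd_mult[OF 3])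
  also have "\<dots> = t - 2 * s * (r + 1)" by (simp add: algebra_simps eval_nat_numeral)
  finally show "int n dvd t - 2 * s * (r + 1)" .
qed

text \<open>
  An outer step followed by an inner one has the same effect as \<open>r\<close> inner steps followed by an outer
  one. At a vertex where \<open>g\<close> swaps, the image of the first walk consists of two inner steps, that of
  the second one alternates between outer and inner steps and ends with an additional outer one. Comparing
  their ends, with the relations of \<open>four_rows_relations\<close>, leads to \<open>2 (r - 1) = 0\<close>.
\<close>
lemma no_alternation:
  assumes m4: "m = 4" and g: "g \<in> automorphisms X"
    and alt: "\<And>v c. v \<in> V \<Longrightarrow> swaps g (step c v) = (\<not> swaps g v)"
  shows False
proof -
  have w4: "u (i + 4) j = u i (j + t)" for i j using u_wrap[of i j] m4 by simp
  have ge: "e 0 = 1" "e 1 = r" "e 2 = r\<^sup>2" "e 3 = r ^ 3" "e 4 = 1"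
    using m4 by (simp_all add: row_power_def)
  note t1 = four_rows_relations(1)[OF assms] and t2 = four_rows_relations(2)[OF assms]
  have "coprime s (int n)"
  proof (rule coprimeI)
    fix k assume k: "k dvd s" "k dvd int n"
    then have "k dvd (t - s * (r\<^sup>2 + 3)) + s * (r\<^sup>2 + 3)"
      using dvd_trans[OF k(2) t1] by (intro dvd_add) auto
    then show "is_unit k" using k generators_coprime by simp
  qed
  then have s_cancel: "int n dvd s * a \<longleftrightarrow> int n dvd a" for a
    by (simp add: coprime_commute coprime_dvd_mult_right_iff)
  have "int n dvd (t - 2 * s * (r + 1)) - (t - s * (r\<^sup>2 + 3))" using t1 t2 by (rule dvd_diff[rotated])
  also have "\<dots> = s * (r - 1)\<^sup>2" by (simp add: power2_eq_square algebra_simps)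
  finally have sq: "int n dvd (r - 1)\<^sup>2" using s_cancel by blast
  have "int n dvd t * (r - 1) - (r - 1) * (t - 2 * s * (r + 1)) - 2 * s * (r - 1)\<^sup>2"
    by (intro dvd_diff r_t dvd_mult[OF t2] dvd_mult[OF sq])
  also have "\<dots> = s * (4 * (r - 1))" by (simp add: power2_eq_square algebra_simps)
  finally have four: "int n dvd 4 * (r - 1)" using s_cancel by blast
  obtain z j where z: "z \<in> V" "swaps g z" "g z = u 0 j"
    using four_rows_relations(3)[OF assms] by blast
  define F where "F k = (step False ^^ k) z" for k
  have FV: "F k \<in> V" for k using z(1) by (induction k) (simp_all add: F_def)
  have swF: "swaps g (F k) = even k" for k
    using z FV alt by (induction k) (simp_all add: F_def)
  obtain i l where zij: "z = u i l" using V_E[OF z(1)] .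
  have F: "F k = u i (l + int k * s * e i)" for k
    by (induction k) (simp_all add: F_def zij algebra_simps)
  \<comment> \<open>An inner cycle has length \<open>n\<close>, and swaps alternate along it.\<close>
  have "F n = F 0" unfolding F u_same_row by (simp add: cong_iff_dvd_diff)
  then have "even n" using swF[of n] swF[of 0] by simp
  \<comment> \<open>A natural number in place of \<open>r\<close>, to count inner steps.\<close>
  define R where "R = nat (r mod int n)"
  have R: "[int R = r] (mod int n)" using n_pos by (simp add: R_def)
  have "coprime (int R) (int n)"
    using r_coprime R by (metis cong_imp_coprime cong_sym)
  then have "odd R" using \<open>even n\<close> by (metis coprime_common_divisor dvd_refl even_of_nat not_coprimeI odd_one)
  have "[int R * (s * e i) = r * (s * e i)] (mod int n)" using R by (rule cong_scalar_right)
  moreover have "[s * e (i + 1) = s * (r * e i)] (mod int n)" using e_Suc by (rule cong_scalar_left)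
  ultimately have "[s * e (i + 1) = int R * s * e i] (mod int n)"
    by (simp add: cong_def mult.assoc mult.left_commute)
  then have "step False (step True z) = step True (F R)"
    by (simp add: zij F u_same_row cong_add_lcancel)
  then have "g (step False (step True z)) = g (step True (F R))" by simp
  then have "step False (step False (g z)) = step True (g (F R))"
    using z alt FV swF \<open>odd R\<close> by (simp add: aut_step[OF g] del: step_True step_False)
  then have key: "step True (g (F R)) = u 0 (j + 2 * s)"
    using z by (simp add: ge algebra_simps)
  have G: "g (F (Suc k)) = step (even k) (g (F k))" for k
    using aut_step[OF g FV, of False k] swF[of k] by (simp add: F_def)
  have G': "g (F k') = step (even k) (g (F k))" if "k' = k + 1" for k k'
    using that G[of k] by simp
  \<comment> \<open>Eight steps of the image, four outer and four inner ones in turn, return to the row.\<close>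
  have G8: "g (F (8 * q)) = u 0 (j + 8 * s * int q) \<and> g (F (8 * q + 1)) = u 1 (j + 8 * s * int q)
      \<and> g (F (8 * q + 3)) = u 2 (j + 8 * s * int q + s * r)
      \<and> g (F (8 * q + 5)) = u 3 (j + 8 * s * int q + s * r + s * r\<^sup>2)
      \<and> g (F (8 * q + 7)) = u 4 (j + 8 * s * int q + s * r + s * r\<^sup>2 + s * r ^ 3)" for q
  proof -
    have base: "g (F (8 * q)) = u 0 x \<Longrightarrow> g (F (8 * q + 1)) = u 1 x
      \<and> g (F (8 * q + 3)) = u 2 (x + s * r) \<and> g (F (8 * q + 5)) = u 3 (x + s * r + s * r\<^sup>2)
      \<and> g (F (8 * q + 7)) = u 4 (x + s * r + s * r\<^sup>2 + s * r ^ 3)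
      \<and> g (F (8 * q + 8)) = u 4 (x + s * r + s * r\<^sup>2 + s * r ^ 3 + s)" for q x
    proof -
      assume x: "g (F (8 * q)) = u 0 x"
      have 1: "g (F (8 * q + 1)) = u 1 x" using G[of "8 * q"] x by simp
      have 2: "g (F (8 * q + 2)) = u 1 (x + s * r)" using G[of "8 * q + 1"] 1 by (simp add: ge)
      have 3: "g (F (8 * q + 3)) = u 2 (x + s * r)"
        using 2 by (simp add: ge G'[of "8 * q + 3" "8 * q + 2"])
      have 4: "g (F (8 * q + 4)) = u 2 (x + s * r + s * r\<^sup>2)"
        using 3 by (simp add: ge G'[of "8 * q + 4" "8 * q + 3"])
      have 5: "g (F (8 * q + 5)) = u 3 (x + s * r + s * r\<^sup>2)"
        using 4 by (simp add: ge G'[of "8 * q + 5" "8 * q + 4"])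
      have 6: "g (F (8 * q + 6)) = u 3 (x + s * r + s * r\<^sup>2 + s * r ^ 3)"
        using 5 by (simp add: ge G'[of "8 * q + 6" "8 * q + 5"])
      have 7: "g (F (8 * q + 7)) = u 4 (x + s * r + s * r\<^sup>2 + s * r ^ 3)"
        using 6 by (simp add: ge G'[of "8 * q + 7" "8 * q + 6"])
      have 8: "g (F (8 * q + 8)) = u 4 (x + s * r + s * r\<^sup>2 + s * r ^ 3 + s)"
        using 7 by (simp add: ge G'[of "8 * q + 8" "8 * q + 7"])
      show ?thesis using 1 3 5 7 8 by blast
    qed
    have "g (F (8 * q)) = u 0 (j + 8 * s * int q)"
    proof (induction q)
      case 0 then show ?case by (simp add: F_def z)
    next
      case (Suc q)
      let ?x = "j + 8 * s * int q"
      have "g (F (8 * Suc q)) = u (0 + 4) (?x + s * r + s * r\<^sup>2 + s * r ^ 3 + s)"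
        using base[OF Suc] by (simp add: add.commute)
      also have "\<dots> = u 0 (?x + s * r + s * r\<^sup>2 + s * r ^ 3 + s + t)" by (rule w4)
      also have "\<dots> = u 0 (?x + 8 * s)"
      proof -
        have "int n dvd (t - 2 * s * (r + 1)) + s * (r - 1)\<^sup>2 + s * (r + 2) * (r - 1)\<^sup>2 + 2 * s * (4 * (r - 1))"
          using t2 sq four by (intro dvd_add) auto
        also have "\<dots> = (?x + s * r + s * r\<^sup>2 + s * r ^ 3 + s + t) - (?x + 8 * s)"
          by (simp add: power2_eq_square power3_eq_cube algebra_simps)
        finally show ?thesis by (simp add: u_same_row cong_iff_dvd_diff)
      qed
      finally show ?case by (simp add: algebra_simps)
    qed
    then show ?thesis using base by blast
  qed
  have rows: "u 2 a \<noteq> u 0 b" "u 3 a \<noteq> u 0 b" "u 5 a \<noteq> u 0 b" for a b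
    by (auto dest!: u_row simp: cong_def m4)
  define q where "q = R div 8"
  have "R mod 8 = 1 \<or> R mod 8 = 3 \<or> R mod 8 = 5 \<or> R mod 8 = 7"
    using \<open>odd R\<close> by presburger
  moreover have "R = 8 * q + R mod 8" by (simp add: q_def)
  ultimately consider "R = 8 * q + 1" | "R = 8 * q + 3" | "R = 8 * q + 5" | "R = 8 * q + 7"
    by metis
  then show False
  proof cases
    case 1 then show False using key G8[of q] rows by auto
  next
    case 2 then show False using key G8[of q] rows by auto
  next
    case 3
    let ?y = "j + 8 * s * int q + s * r + s * r\<^sup>2"
    have "u (0 + 4) ?y = u 0 (j + 2 * s)" using key G8[of q] 3 by simp
    then have d1: "int n dvd (?y + t) - (j + 2 * s)"
      unfolding w4 u_same_row cong_iff_dvd_diff .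
    have d2: "int n dvd int R - r" using R by (simp add: cong_iff_dvd_diff)
    have "int n dvd ((?y + t) - (j + 2 * s)) - s * (int R - r) - (t - 2 * s * (r + 1)) - s * (r - 1)\<^sup>2
        - s * (4 * (r - 1))"
      by (rule dvd_diff[OF dvd_diff[OF dvd_diff[OF dvd_diff[OF d1 dvd_mult[OF d2]] t2]
            dvd_mult[OF sq]] dvd_mult[OF four]])
    also have "\<dots> = s * (2 * (r - 1))"
      by (simp add: 3 power2_eq_square algebra_simps)
    finally show False using s_cancel square_zero_imp_double[OF sq] by blast
  next
    case 4 then show False using key G8[of q] rows by auto
  qed
qed

lemma swaps_const:
  assumes "g \<in> automorphisms X" "v \<in> V"
  shows "swaps g v = swaps g (u 0 0)"
proof (cases "m = 4")
  case True
  show ?thesis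
  proof (rule ccontr)
    assume "swaps g v \<noteq> swaps g (u 0 0)"
    from no_alternation[OF True assms(1) swaps_alternate[OF True assms this]] show False .
  qed
next
  case False then show ?thesis using assms by (rule swaps_const_off_4)
qed

text \<open>
  Two automorphisms that swap alike agree at the head of an arc of \<open>D\<close> if and only if they agree at its
  tail.
\<close>
lemma aut_eqI:
  assumes g: "g \<in> automorphisms X" and h: "h \<in> automorphisms X"
    and "g v = h v" "v \<in> V" "swaps g v = swaps h v"
  shows "g = h"
proof
  have sw: "swaps g w = swaps h w" if "w \<in> V" for w
    using swaps_const[OF g that] swaps_const[OF h that] swaps_const[OF g assms(4)]
      swaps_const[OF h assms(4)] assms(5) by simp
  have A: "g (step c w) = h (step c w) \<longleftrightarrow> g w = h w" if "w \<in> V" for w c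
    using that sw[OF that] g h by (simp add: aut_step step_inj)
  have *: "g w = h w \<longleftrightarrow> g (u 0 0) = h (u 0 0)" if "w \<in> V" for w
    using that by (induction rule: vertex_induct) (simp_all add: A)
  fix w show "g w = h w"
  proof (cases "w \<in> V")
    case True then show ?thesis using *[OF True] *[OF assms(4)] assms(3) by simp
  next
    case False then show ?thesis using aut_outside g h by metis
  qed
qed

lemma swap_at:
  assumes v: "v \<in> V"
  obtains \<tau> where "\<tau> \<in> automorphisms X" "\<tau> v = v" "swaps \<tau> v"
proof -
  have "(v, step False v) \<in> D" "(v, step True v) \<in> D"
    using v unfolding D_step by blast+
  then obtain \<tau> where \<tau>: "\<tau> \<in> automorphisms X" "\<tau> v = v" "\<tau> (step False v) = step True v"
    using arc_trans by metis
  then have "step (swaps \<tau> v) v = step True v" using aut_step[OF \<tau>(1) v, of False] by simp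
  then have "swaps \<tau> v" using steps_distinct[OF v] by (cases "swaps \<tau> v") auto
  then show thesis using that \<tau> by blast
qed

lemma stabilizer_iso:
  assumes v: "v \<in> V"
  shows "vertex_stabilizer X v \<cong> integer_mod_group 2"
proof -
  obtain \<tau> where \<tau>: "\<tau> \<in> automorphisms X" "\<tau> v = v" "swaps \<tau> v" using swap_at[OF v] .
  have nsw: "\<not> swaps id w" for w by (simp add: swaps_def)
  have tt: "\<tau> \<circ> \<tau> = id"
  proof (rule aut_eqI[OF comp_aut[OF \<tau>(1,1)] id_aut _ v])
    have "\<not> swaps (\<tau> \<circ> \<tau>) v" using aut_step[OF \<tau>(1) v, of True] aut_step[OF \<tau>(1) v, of False] \<tau>
      by (simp add: swaps_def)
    then show "swaps (\<tau> \<circ> \<tau>) v = swaps id v" using nsw by blast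
  qed (simp add: \<tau>)
  have "\<tau> \<noteq> id" using \<tau>(3) nsw by blast
  have stab: "{g \<in> automorphisms X. g v = v} = {id, \<tau>}"
  proof (rule subset_antisym; rule subsetI)
    fix g assume "g \<in> {g \<in> automorphisms X. g v = v}"
    then have g: "g \<in> automorphisms X" "g v = v" by auto
    show "g \<in> {id, \<tau>}"
    proof (cases "swaps g v")
      case True then show ?thesis using aut_eqI[OF g(1) \<tau>(1) _ v] g \<tau> by simp
    next
      case False then show ?thesis using aut_eqI[OF g(1) id_aut _ v] g nsw by simp
    qed
  qed (use \<tau> id_aut in auto)
  define f where "f g = (if g = id then 0 else 1 :: int)" for g :: "'a \<Rightarrow> 'a"
  have "{0..<2::int} = {0, 1}" by auto
  then have "f \<in> iso (vertex_stabilizer X v) (integer_mod_group 2)"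
    using \<open>\<tau> \<noteq> id\<close> tt stab
    by (auto simp: iso_def hom_def bij_betw_def inj_on_def f_def vertex_stabilizer_def aut_group_def
        carrier_integer_mod_group)
  then show ?thesis by (auto simp: is_iso_def)
qed

end

section \<open>Parameters\<close>

context class_II_coordinates begin

lemma swap_powers:
  assumes \<tau>: "\<tau> \<in> automorphisms X" "\<tau> (u 0 0) = u 0 0" "swaps \<tau> (u 0 0)"
  shows "\<tau> (u 0 (int k * s)) = u (int k) 0" and "\<tau> (u (int k) 0) = u 0 (int k * s)"
proof -
  have st: "\<tau> (step c v) = step (\<not> c) (\<tau> v)" if "v \<in> V" for c v
    using aut_step[OF \<tau>(1) that] swaps_const[OF \<tau>(1) that] \<tau>(3) by simp
  show "\<tau> (u 0 (int k * s)) = u (int k) 0"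
  proof (induction k)
    case (Suc k)
    have "u 0 (int (Suc k) * s) = step False (u 0 (int k * s))" by (simp add: e_0 algebra_simps)
    then show ?case using st[of "u 0 (int k * s)" False] Suc by (simp add: add.commute)
  qed (simp add: \<tau>)
  show "\<tau> (u (int k) 0) = u 0 (int k * s)"
  proof (induction k)
    case (Suc k)
    have "u (int (Suc k)) 0 = step True (u (int k) 0)" by (simp add: add.commute)
    then show ?case using st[of "u (int k) 0" True] Suc by (simp add: e_0 algebra_simps)
  qed (simp add: \<tau>)
qed

lemma swap_orders: "int n dvd int k * s \<longleftrightarrow> (\<exists>q. int k = q * int m \<and> int n dvd t * q)"
proof -
  obtain \<tau> where \<tau>: "\<tau> \<in> automorphisms X" "\<tau> (u 0 0) = u 0 0" "swaps \<tau> (u 0 0)"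
    using swap_at[of "u 0 0"] by auto
  have "int n dvd int k * s \<longleftrightarrow> u 0 (int k * s) = u 0 0"
    by (simp add: u_same_row cong_iff_dvd_diff)
  also have "\<dots> \<longleftrightarrow> \<tau> (u 0 (int k * s)) = \<tau> (u 0 0)"
    using aut_inj[OF \<tau>(1)] by simp
  also have "\<dots> \<longleftrightarrow> u 0 0 = u (int k) 0"
    using swap_powers[OF \<tau>] \<tau>(2) by auto
  also have "\<dots> \<longleftrightarrow> (\<exists>q. int k = q * int m \<and> int n dvd t * q)"
    unfolding u_eq by (simp add: cong_iff_dvd_diff)
  finally show ?thesis .
qed

text \<open>
  With \<open>d = gcd s n\<close>, inner cycles have length \<open>n / d\<close>. As the outer cycles have this length as well,
  \<open>d\<close> divides \<open>t\<close>, so it divides all shifts.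
\<close>
lemma s_coprime: "coprime s (int n)"
proof -
  define d where "d = gcd s (int n)"
  have "d > 0" using n_pos by (simp add: d_def)
  obtain k' where k': "int n = d * k'" unfolding d_def by (metis dvdE gcd_dvd2)
  have "k' > 0" using k' n_pos \<open>d > 0\<close> by (metis zero_less_mult_pos)
  define k where "k = nat k'"
  have k: "int n = d * int k" using k' \<open>k' > 0\<close> by (simp add: k_def)
  have "d dvd s" by (simp add: d_def)
  then have "int n dvd int k * s" unfolding k by (simp add: mult.commute mult_dvd_mono)
  then obtain q where q: "int k = q * int m" "int n dvd t * q" using swap_orders by blast
  have "q \<noteq> 0" using q(1) \<open>k' > 0\<close> by (auto simp: k_def)
  have "q * (d * int m) dvd q * t" using q k by (simp add: algebra_simps)
  then have "d * int m dvd t" using \<open>q \<noteq> 0\<close> by simp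
  then have "d dvd t" by (rule dvd_mult_left)
  moreover have "d dvd int n" by (simp add: d_def)
  ultimately have "is_unit d" using generators_coprime[OF \<open>d dvd s\<close>] by blast
  then show ?thesis using \<open>d > 0\<close> by (simp add: d_def coprime_iff_gcd_eq_1)
qed

text \<open>
  The new coordinate counts inner steps in row 0.
\<close>
lemma rescale:
  obtains u' t' where "class_II_coordinates X m n r 1 t' u'" "0 \<le> t'" "t' < int n"
proof -
  obtain s' where s': "[s * s' = 1] (mod int n)"
    using s_coprime cong_solve_coprime_int by blast
  have ss: "int n dvd s * s' - 1" using s' by (simp add: cong_iff_dvd_diff)
  define t' where "t' = s' * t mod int n"
  define u' where "u' i j = u i (s * j)" for i j
  have tt: "int n dvd s * t' - t"
  proof -
    have "int n dvd s * (t' - s' * t) + t * (s * s' - 1)"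
      using ss by (intro dvd_add dvd_mult) (auto simp: t'_def mod_eq_dvd_iff[symmetric])
    then show ?thesis by (simp add: algebra_simps)
  qed
  have s_cancel: "int n dvd s * a \<longleftrightarrow> int n dvd a" for a
    using s_coprime by (simp add: coprime_commute coprime_dvd_mult_right_iff)
  have onto: "u i j = u' i (s' * j)" for i j
  proof -
    have "int n dvd j * (s * s' - 1)" using ss by (rule dvd_mult)
    then show ?thesis unfolding u'_def u_same_row
      by (simp add: cong_iff_dvd_diff algebra_simps dvd_diff_commute)
  qed
  have eq: "u' i j = u' i' j' \<longleftrightarrow> (\<exists>k. i' = i + k * int m \<and> [j = j' + t' * k] (mod int n))" for i j i' j'
  proof -
    have "[s * j = s * j' + t * k] (mod int n) \<longleftrightarrow> [j = j' + t' * k] (mod int n)" for k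
    proof -
      have "int n dvd s * j - (s * j' + t * k) \<longleftrightarrow> int n dvd s * (j - (j' + t' * k)) + k * (s * t' - t)"
        by (simp add: algebra_simps)
      also have "\<dots> \<longleftrightarrow> int n dvd s * (j - (j' + t' * k))"
        using tt by (simp add: dvd_add_left_iff)
      also have "\<dots> \<longleftrightarrow> int n dvd j - (j' + t' * k)" by (rule s_cancel)
      finally show ?thesis by (simp add: cong_iff_dvd_diff)
    qed
    then show ?thesis unfolding u'_def u_eq by simp
  qed
  have arcs': "out_arcs_of m r 1 u' = D"
  proof (rule subset_antisym; rule subsetI)
    fix a assume "a \<in> out_arcs_of m r 1 u'"
    then consider i j where "a = (u' i j, u' (i + 1) j)" | i j where "a = (u' i j, u' i (j + e i))"
      unfolding out_arcs_of_def by auto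
    then show "a \<in> D"
    proof cases
      case (1 i j)
      then have "a = (u i (s * j), u (i + 1) (s * j))" by (simp add: u'_def)
      then show ?thesis unfolding out_arcs_of_def by blast
    next
      case (2 i j)
      then have "a = (u i (s * j), u i (s * j + s * e i))" by (simp add: u'_def algebra_simps)
      then show ?thesis unfolding out_arcs_of_def by blast
    qed
  next
    fix a assume "a \<in> D"
    then consider i j where "a = (u i j, u (i + 1) j)" | i j where "a = (u i j, step False (u i j))"
      unfolding out_arcs_of_def by auto
    then show "a \<in> out_arcs_of m r 1 u'"
    proof cases
      case (1 i j)
      then have "a = (u' i (s' * j), u' (i + 1) (s' * j))" by (simp add: onto)
      then show ?thesis unfolding out_arcs_of_def by blast
    next
      case (2 i j)
      have "step False (u' i (s' * j)) = u' i (s' * j + 1 * e i)"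
        by (simp add: u'_def algebra_simps)
      then have "a = (u' i (s' * j), u' i (s' * j + 1 * e i))" using 2 by (simp add: onto)
      then show ?thesis unfolding out_arcs_of_def by blast
    qed
  qed
  have "class_II_coordinates X m n r 1 t' u'"
  proof (intro class_II_coordinates.intro class_II_coordinates_axioms.intro)
    show "half_arc_orientation X (out_arcs_of m r 1 u')" unfolding arcs' by unfold_locales
    show "[t' * (r - 1) = 0] (mod int n)"
    proof -
      have "int n dvd (s * t' - t) * (r - 1) + t * (r - 1)"
        using tt r_t by (intro dvd_add) auto
      then have "int n dvd s * (t' * (r - 1))" by (simp add: algebra_simps)
      then show ?thesis using s_cancel by (simp add: cong_iff_dvd_diff)
    qed
    show "pverts X = {u' i j | i j. True}"
    proof (rule subset_antisym; rule subsetI)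
      fix v assume "v \<in> V" from V_E[OF this] obtain i j where "v = u i j" .
      then show "v \<in> {u' i j | i j. True}" using onto by blast
    qed (auto simp: u'_def)
    show "u' i j \<in> S" if "u' 0 0 \<in> S" "\<And>i j. u' i j \<in> S \<Longrightarrow> u' (i + 1) j \<in> S"
      "\<And>i j. u' i j \<in> S \<Longrightarrow> u' i (j + 1 * row_power m r i) \<in> S" for S i j
      unfolding u'_def
    proof (rule generated)
      show "u 0 0 \<in> S" using that(1) by (simp add: u'_def)
      show "u (i + 1) j \<in> S" if "u i j \<in> S" for i j
        using \<open>\<And>i j. u' i j \<in> S \<Longrightarrow> u' (i + 1) j \<in> S\<close> that onto by metis
      show "u i (j + s * e i) \<in> S" if "u i j \<in> S" for i j
      proof -
        have "u' i (s' * j) \<in> S" using that onto by simp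
        then have "u' i (s' * j + e i) \<in> S"
          using \<open>\<And>i j. u' i j \<in> S \<Longrightarrow> u' i (j + 1 * row_power m r i) \<in> S\<close> by force
        also have "u' i (s' * j + e i) = step False (u' i (s' * j))"
          by (simp add: u'_def algebra_simps)
        also have "\<dots> = u i (j + s * e i)" by (simp flip: onto)
        finally show ?thesis .
      qed
    qed
  qed (use m3 n3 r_coprime r_power eq in auto)
  then show thesis using that[of t' u'] n_pos by (simp add: t'_def)
qed

end

locale class_II_normalised = class_II_coordinates X m n r 1 t u
  for X :: "'a pair_pre_digraph" and m n r t u +
  assumes r_range: "0 \<le> r" "r < int n" and t_range: "0 \<le> t" "t < int n"
begin

text \<open>
  Let \<open>\<tau>\<close> fix \<open>u 0 0\<close> and swap colours. Equality of the lengths of inner and outer cycles gives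
  \<open>m | n\<close> and \<open>m | t\<close>. The first relation for \<open>c\<close> is the image under \<open>\<tau>\<close> of \<open>m\<close> outer steps being \<open>t\<close>
  inner ones. That for \<open>q\<close> is the image of the relation between outer-inner and inner-outer walks, in
  which \<open>r\<close> inner steps become \<open>r\<close> outer steps. Finally \<open>d \<le> 2\<close> would imply \<open>2 (r - 1) = 0\<close>.
\<close>
lemma parameters:
  obtains c q d where "n = m * d" "2 < d" "t = c * int m" "r - 1 = int m * q"
    "0 \<le> c" "c < int d" "0 \<le> q" "q < int d"
    "int n dvd t * c - int m" "int n dvd t * q + (r - 1)"
    "int n dvd int m * (r - 1)" "int n dvd (r - 1)\<^sup>2" "\<not> int n dvd 2 * (r - 1)"
proof -
  obtain \<tau> where \<tau>: "\<tau> \<in> automorphisms X" "\<tau> (u 0 0) = u 0 0" "swaps \<tau> (u 0 0)"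
    using swap_at[of "u 0 0"] by auto
  obtain q0 where q0: "int n = q0 * int m" "int n dvd t * q0"
    using swap_orders[of n] by (metis dvd_triv_left)
  have "q0 > 0" using q0(1) m_pos n_pos by (metis zero_less_mult_pos2)
  define d where "d = nat q0"
  have d: "n = m * d" using q0(1) \<open>q0 > 0\<close>
    by (metis d_def mult.commute nat_int of_nat_mult int_nat_eq less_le)
  have "q0 * int m dvd q0 * t" using q0 by (simp add: mult.commute)
  then have "int m dvd t" using \<open>q0 > 0\<close> by simp
  then obtain c where c: "t = c * int m" by (metis dvdE mult.commute)
  have "c \<ge> 0" using c t_range m_pos by (metis not_le mult_neg_pos)
  have "c < int d"
  proof -
    have "c * int m < int d * int m" using c t_range d by (simp add: mult.commute)
    then show ?thesis using m_pos by simp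
  qed
  have tc: "int n dvd t * c - int m"
  proof -
    have "u 0 (int m) = \<tau> (u (0 + int m) 0)" using swap_powers(2)[OF \<tau>, of m] by simp
    also have "u (0 + int m) 0 = u 0 (int (nat t) * 1)" using u_wrap[of 0 0] t_range by simp
    also have "\<tau> \<dots> = u (0 + c * int m) 0"
      using swap_powers(1)[OF \<tau>, of "nat t"] t_range c by simp
    also have "\<dots> = u 0 (t * c)" unfolding u_wrap_mult by simp
    finally have "int n dvd int m - t * c" by (simp add: u_same_row cong_iff_dvd_diff)
    then show ?thesis by (simp add: dvd_diff_commute)
  qed
  have e1: "e 1 = r" using m3 by (simp add: row_power_def)
  have st: "\<tau> (step b v) = step (\<not> b) (\<tau> v)" if "v \<in> V" for b v
    using aut_step[OF \<tau>(1) that] swaps_const[OF \<tau>(1) that] \<tau>(3) by simp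
  have "step False (step True (u 0 0)) = step True (u 0 (int (nat r) * 1))"
    using r_range by (simp add: e1)
  then have "\<tau> (step False (step True (u 0 0))) = \<tau> (step True (u 0 (int (nat r) * 1)))" by simp
  then have "step True (step False (u 0 0)) = step False (u (int (nat r)) 0)"
    using st swap_powers(1)[OF \<tau>, of "nat r"] \<tau>(2) by (simp del: step_True step_False)
  then have "u 1 1 = u r (e r)" using r_range by (simp add: e_0)
  then obtain q where q: "r = 1 + q * int m" "[1 = e r + t * q] (mod int n)"
    unfolding u_eq by auto
  have "e r = r" using arg_cong[OF q(1), of e] e_wrap[of 1 q] e1 by linarith
  then have tq: "int n dvd t * q + (r - 1)"
    using q(2) by (simp add: cong_iff_dvd_diff algebra_simps dvd_diff_commute)
  have "r \<noteq> 0" using r_coprime n3 by auto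
  then have "q * int m \<ge> 0" using q(1) r_range by simp
  then have "q \<ge> 0" using m_pos by (metis mult_neg_pos not_le)
  have "q < int d"
  proof -
    have "q * int m < int d * int m" using q r_range d by (simp add: mult.commute)
    then show ?thesis using m_pos by simp
  qed
  have mr: "int n dvd int m * (r - 1)"
  proof -
    have "int n dvd c * (t * (r - 1)) - (r - 1) * (t * c - int m)"
      by (intro dvd_diff dvd_mult[OF r_t] dvd_mult[OF tc])
    then show ?thesis by (simp add: algebra_simps)
  qed
  have r1: "r - 1 = int m * q" using q(1) by simp
  have "int n dvd q * (int m * (r - 1))" using mr by (rule dvd_mult)
  then have sq: "int n dvd (r - 1)\<^sup>2" unfolding power2_eq_square by (simp add: r1 ac_simps)
  note dbl = square_zero_imp_double[OF sq]
  have "d > 2"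
  proof (rule ccontr)
    assume "\<not> d > 2"
    then have "d = 0 \<or> d = 1 \<or> d = 2" by auto
    then have "q = 0 \<or> (q = 1 \<and> d = 2)" using \<open>q \<ge> 0\<close> \<open>q < int d\<close> by auto
    then show False using dbl r1 d by auto
  qed
  then show thesis using that d c r1 \<open>c \<ge> 0\<close> \<open>c < int d\<close> \<open>q \<ge> 0\<close> \<open>q < int d\<close> tc tq mr sq dbl by blast
qed

end

section \<open>The isomorphism with the standard graph\<close>

context class_II_coordinates begin

lemma coords_E:
  assumes "v \<in> V"
  obtains i j where "i < m" "0 \<le> j" "j < int n" "v = u (int i) j"
proof -
  obtain i j where v: "v = u i j" using V_E[OF assms] .
  have "v = u (i mod int m) (j + t * (i div int m))"
    using u_wrap_mult[of "i mod int m" "i div int m" j] v by (simp add: algebra_simps)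
  also have "\<dots> = u (int (nat (i mod int m))) ((j + t * (i div int m)) mod int n)"
    using m_pos by (simp add: u_same_row cong_def)
  finally show thesis
    using m_pos n_pos by (intro that[of "nat (i mod int m)" "(j + t * (i div int m)) mod int n"])
      (auto simp: nat_less_iff)
qed

lemma coords_inj:
  assumes "i < m" "i' < m" "0 \<le> j" "j < int n" "0 \<le> j'" "j' < int n" "u (int i) j = u (int i') j'"
  shows "i = i' \<and> j = j'"
proof -
  have "int i mod int m = int i' mod int m" using u_row[OF assms(7)] by (simp add: cong_def)
  then have "i = i'" using assms(1,2) by simp
  then have "[j = j'] (mod int n)" using assms(7) u_same_row by simp
  then show ?thesis using \<open>i = i'\<close> assms by (simp add: cong_def)
qed

lemma wf_X: "wf_digraph (with_proj X)"
  by unfold_locales (auto simp: with_proj_def arcs D_step)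

end

context class_II_normalised begin

lemma y_iso: "digraph_iso (with_proj X) (with_proj (y_graph m n r t))"
proof -
  define g where "g = (\<lambda>(i, j). u (int i) j)"
  have g [simp]: "g (i, j) = u (int i) j" for i j by (simp add: g_def)
  show ?thesis
  proof (rule digraph_isoI[OF wf_X])
  let ?Y = "y_graph m n r t"
  have pv: "pverts ?Y = {0..<m} \<times> {0..<int n}" by (simp add: y_graph_def)
  show "bij_betw g (pverts ?Y) V"
    unfolding bij_betw_def
  proof
    show "inj_on g (pverts ?Y)"
      unfolding pv inj_on_def using coords_inj by auto
    show "g ` pverts ?Y = V"
    proof (rule subset_antisym; rule subsetI)
      fix v assume "v \<in> V"
      then obtain i j where "i < m" "0 \<le> j" "j < int n" "v = u (int i) j" by (rule coords_E)
      then show "v \<in> g ` pverts ?Y" unfolding pv by force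
    qed auto
  qed
  have half: "y_half_arcs m n r t \<subseteq> pverts ?Y \<times> pverts ?Y"
    using m3 n3 by (auto simp: y_half_arcs_def pv)
  then show "parcs ?Y \<subseteq> pverts ?Y \<times> pverts ?Y"
    by (auto simp: y_graph_def)
  have um: "u (int j) y = u (int j) y'" if "[y = y'] (mod int n)" for j y y'
    using that u_cong by blast
  have e_nat: "e (int i) = r ^ i" if "i < m" for i
    using that by (simp add: row_power_def)
  have img: "map_prod g g ` y_half_arcs m n r t = D"
  proof (rule subset_antisym; rule subsetI)
    fix a assume "a \<in> map_prod g g ` y_half_arcs m n r t"
    then obtain b where b: "a = map_prod g g b" "b \<in> y_half_arcs m n r t" by (rule imageE)
    from b(2) consider i j where "i < m" "b = ((i, j), (i, (j + r ^ i) mod int n))"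
      | i j where "b = ((i, j), (i + 1, j))"
      | j where "b = ((m - 1, j), (0, (j + t) mod int n))"
      unfolding y_half_arcs_def by (elim UnE CollectE exE conjE) metis+
    then show "a \<in> D"
    proof cases
      case (1 i j)
      have "u (int i) ((j + r ^ i) mod int n) = step False (u (int i) j)"
        using e_nat[OF 1(1)] by (simp add: u_same_row)
      then have "a = (u (int i) j, step False (u (int i) j))" using 1 b(1) by simp
      then show ?thesis unfolding D_step using u_in by blast
    next
      case (2 i j)
      then have "a = (u (int i) j, step True (u (int i) j))" using b(1) by (simp add: add.commute)
      then show ?thesis unfolding D_step using u_in by blast
    next
      case (3 j)
      have "u 0 ((j + t) mod int n) = u (0 + int m) j"
        unfolding u_wrap by (simp add: u_same_row)
      also have "\<dots> = step True (u (int (m - 1)) j)" using m3 by (simp add: of_nat_diff)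
      finally have "a = (u (int (m - 1)) j, step True (u (int (m - 1)) j))" using 3 b(1) by simp
      then show ?thesis unfolding D_step using u_in by blast
    qed
  next
    fix a assume "a \<in> D"
    then obtain v c where a: "a = (v, step c v)" "v \<in> V" unfolding D_step by blast
    obtain i j where ij: "i < m" "0 \<le> j" "j < int n" "v = u (int i) j"
      using a(2) by (rule coords_E)
    have "\<exists>b \<in> y_half_arcs m n r t. a = map_prod g g b"
    proof (cases c)
      case False
      then have "a = map_prod g g ((i, j), (i, (j + r ^ i) mod int n))"
        using a ij e_nat[OF ij(1)] by (simp add: u_same_row)
      moreover have "((i, j), (i, (j + r ^ i) mod int n)) \<in> y_half_arcs m n r t"
        using ij by (auto simp: y_half_arcs_def)
      ultimately show ?thesis by blast
    next
      case True
      show ?thesis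
      proof (cases "i < m - 1")
        case True
        then have "a = map_prod g g ((i, j), (i + 1, j))"
          using a ij \<open>c\<close> by (simp add: add.commute)
        moreover have "((i, j), (i + 1, j)) \<in> y_half_arcs m n r t"
          using ij True by (auto simp: y_half_arcs_def)
        ultimately show ?thesis by blast
      next
        case False
        then have i: "i = m - 1" using ij(1) by simp
        have "step True v = u (0 + int m) j" using ij(4) i m3 by (simp add: of_nat_diff)
        also have "\<dots> = u 0 ((j + t) mod int n)"
          unfolding u_wrap by (simp add: u_same_row)
        finally have "a = map_prod g g ((m - 1, j), (0, (j + t) mod int n))"
          using a ij \<open>c\<close> i by simp
        moreover have "((m - 1, j), (0, (j + t) mod int n)) \<in> y_half_arcs m n r t"
          using ij by (auto simp: y_half_arcs_def)
        ultimately show ?thesis by blast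
      qed
    qed
    then show "a \<in> map_prod g g ` y_half_arcs m n r t" by blast
  qed
  have conv: "map_prod f f ` (R\<inverse>) = (map_prod f f ` R)\<inverse>" for f :: "nat \<times> int \<Rightarrow> 'a" and R by force
  have "parcs ?Y = y_half_arcs m n r t \<union> (y_half_arcs m n r t)\<inverse>" by (simp add: y_graph_def)
  then show "map_prod g g ` parcs ?Y = parcs X"
    by (simp only: image_Un conv img arcs)
  qed
qed

end

text \<open>
  The graphs with \<open>m = 4\<close>, \<open>n = 16\<close>, \<open>t = 12\<close> on the grid of reduced coordinates.
\<close>
definition normal_16 :: "int \<times> int \<Rightarrow> int \<times> int" where
  "normal_16 = (\<lambda>(i, j). (i mod 4, (j + 12 * (i div 4)) mod 16))"

definition step_16 :: "int \<Rightarrow> bool \<Rightarrow> int \<times> int \<Rightarrow> int \<times> int" where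
  "step_16 r c = (\<lambda>(i, j). normal_16 (if c then (i + 1, j) else (i, j + r ^ nat (i mod 4))))"

text \<open>
  The map that reverses all arcs of the graph with \<open>r = 1 + x\<close>, and that keeps colours of arcs from
  vertices \<open>u i j\<close> with \<open>i + j\<close> even and swaps the other ones. These rules determine the image of the
  walk of \<open>j\<close> inner and \<open>i\<close> outer arcs that leads from \<open>u 0 0\<close> to \<open>u i j\<close>: the inner part goes back along
  \<open>p'\<close> inner and \<open>p\<close> outer arcs in turn, and the outer part is treated case by case.
\<close>
definition reversal_16 :: "int \<Rightarrow> int \<times> int \<Rightarrow> int \<times> int" where
  "reversal_16 x = (\<lambda>(i, j). normal_16 (
     let p = j div 2; p' = (j + 1) div 2; b = x * (p' * (p' - 1) div 2) - p'
     in if even j then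
          (if i = 0 then (- p, b) else if i = 1 then (- p - 1, b)
           else if i = 2 then (- p - 1, b - 1 + x * (p + 1)) else (- p - 2, b - 1 + x * (p + 1)))
        else
          (if i = 0 then (- p, b) else if i = 1 then (- p, b - 1 + x * p)
           else if i = 2 then (- p - 1, b - 1 + x * p) else (- p - 1, b - 2 + x * p + x * (p + 1)))))"

definition grid_16 :: "(int \<times> int) list" where
  "grid_16 = List.product [0..3] [0..15]"

lemma reversal_16_reverses:
  assumes "x = 4 \<or> x = 12"
  shows "list_all (\<lambda>p. list_all (\<lambda>c.
      list_ex (\<lambda>c'. step_16 (1 + x) c' (reversal_16 x (step_16 (1 + x) c p)) = reversal_16 x p)
        [False, True]) [False, True]) grid_16"
proof -
  have "list_all (\<lambda>p. list_all (\<lambda>c.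
      list_ex (\<lambda>c'. step_16 (1 + 4) c' (reversal_16 4 (step_16 (1 + 4) c p)) = reversal_16 4 p)
        [False, True]) [False, True]) grid_16"
    by code_simp
  moreover have "list_all (\<lambda>p. list_all (\<lambda>c.
      list_ex (\<lambda>c'. step_16 (1 + 12) c' (reversal_16 12 (step_16 (1 + 12) c p)) = reversal_16 12 p)
        [False, True]) [False, True]) grid_16"
    by code_simp
  ultimately show ?thesis using assms by auto
qed

lemma reversal_16_distinct:
  assumes "x = 4 \<or> x = 12"
  shows "distinct (map (reversal_16 x) grid_16)"
proof -
  have "distinct (map (reversal_16 4) grid_16)" "distinct (map (reversal_16 12) grid_16)"
    by code_simp+
  then show ?thesis using assms by auto
qed

section \<open>Alternating cycles\<close>

context class_II_normalised begin

lemma not_exceptional: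
  assumes m4: "m = 4" and n16: "n = 16" and t12: "t = 12" and r: "r = 1 + x" and x: "x = 4 \<or> x = 12"
  shows False
proof -
  define U where "U p = u (fst p) (snd p)" for p
  have grid: "p \<in> set grid_16 \<longleftrightarrow> 0 \<le> fst p \<and> fst p < 4 \<and> 0 \<le> snd p \<and> snd p < 16" for p
    by (cases p) (auto simp: grid_16_def)
  have U_V: "U p \<in> V" for p by (simp add: U_def)
  have U_normal: "U (normal_16 p) = U p" for p
  proof (cases p)
    case (Pair i j)
    have "u (i mod 4 + i div 4 * int m) j = u (i mod 4) (j + t * (i div 4))"
      by (rule u_wrap_mult)
    then have "u i j = u (i mod 4) (j + t * (i div 4))" by (simp add: m4)
    also have "\<dots> = u (i mod 4) ((j + t * (i div 4)) mod 16)"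
      by (rule u_cong) (simp add: cong_def n16)
    finally show ?thesis by (simp add: Pair U_def normal_16_def t12)
  qed
  have normal_grid: "normal_16 p \<in> set grid_16" for p
    unfolding grid by (cases p) (simp add: normal_16_def)
  have e_4: "e i = r ^ nat (i mod 4)" for i by (simp add: row_power_def m4)
  have U_step: "U (step_16 r c p) = step c (U p)" for c p
  proof (cases p)
    case (Pair i j)
    have "U (step_16 r c p) = U (if c then (i + 1, j) else (i, j + r ^ nat (i mod 4)))"
      by (simp add: Pair step_16_def U_normal)
    also have "\<dots> = step c (U p)"
      by (cases c) (simp_all add: Pair U_def e_4)
    finally show ?thesis .
  qed
  have step_grid: "step_16 r c p \<in> set grid_16" for c p
    by (cases p) (simp add: step_16_def normal_grid)
  have rev_grid: "reversal_16 x p \<in> set grid_16" for p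
    by (cases p) (simp add: reversal_16_def normal_grid)
  have U_inj: "p = p'" if "p \<in> set grid_16" "p' \<in> set grid_16" "U p = U p'" for p p'
  proof -
    have "nat (fst p) = nat (fst p') \<and> snd p = snd p'"
      by (rule coords_inj) (use that in \<open>auto simp: grid U_def m4 n16\<close>)
    then show ?thesis using that(1,2) unfolding grid by (auto simp: prod_eq_iff eq_nat_nat_iff)
  qed
  define h where "h v = U (reversal_16 x (SOME p. p \<in> set grid_16 \<and> U p = v))" for v
  have h_U: "h (U p) = U (reversal_16 x p)" if "p \<in> set grid_16" for p
  proof -
    have "(SOME p'. p' \<in> set grid_16 \<and> U p' = U p) = p"
      by (rule some_equality) (use that U_inj in auto)
    then show ?thesis by (simp add: h_def)
  qed
  have U_E: "\<exists>p\<in>set grid_16. U p = v" if v: "v \<in> V" for v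
  proof -
    obtain i j where "v = u i j" using V_E[OF v] .
    then have "v = U (normal_16 (i, j))" by (simp add: U_normal) (simp add: U_def)
    then show ?thesis using normal_grid by blast
  qed
  have rev_inj: "inj_on (reversal_16 x) (set grid_16)"
    using reversal_16_distinct[OF x] by (simp add: distinct_map)
  show False
  proof (rule no_reversal[of h])
    show "h v \<in> V" if "v \<in> V" for v by (simp add: h_def U_V)
    show "inj_on h V"
    proof (rule inj_onI)
      fix v w assume "v \<in> V" "w \<in> V" "h v = h w"
      then obtain p p' where p: "p \<in> set grid_16" "p' \<in> set grid_16" "v = U p" "w = U p'"
        using U_E by metis
      then have "U (reversal_16 x p) = U (reversal_16 x p')"
        using \<open>h v = h w\<close> by (simp add: h_U)
      then have "reversal_16 x p = reversal_16 x p'"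
        using U_inj[OF rev_grid rev_grid] by blast
      then have "p = p'" using p(1,2) by (rule inj_onD[OF rev_inj])
      then show "v = w" using p by simp
    qed
    show "\<exists>c'. h v = step c' (h (step c v))" if v: "v \<in> V" for v c
    proof -
      obtain p where p: "p \<in> set grid_16" "U p = v" using U_E[OF v] by blast
      have "\<forall>p\<in>set grid_16. \<forall>c\<in>{False, True}. \<exists>c'.
          step_16 r c' (reversal_16 x (step_16 r c p)) = reversal_16 x p"
        using reversal_16_reverses[OF x] unfolding r list_all_iff list_ex_iff by fastforce
      moreover have "c \<in> {False, True}" by simp
      ultimately obtain c' where c': "step_16 r c' (reversal_16 x (step_16 r c p)) = reversal_16 x p"
        using p(1) by blast
      have "h (step c v) = U (reversal_16 x (step_16 r c p))"
        unfolding p(2)[symmetric] U_step[symmetric] by (rule h_U[OF step_grid])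
      then have "step c' (h (step c v)) = U (reversal_16 x p)"
        using c' by (simp flip: U_step)
      also have "\<dots> = h v" using h_U[OF p(1)] p(2) by simp
      finally show ?thesis by (intro exI[of _ c']) simp
    qed
  qed
qed

text \<open>
  From \<open>v\<close> forward along the inner arc and back along the outer arc: the next tail on the alternating
  cycle on which \<open>v\<close> is a tail.
\<close>
definition turn :: "'a \<Rightarrow> 'a" where
  "turn v = (if v \<in> V then THE w. w \<in> V \<and> step True w = step False v else v)"

lemma turn_u: "turn (u i j) = u (i - 1) (j + e i)"
proof -
  have "(THE w. w \<in> V \<and> step True w = step False (u i j)) = u (i - 1) (j + e i)"
    by (rule the_equality) (auto simp: step_True_eq)
  then show ?thesis by (simp add: turn_def)
qed

lemma turn_in [simp]: "v \<in> V \<Longrightarrow> turn v \<in> V"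
  by (erule V_E) (simp add: turn_u)

lemma turn_pow_in [simp]: "v \<in> V \<Longrightarrow> (turn ^^ k) v \<in> V"
  by (induction k) simp_all

lemma step_turn: "v \<in> V \<Longrightarrow> step True (turn v) = step False v"
  by (erule V_E) (simp add: turn_u)

lemma turn_unique:
  assumes "v \<in> V" "w \<in> V" "step True w = step False v" shows "w = turn v"
proof -
  have "step True w = step True (turn v)" using assms step_turn by simp
  then show ?thesis using step_inj assms(1,2) by simp
qed

lemma turn_permutes: "turn permutes V"
proof (rule bij_imp_permutes)
  have "inj_on turn V"
    by (metis inj_onI step_inj step_turn)
  moreover have "turn ` V = V"
    by (rule card_subset_eq[OF finite_V]) (use calculation in \<open>auto simp: card_image\<close>)
  ultimately show "bij_betw turn V V" by (simp add: bij_betw_def)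
qed (simp add: turn_def)

lemma turn_permutation: "permutation turn"
  using turn_permutes finite_V permutation_permutes by blast

definition tails :: "'a \<Rightarrow> 'a set" where
  "tails v = orbit turn v"

lemma tails_alt: "tails v = {(turn ^^ k) v | k. True}"
  unfolding tails_def by (rule orbit_altdef_permutation[OF turn_permutation])

lemma tails_sub: "v \<in> V \<Longrightarrow> tails v \<subseteq> V"
  unfolding tails_alt by auto

lemma self_tails: "v \<in> tails v"
  unfolding tails_def by (rule permutation_self_in_orbit[OF turn_permutation])

lemma turn_tails: "w \<in> tails v \<Longrightarrow> turn w \<in> tails v"
  unfolding tails_def by (rule orbit.step)

lemma tails_eq: "w \<in> tails v \<Longrightarrow> tails w = tails v"
  unfolding tails_def
  by (rule orbit_cyclic_eq3[OF cyclic_on_orbit'[OF turn_permutation]])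

lemma tails_turn: "tails (turn v) = tails v"
  using tails_eq turn_tails self_tails by blast

text \<open>
  As \<open>m\<close> divides \<open>n\<close>, \<open>t\<close> and \<open>r - 1\<close>, the sum of the coordinates is well defined modulo \<open>m\<close> and every
  arc increases it by one. So tails and heads of an alternating cycle lie on different levels.
\<close>
definition level :: "'a \<Rightarrow> int" where
  "level v = (THE l. \<exists>i j. v = u i j \<and> l = (i + j) mod int m)"

lemma m_dvd: "int m dvd int n" "int m dvd t" "int m dvd r - 1"
  using parameters by (metis dvd_triv_left dvd_triv_right of_nat_mult)+

lemma level_u: "level (u i j) = (i + j) mod int m"
  unfolding level_def
proof (rule the_equality)
  fix l assume "\<exists>i' j'. u i j = u i' j' \<and> l = (i' + j') mod int m"
  then obtain i' j' k where k: "i' = i + k * int m" "[j = j' + t * k] (mod int n)" "l = (i' + j') mod int m"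
    unfolding u_eq by blast
  have "int m dvd j - (j' + t * k)"
    using k(2) dvd_trans[OF m_dvd(1)] by (simp add: cong_iff_dvd_diff)
  then have "int m dvd (j - (j' + t * k)) + t * k - k * int m"
    by (rule dvd_diff[OF dvd_add[OF _ dvd_mult2[OF m_dvd(2)]] dvd_triv_right])
  then have "int m dvd (i + j) - (i' + j')" by (simp add: k(1) algebra_simps)
  then show "l = (i + j) mod int m" by (simp add: k(3) mod_eq_dvd_iff dvd_diff_commute)
qed blast

lemma e_mod_m: "int m dvd e i - 1"
proof -
  have "[r = 1] (mod int m)" using m_dvd(3) by (simp add: cong_iff_dvd_diff)
  then have "[e i = 1 ^ nat (i mod int m)] (mod int m)"
    unfolding row_power_def by (rule cong_pow)
  then show ?thesis by (simp add: cong_iff_dvd_diff)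
qed

lemma level_step: "v \<in> V \<Longrightarrow> [level (step c v) = level v + 1] (mod int m)"
proof (erule V_E)
  fix i j assume v: "v = u i j"
  have "[i + (j + e i) = i + j + 1] (mod int m)"
    using e_mod_m[of i] by (simp add: cong_iff_dvd_diff)
  then have "[level (step c v) = i + j + 1] (mod int m)"
    by (cases c) (simp_all add: v level_u cong_def ac_simps)
  moreover have "[level v + 1 = i + j + 1] (mod int m)"
    by (simp add: v level_u cong_def mod_simps)
  ultimately show "[level (step c v) = level v + 1] (mod int m)"
    by (simp add: cong_def)
qed

lemma level_turn: "v \<in> V \<Longrightarrow> level (turn v) = level v"
proof (erule V_E)
  fix i j assume v: "v = u i j"
  have "int m dvd (i - 1 + (j + e i)) - (i + j)" using e_mod_m[of i] by (simp add: algebra_simps)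
  then show "level (turn v) = level v" by (simp add: v turn_u level_u mod_eq_dvd_iff)
qed

lemma level_tails:
  assumes "v \<in> V" "w \<in> tails v" shows "level w = level v"
proof -
  obtain k where "w = (turn ^^ k) v" using assms(2) unfolding tails_alt by blast
  moreover have "level ((turn ^^ k) v) = level v"
    by (induction k) (simp_all add: level_turn assms(1))
  ultimately show ?thesis by simp
qed

definition tail_arcs :: "'a set \<Rightarrow> 'a rel" where
  "tail_arcs T = {(w, step c w) | w c. w \<in> T}"

lemma tail_arcsI: "w \<in> T \<Longrightarrow> (w, step c w) \<in> tail_arcs T"
  unfolding tail_arcs_def by blast

lemma Field_tail_arcs:
  assumes v: "v \<in> V"
  shows "Field (tail_arcs (tails v)) = tails v \<union> step False ` tails v"
proof -
  have "step True w \<in> step False ` tails v" if "w \<in> tails v" for w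
  proof -
    have "w \<in> turn ` tails v"
      using that permutation_orbit_step[OF turn_permutation] unfolding tails_def
      by (metis image_eqI orbit.cases permutation_self_in_orbit turn_permutation)
    then obtain w' where "w' \<in> tails v" "w = turn w'" by blast
    then show ?thesis using step_turn tails_sub[OF v] by auto
  qed
  moreover have "x \<in> Field (tail_arcs (tails v)) \<longleftrightarrow>
      x \<in> tails v \<or> (\<exists>w\<in>tails v. x = step True w \<or> x = step False w)" for x
  proof
    assume "x \<in> Field (tail_arcs (tails v))"
    then obtain w c where "w \<in> tails v" "x = w \<or> x = step c w"
      unfolding Field_def tail_arcs_def by auto
    then show "x \<in> tails v \<or> (\<exists>w\<in>tails v. x = step True w \<or> x = step False w)"
      by (cases c) auto
  qed (use tail_arcsI FieldI1 FieldI2 in metis)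
  ultimately show ?thesis by blast
qed

end

context class_II_normalised begin

text \<open>
  Both arcs that leave a tail of the cycle belong to it, and so do both arcs that enter a head. So the
  set of tails is closed under \<^const>\<open>turn\<close>, and consecutive tails differ by one application of it.
\<close>
lemma alternating_cycle_imp:
  assumes "alternating_cycle D C"
  obtains v where "v \<in> V" "C = tail_arcs (tails v)"
proof -
  obtain vs where L: "4 \<le> length vs" "even (length vs)" and dist: "distinct vs" and CD: "C \<subseteq> D"
    and C: "C = {(vs ! i, vs ! ((i + 1) mod length vs)) | i. i < length vs \<and> even i} \<union>
            {(vs ! ((i + 1) mod length vs), vs ! i) | i. i < length vs \<and> odd i}"
    using assms unfolding alternating_cycle_def by blast
  let ?L = "length vs"
  define T where "T = {vs ! i | i. i < ?L \<and> even i}"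
  have even_arc: "(vs ! i, vs ! (i + 1)) \<in> C" if "i < ?L" "even i" for i
  proof -
    have "i + 1 < ?L" using that L by (metis Suc_eq_plus1 Suc_lessI even_Suc)
    then show ?thesis unfolding C using that by (auto intro!: exI[of _ i])
  qed
  have odd_arc: "(vs ! ((i + 1) mod ?L), vs ! i) \<in> C" if "i < ?L" "odd i" for i
    unfolding C using that by blast
  have tail: "w \<in> T" if "(w, x) \<in> C" for w x
  proof -
    have "even ((i + 1) mod ?L)" if "i < ?L" "odd i" for i
      using that L by (simp add: dvd_mod)
    moreover have "(i + 1) mod ?L < ?L" for i by (rule mod_less_divisor) (use L in linarith)
    ultimately show ?thesis using that unfolding C T_def by blast
  qed
  have TV: "T \<subseteq> V"
    using even_arc CD unfolding T_def D_step by blast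
  have out: "\<exists>a b. (w, a) \<in> C \<and> (w, b) \<in> C \<and> a \<noteq> b" if "w \<in> T" for w
  proof -
    obtain i where i: "w = vs ! i" "i < ?L" "even i" using \<open>w \<in> T\<close> unfolding T_def by blast
    define k where "k = (if i = 0 then ?L - 1 else i - 1)"
    have k: "k < ?L" "odd k" "(k + 1) mod ?L = i" using i L by (auto simp: k_def)
    have i1: "i + 1 < ?L" using i L by (metis Suc_eq_plus1 Suc_lessI even_Suc)
    have "i + 1 \<noteq> k" using i L by (auto simp: k_def)
    then have "vs ! (i + 1) \<noteq> vs ! k" using nth_eq_iff_index_eq[OF dist i1 k(1)] by simp
    moreover have "(w, vs ! k) \<in> C" using odd_arc[OF k(1,2)] k(3) i by simp
    ultimately show ?thesis using even_arc[OF i(2,3)] i(1) by blast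
  qed
  have outC: "(w, step c w) \<in> C" if w: "w \<in> T" for w c
  proof -
    obtain a b where ab: "(w, a) \<in> C" "(w, b) \<in> C" "a \<noteq> b" using out[OF w] by blast
    then obtain c1 c2 where "a = step c1 w" "b = step c2 w" using CD unfolding D_step by blast
    then show ?thesis using ab by (cases c; cases c1; cases c2) simp_all
  qed
  have C_eq: "C = tail_arcs T"
  proof (rule subset_antisym; rule subsetI)
    fix a assume a: "a \<in> C"
    then obtain w c where "a = (w, step c w)" using CD unfolding D_step by blast
    then show "a \<in> tail_arcs T" using tail a tail_arcsI by metis
  qed (use outC in \<open>auto simp: tail_arcs_def\<close>)
  have into: "\<exists>w w'. w \<in> T \<and> w' \<in> T \<and> (w, vs ! k) \<in> C \<and> (w', vs ! k) \<in> C \<and> w \<noteq> w'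
      \<and> w = vs ! (k - 1) \<and> w' = vs ! ((k + 1) mod ?L)"
    if k: "k < ?L" "odd k" for k
  proof -
    have k0: "k - 1 < ?L" "even (k - 1)" "k - 1 + 1 = k" using k by (auto elim: oddE)
    have "(k + 1) mod ?L \<noteq> k - 1"
    proof (cases "k + 1 = ?L")
      case True then show ?thesis using L by simp
    next
      case False then show ?thesis using k by simp
    qed
    moreover have "(k + 1) mod ?L < ?L" by (rule mod_less_divisor) (use L in linarith)
    ultimately have "vs ! (k - 1) \<noteq> vs ! ((k + 1) mod ?L)"
      using nth_eq_iff_index_eq[OF dist] k0(1) by metis
    moreover have "(vs ! (k - 1), vs ! k) \<in> C" using even_arc[OF k0(1,2)] k0(3) by simp
    ultimately show ?thesis using odd_arc[OF k] tail by blast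
  qed
  have common: "w' = turn w \<or> w = turn w'"
    if a: "w \<in> V" "w' \<in> V" "w \<noteq> w'" "(w, x) \<in> D" "(w', x) \<in> D" for w w' x
  proof -
    obtain c c' where cc: "x = step c w" "x = step c' w'" using a(4,5) unfolding D_step by blast
    have "c \<noteq> c'"
    proof
      assume "c = c'"
      then have "step c w = step c w'" using cc by simp
      then show False using step_inj[OF a(1,2)] a(3) by blast
    qed
    then show ?thesis using cc a(1,2) turn_unique by (cases c; cases c') auto
  qed
  have turnT: "turn w \<in> T" if w: "w \<in> T" for w
  proof -
    have "(w, step False w) \<in> C" using outC[OF w] .
    then have "\<exists>k. k < ?L \<and> odd k \<and> step False w = vs ! k"
    proof -
      have "even i \<Longrightarrow> i < ?L \<Longrightarrow> (i + 1) mod ?L < ?L \<and> odd ((i + 1) mod ?L)" for i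
        using L by (metis Suc_eq_plus1 Suc_lessI even_Suc mod_less)
      then show ?thesis using \<open>(w, step False w) \<in> C\<close> unfolding C by blast
    qed
    then obtain k where k: "k < ?L" "odd k" "step False w = vs ! k" by blast
    then obtain w1 w2 where w12: "w1 \<in> T" "w2 \<in> T" "w1 \<noteq> w2" "(w1, step False w) \<in> D" "(w2, step False w) \<in> D"
      using into[OF k(1,2)] CD by (metis subsetD)
    then obtain w' where w': "w' \<in> T" "w' \<noteq> w" "(w', step False w) \<in> D" by metis
    then obtain c where c: "step False w = step c w'" unfolding D_step by blast
    have V: "w \<in> V" "w' \<in> V" using w w' TV by blast+
    have "c" using c w'(2) step_inj[OF V, of False] by (cases c) auto
    then have "w' = turn w" using c turn_unique[OF V] by simp
    then show ?thesis using w' by simp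
  qed
  have v0: "vs ! 0 \<in> T" unfolding T_def using L by force
  have "tails (vs ! 0) \<subseteq> T"
  proof
    fix w assume "w \<in> tails (vs ! 0)"
    then obtain k where "w = (turn ^^ k) (vs ! 0)" unfolding tails_alt by blast
    moreover have "(turn ^^ k) (vs ! 0) \<in> T" by (induction k) (simp_all add: v0 turnT)
    ultimately show "w \<in> T" by simp
  qed
  moreover have "T \<subseteq> tails (vs ! 0)"
  proof
    fix w assume "w \<in> T"
    then obtain i where "w = vs ! i" "i < ?L" "even i" unfolding T_def by blast
    then obtain k where k: "w = vs ! (2 * k)" "2 * k < ?L" by (metis evenE)
    have "vs ! (2 * k) \<in> tails (vs ! 0)" if "2 * k < ?L" for k
      using that
    proof (induction k)
      case 0 show ?case using self_tails by simp
    next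
      case (Suc k)
      let ?w = "vs ! (2 * k)" and ?w' = "vs ! (2 * Suc k)"
      have k: "2 * k + 1 < ?L" "odd (2 * k + 1)" using Suc.prems by simp_all
      have idx: "2 * k + 1 - 1 = 2 * k" "(2 * k + 1 + 1) mod ?L = 2 * Suc k" using Suc.prems by simp_all
      have "?w \<in> T" "?w' \<in> T" "(?w, vs ! (2 * k + 1)) \<in> C" "(?w', vs ! (2 * k + 1)) \<in> C" "?w \<noteq> ?w'"
        using into[OF k] unfolding idx by blast+
      then have "?w' = turn ?w \<or> ?w = turn ?w'" using common TV CD by (meson subsetD)
      moreover have "?w \<in> tails (vs ! 0)" using Suc by simp
      ultimately show ?case using turn_tails tails_turn tails_eq self_tails by metis
    qed
    then show "w \<in> tails (vs ! 0)" using k by blast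
  qed
  ultimately have "T = tails (vs ! 0)" by blast
  then show thesis using that[of "vs ! 0"] v0 TV C_eq by blast
qed

end

section \<open>Attachment\<close>

context class_II_normalised begin

lemma r_square_zero: "int n dvd (r - 1)\<^sup>2" and m_r: "int n dvd int m * (r - 1)"
  using parameters by metis+

lemma r_power_linear: "int n dvd r ^ k - (1 + int k * (r - 1))"
proof (induction k)
  case (Suc k)
  have "int n dvd r * (r ^ k - (1 + int k * (r - 1))) + int k * (r - 1)\<^sup>2"
    by (intro dvd_add dvd_mult Suc r_square_zero)
  also have "\<dots> = r ^ Suc k - (1 + int (Suc k) * (r - 1))"
    by (simp add: power2_eq_square algebra_simps)
  finally show ?case .
qed simp

text \<open>
  Since \<open>(r - 1)\<^sup>2 = 0\<close>, powers of \<open>r\<close> are linear in the exponent.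
\<close>
lemma e_linear: "int n dvd e i - (1 + i * (r - 1))"
proof -
  define a b where "a = i mod int m" and "b = i div int m"
  have i: "i = b * int m + a" by (simp add: a_def b_def)
  have "e i = r ^ nat a" by (simp add: row_power_def a_def)
  moreover have "int (nat a) = a" using m_pos by (simp add: a_def)
  ultimately have 1: "int n dvd e i - (1 + a * (r - 1))" using r_power_linear[of "nat a"] by simp
  have "int n dvd (e i - (1 + a * (r - 1))) - b * (int m * (r - 1))"
    by (rule dvd_diff[OF 1 dvd_mult[OF m_r]])
  also have "\<dots> = e i - (1 + (b * int m + a) * (r - 1))" by (simp add: algebra_simps)
  finally show ?thesis unfolding i[symmetric] .
qed

definition turn_sum :: "nat \<Rightarrow> int \<Rightarrow> int" where
  "turn_sum k i = (\<Sum>l<k. e (i - int l))"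

lemma turn_pow: "(turn ^^ k) (u i j) = u (i - int k) (j + turn_sum k i)"
  by (induction k) (simp_all add: turn_u turn_sum_def algebra_simps)

lemma turn_sum_linear:
  "int n dvd turn_sum k i - (int k + int k * i * (r - 1) - (r - 1) * (\<Sum>l<k. int l))"
proof (induction k)
  case (Suc k)
  have "int n dvd (turn_sum k i - (int k + int k * i * (r - 1) - (r - 1) * (\<Sum>l<k. int l)))
      + (e (i - int k) - (1 + (i - int k) * (r - 1)))"
    by (rule dvd_add[OF Suc e_linear])
  also have "\<dots> = turn_sum (Suc k) i
      - (int (Suc k) + int (Suc k) * i * (r - 1) - (r - 1) * (\<Sum>l<Suc k. int l))"
    by (simp add: turn_sum_def algebra_simps)
  finally show ?case .
qed (simp add: turn_sum_def)

lemma turn_sum_shift: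
  assumes "int m dvd int k" shows "int n dvd turn_sum k i - turn_sum k 0"
proof -
  obtain l where l: "int k = int m * l" using assms by blast
  have "int n dvd (turn_sum k i - (int k + int k * i * (r - 1) - (r - 1) * (\<Sum>l<k. int l)))
     - (turn_sum k 0 - (int k + int k * 0 * (r - 1) - (r - 1) * (\<Sum>l<k. int l)))
     + l * i * (int m * (r - 1))"
    by (intro dvd_add[OF dvd_diff[OF turn_sum_linear turn_sum_linear] dvd_mult[OF m_r]])
  also have "\<dots> = turn_sum k i - turn_sum k 0" by (simp add: l algebra_simps)
  finally show ?thesis .
qed

text \<open>
  A power of \<^const>\<open>turn\<close> preserves rows only if the exponent is a multiple of \<open>m\<close>; then the shift is the
  same in all rows because \<open>m (r - 1) = 0\<close>.
\<close>
lemma turn_period: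
  assumes "v \<in> V"
  shows "(turn ^^ k) v = v \<longleftrightarrow> (turn ^^ k) (u 0 0) = u 0 0"
proof -
  have *: "(turn ^^ k) (u i j) = u i j \<longleftrightarrow> (\<exists>l. int k = int m * l \<and> int n dvd turn_sum k 0 - t * l)" for i j
  proof -
    have "(turn ^^ k) (u i j) = u i j \<longleftrightarrow> (\<exists>l. int k = int m * l \<and> int n dvd turn_sum k i - t * l)"
      unfolding turn_pow u_eq by (auto simp: cong_iff_dvd_diff algebra_simps)
    moreover have "int n dvd turn_sum k i - t * l \<longleftrightarrow> int n dvd turn_sum k 0 - t * l"
      if "int k = int m * l" for l
    proof -
      have "int n dvd turn_sum k i - turn_sum k 0" by (rule turn_sum_shift) (simp add: that)
      then have "int n dvd (turn_sum k 0 - t * l) + (turn_sum k i - turn_sum k 0) \<longleftrightarrow>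
          int n dvd turn_sum k 0 - t * l"
        by (simp only: dvd_add_left_iff)
      then show ?thesis by (simp add: algebra_simps)
    qed
    ultimately show ?thesis by metis
  qed
  obtain i j where "v = u i j" using V_E[OF assms] .
  then show ?thesis using * by simp
qed

definition radius :: nat where
  "radius = card (tails (u 0 0))"

lemma turn_pow_eq: "(turn ^^ a) v = (turn ^^ b) v \<longleftrightarrow> [a = b] (mod card (tails v))"
  unfolding tails_def
  by (rule funpow_eq_iff_cong[OF permutation_self_in_orbit[OF turn_permutation]])

lemma card_tails:
  assumes v: "v \<in> V" shows "card (tails v) = radius"
proof -
  have "card (tails w) dvd k \<longleftrightarrow> (turn ^^ k) w = w" for w k
    using turn_pow_eq[of k w 0] by (simp add: cong_0_iff)
  then have "card (tails v) dvd k \<longleftrightarrow> radius dvd k" for k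
    using turn_period[OF v] by (simp add: radius_def)
  then show ?thesis by (metis dvd_antisym dvd_refl)
qed

lemma radius_pos: "0 < radius"
  unfolding radius_def using self_tails tails_sub[of "u 0 0"] finite_V finite_subset
  by (metis card_gt_0_iff empty_iff u_in)

lemma turn_pow_radius: "v \<in> V \<Longrightarrow> (turn ^^ radius) v = v"
  using turn_pow_eq[of radius v 0] card_tails[of v] by (simp add: cong_def)

lemma turn_pow_inj:
  assumes "v \<in> V" "a < radius" "b < radius" "(turn ^^ a) v = (turn ^^ b) v"
  shows "a = b"
  using assms turn_pow_eq[of a v b] card_tails[of v] by (simp add: cong_def)

lemma tails_bounded: "v \<in> V \<Longrightarrow> tails v = {(turn ^^ k) v | k. k < radius}"
  unfolding tails_def by (intro orbit_altdef_bounded turn_pow_radius radius_pos)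

lemma radius_gt_1: "1 < radius"
proof (rule ccontr)
  assume "\<not> 1 < radius"
  then have "radius = 1" using radius_pos by simp
  then have "u (- 1) (e 0) = u 0 0" using turn_pow_radius[of "u 0 0"] by (simp add: turn_u)
  from u_row[OF this] have "int m dvd 1" by (simp add: cong_iff_dvd_diff)
  then show False using m3 by simp
qed

text \<open>
  The cycle lists the tails in the order in which \<^const>\<open>turn\<close> visits them, each one followed by the
  head of its inner arc.
\<close>
lemma tail_arcs_alternating:
  assumes v: "v \<in> V"
  shows "alternating_cycle D (tail_arcs (tails v))"
proof -
  define f where "f i = (if even i then (turn ^^ (i div 2)) v else step False ((turn ^^ (i div 2)) v))" for i
  define vs where "vs = map f [0..<2 * radius]"
  have L: "length vs = 2 * radius" by (simp add: vs_def)
  have nth: "vs ! i = f i" if "i < 2 * radius" for i using that by (simp add: vs_def)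
  have levels: "level (f i) = level v" if "even i" for i
    using that level_tails[OF v] by (auto simp: f_def tails_alt)
  have levels': "[level (f i) = level v + 1] (mod int m)" if "odd i" for i
  proof -
    have "level ((turn ^^ (i div 2)) v) = level v" using level_tails[OF v] tails_alt by blast
    then show ?thesis using that level_step[of "(turn ^^ (i div 2)) v" False] v by (simp add: f_def)
  qed
  have "distinct vs"
    unfolding vs_def distinct_map
  proof
    show "inj_on f (set [0..<2 * radius])"
    proof (rule inj_onI)
      fix a b assume ab: "a \<in> set [0..<2 * radius]" "b \<in> set [0..<2 * radius]" "f a = f b"
      have eqp: "even a \<longleftrightarrow> even b"
      proof (rule ccontr)
        assume "even a \<noteq> even b"
        then have "[level v = level v + 1] (mod int m)"
          using levels[of a] levels[of b] levels'[of a] levels'[of b] ab(3)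
          by (cases "even a") (auto simp: cong_sym_eq)
        then have "int m dvd 1" by (simp add: cong_iff_dvd_diff)
        then show False using m3 by simp
      qed
      then have "(turn ^^ (a div 2)) v = (turn ^^ (b div 2)) v"
        using ab(3) v by (auto simp: f_def step_inj split: if_splits)
      moreover have "a div 2 < radius" "b div 2 < radius" using ab(1,2) by auto
      ultimately have "a div 2 = b div 2" using turn_pow_inj[OF v] by blast
      then show "a = b" using eqp by (metis even_iff_mod_2_eq_zero mult_div_mod_eq not_mod_2_eq_0_eq_1)
    qed
  qed simp
  moreover have "tail_arcs (tails v) \<subseteq> D"
    using tails_sub[OF v] unfolding tail_arcs_def D_step by blast
  moreover have "tail_arcs (tails v) =
      {(vs ! i, vs ! ((i + 1) mod length vs)) | i. i < length vs \<and> even i} \<union>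
      {(vs ! ((i + 1) mod length vs), vs ! i) | i. i < length vs \<and> odd i}" (is "_ = ?A \<union> ?B")
  proof -
    have A: "(vs ! (2 * k), vs ! ((2 * k + 1) mod length vs)) = ((turn ^^ k) v, step False ((turn ^^ k) v))"
      if "k < radius" for k
      using that by (simp add: L nth f_def)
    have B: "(vs ! ((2 * k + 1 + 1) mod length vs), vs ! (2 * k + 1)) =
        ((turn ^^ Suc k) v, step True ((turn ^^ Suc k) v))" if k: "k < radius" for k
    proof -
      have "vs ! ((2 * k + 1 + 1) mod length vs) = (turn ^^ Suc k) v"
      proof (cases "Suc k = radius")
        case True
        then have "2 * k + 1 + 1 = length vs" by (simp add: L)
        then have "vs ! ((2 * k + 1 + 1) mod length vs) = f 0" using radius_pos by (simp only: mod_self nth)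
        moreover have "(turn ^^ Suc k) v = v" using turn_pow_radius[OF v] True by simp
        ultimately show ?thesis by (simp add: f_def)
      next
        case False
        then have "2 * k + 1 + 1 < length vs" using k by (simp add: L)
        then show ?thesis by (simp add: L nth f_def)
      qed
      moreover have "vs ! (2 * k + 1) = step True ((turn ^^ Suc k) v)"
        using k v step_turn[of "(turn ^^ k) v"] by (simp add: L nth f_def)
      ultimately show ?thesis by simp
    qed
    have "?A = {((turn ^^ k) v, step False ((turn ^^ k) v)) | k. k < radius}"
    proof (rule subset_antisym; rule subsetI)
      fix a assume "a \<in> ?A"
      then obtain i where i: "a = (vs ! i, vs ! ((i + 1) mod length vs))" "i < length vs" "even i" by blast
      then obtain k where "i = 2 * k" by blast
      then show "a \<in> {((turn ^^ k) v, step False ((turn ^^ k) v)) | k. k < radius}"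
        using i A[of k] L by auto
    next
      fix a assume "a \<in> {((turn ^^ k) v, step False ((turn ^^ k) v)) | k. k < radius}"
      then obtain k where "k < radius" "a = ((turn ^^ k) v, step False ((turn ^^ k) v))" by blast
      then have "a = (vs ! (2 * k), vs ! ((2 * k + 1) mod length vs)) \<and> 2 * k < length vs \<and> even (2 * k)"
        using A[of k] L by simp
      then show "a \<in> ?A" by blast
    qed
    moreover have "?B = {((turn ^^ Suc k) v, step True ((turn ^^ Suc k) v)) | k. k < radius}"
    proof (rule subset_antisym; rule subsetI)
      fix a assume "a \<in> ?B"
      then obtain i where i: "a = (vs ! ((i + 1) mod length vs), vs ! i)" "i < length vs" "odd i" by blast
      then obtain k where k: "i = 2 * k + 1" by (auto elim: oddE)
      then have "k < radius" using i L by simp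
      then show "a \<in> {((turn ^^ Suc k) v, step True ((turn ^^ Suc k) v)) | k. k < radius}"
        using i(1) B[of k] unfolding k by blast
    next
      fix a assume "a \<in> {((turn ^^ Suc k) v, step True ((turn ^^ Suc k) v)) | k. k < radius}"
      then obtain k where k: "k < radius" "a = ((turn ^^ Suc k) v, step True ((turn ^^ Suc k) v))" by blast
      then have "a = (vs ! ((2 * k + 1 + 1) mod length vs), vs ! (2 * k + 1))" using B by simp
      moreover have "2 * k + 1 < length vs" "odd (2 * k + 1)" using k L by simp_all
      ultimately show "a \<in> ?B" by blast
    qed
    moreover have "tail_arcs (tails v) = {((turn ^^ k) v, step False ((turn ^^ k) v)) | k. k < radius} \<union>
       {((turn ^^ Suc k) v, step True ((turn ^^ Suc k) v)) | k. k < radius}" (is "_ = ?E \<union> ?F")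
    proof (rule subset_antisym; rule subsetI)
      fix a assume "a \<in> tail_arcs (tails v)"
      then obtain w c where a: "a = (w, step c w)" "w \<in> tails v" unfolding tail_arcs_def by blast
      show "a \<in> ?E \<union> ?F"
      proof (cases c)
        case True
        have "tails (turn v) = tails v" by (rule tails_turn)
        then obtain k where "k < radius" "w = (turn ^^ k) (turn v)"
          using a(2) tails_bounded[of "turn v"] v by auto
        have w: "w = (turn ^^ Suc k) v" using \<open>w = _\<close> by (simp add: funpow_swap1)
        have "a = (w, step True w)" using a(1) True by simp
        then have "a = ((turn ^^ Suc k) v, step True ((turn ^^ Suc k) v))" unfolding w .
        then show ?thesis using \<open>k < radius\<close> by (intro UnI2 CollectI exI[of _ k] conjI)
      next
        case False
        obtain k where k: "k < radius" "w = (turn ^^ k) v" using a(2) tails_bounded[OF v] by auto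
        have "a = (w, step False w)" using a(1) False by simp
        then have "a = ((turn ^^ k) v, step False ((turn ^^ k) v))" unfolding k(2) .
        then show ?thesis using k(1) by (intro UnI1 CollectI exI[of _ k] conjI)
      qed
    next
      fix a assume "a \<in> ?E \<union> ?F"
      then have "\<exists>k c. a = ((turn ^^ k) v, step c ((turn ^^ k) v))" by (elim UnE CollectE exE conjE) metis+
      then obtain k c where "a = ((turn ^^ k) v, step c ((turn ^^ k) v))" by (elim exE)
      moreover have "(turn ^^ k) v \<in> tails v" unfolding tails_alt by (intro CollectI exI[of _ k] conjI) simp_all
      ultimately show "a \<in> tail_arcs (tails v)" using tail_arcsI by simp
    qed
    ultimately show ?thesis by simp
  qed
  ultimately show ?thesis unfolding alternating_cycle_def using radius_gt_1 L
    by (intro exI[of _ vs]) simp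
qed

lemma card_tail_arcs:
  assumes v: "v \<in> V" shows "card (tail_arcs (tails v)) = 2 * radius"
proof -
  have "tail_arcs (tails v) = (\<lambda>(w, c). (w, step c w)) ` (tails v \<times> UNIV)"
    unfolding tail_arcs_def by auto
  moreover have "inj_on (\<lambda>(w, c). (w, step c w)) (tails v \<times> UNIV)"
  proof (rule inj_onI, clarsimp)
    fix w c c' assume "w \<in> tails v" "step c w = step c' w"
    then show "c = c'" using steps_distinct[of w] tails_sub[OF v] by (cases c; cases c') auto
  qed
  ultimately show ?thesis
    by (simp add: card_image card_cartesian_product card_tails[OF v])
qed

text \<open>
  The assumption makes the heads of an alternating cycle the tails of another one. As the level
  increases along arcs and \<open>m > 2\<close>, two distinct cycles that meet do so exactly in the heads of one,
  which are the tails of the other.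
\<close>
lemma tightly_attachedI:
  assumes tight: "\<And>v. v \<in> V \<Longrightarrow> step False (turn v) \<in> tails (step False v)"
  shows "tightly_attached X"
proof -
  have heads: "step False ` tails v = tails (step False v)" if v: "v \<in> V" for v
  proof (rule card_subset_eq)
    show "finite (tails (step False v))" using finite_V tails_sub v finite_subset step_in by metis
    have "step False ((turn ^^ k) v) \<in> tails (step False v)" for k
    proof (induction k)
      case (Suc k)
      have "step False (turn ((turn ^^ k) v)) \<in> tails (step False ((turn ^^ k) v))"
        using tight v by simp
      then show ?case using tails_eq[OF Suc] by simp
    qed (simp add: self_tails)
    then show "step False ` tails v \<subseteq> tails (step False v)" unfolding tails_alt[of v] by blast
    have "inj_on (step False) (tails v)"
    proof (rule inj_onI)
      fix x y assume "x \<in> tails v" "y \<in> tails v" "step False x = step False y"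
      then show "x = y" using step_inj[of x y False] tails_sub[OF v] by blast
    qed
    then show "card (step False ` tails v) = card (tails (step False v))"
      by (simp add: card_image card_tails v)
  qed
  have "invariant_orientation X D"
    unfolding invariant_orientation_def using arcs antisym invariant by blast
  moreover have "has_radius D radius"
    unfolding has_radius_def
  proof
    show "\<exists>C. alternating_cycle D C" using tail_arcs_alternating[of "u 0 0"] by auto
    show "\<forall>C. alternating_cycle D C \<longrightarrow> card C = 2 * radius"
      using alternating_cycle_imp card_tail_arcs by metis
  qed
  moreover have "has_attachment_number D radius"
    unfolding has_attachment_number_def
  proof (intro conjI allI impI)
    have field: "Field (tail_arcs (tails v)) = tails v \<union> tails (step False v)" if "v \<in> V" for v
      using Field_tail_arcs[OF that] heads[OF that] by simp
    have lev: "\<not> [l + 1 = l] (mod int m)" "\<not> [l + 2 = l] (mod int m)" for l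
    proof -
      have "\<not> int m dvd 1" using m3 by simp
      then show "\<not> [l + 1 = l] (mod int m)" by (simp add: cong_iff_dvd_diff)
      have "\<not> int m dvd 2" using m3 zdvd_imp_le[of "int m" 2] by auto
      then show "\<not> [l + 2 = l] (mod int m)" by (simp add: cong_iff_dvd_diff)
    qed
    have meet: "tails v = tails w" if "tails v \<inter> tails w \<noteq> {}" for v w
      using that tails_eq by blast
    show "\<exists>C C'. adjacent_alternating_cycles D C C'"
    proof -
      let ?v = "u 0 0" let ?w = "step False ?v"
      have w: "?w \<in> V" by (rule step_in) simp
      have "Field (tail_arcs (tails ?v)) \<inter> Field (tail_arcs (tails ?w)) \<noteq> {}"
        using field[of ?v] field[OF w] self_tails[of ?w] by auto
      moreover have "tail_arcs (tails ?v) \<noteq> tail_arcs (tails ?w)"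
      proof
        assume "tail_arcs (tails ?v) = tail_arcs (tails ?w)"
        then have "?v \<in> tails ?w" using self_tails[of ?v] unfolding tail_arcs_def by blast
        then have "level ?v = level ?w" using level_tails[OF w] by blast
        then show False using level_step[of ?v False] lev(1) by (metis cong_sym u_in)
      qed
      ultimately show ?thesis unfolding adjacent_alternating_cycles_def
        using tail_arcs_alternating[of ?v] tail_arcs_alternating[OF w] by (metis u_in)
    qed
    fix C C' assume adj: "adjacent_alternating_cycles D C C'"
    then have alt: "alternating_cycle D C" "alternating_cycle D C'" and "C \<noteq> C'" "Field C \<inter> Field C' \<noteq> {}"
      unfolding adjacent_alternating_cycles_def by auto
    obtain v where v: "v \<in> V" "C = tail_arcs (tails v)" using alternating_cycle_imp[OF alt(1)] .
    obtain w where w: "w \<in> V" "C' = tail_arcs (tails w)" using alternating_cycle_imp[OF alt(2)] .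
    have ne: "tails v \<noteq> tails w" using \<open>C \<noteq> C'\<close> v w by auto
    have 1: "tails v \<inter> tails w = {}" using ne meet by blast
    have 2: "tails (step False v) \<inter> tails (step False w) = {}"
    proof -
      have "step False ` tails v \<inter> step False ` tails w = {}"
      proof (rule ccontr)
        assume "\<not> ?thesis"
        then obtain a b where ab: "a \<in> tails v" "b \<in> tails w" "step False a = step False b" by blast
        then have "a \<in> V" "b \<in> V" using tails_sub v(1) w(1) by blast+
        then have "a = b" using ab(3) step_inj[of a b False] by simp
        then show False using ab 1 by blast
      qed
      then show ?thesis using heads v w by simp
    qed
    have "Field C \<inter> Field C' = (tails v \<inter> tails (step False w)) \<union> (tails (step False v) \<inter> tails w)"
      using 1 2 field v w by auto
    moreover have key: "card ((tails x \<inter> tails (step False y)) \<union> (tails (step False x) \<inter> tails y)) = radius"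
      if "x \<in> V" "y \<in> V" "tails x \<inter> tails (step False y) \<noteq> {}" for x y
    proof -
      have eq: "tails x = tails (step False y)" using that(3) by (rule meet)
      then have "x \<in> tails (step False y)" using self_tails by blast
      then have "level x = level (step False y)" using level_tails that(2) step_in by metis
      then have xy: "[level x = level y + 1] (mod int m)" using level_step[OF that(2), of False] by simp
      have "tails (step False x) \<inter> tails y = {}"
      proof (rule ccontr)
        assume "tails (step False x) \<inter> tails y \<noteq> {}"
        then have "step False x \<in> tails y" using meet self_tails by blast
        then have "level (step False x) = level y" using level_tails that(2) by blast
        then have "[level y = level x + 1] (mod int m)" using level_step[OF that(1), of False] by simp
        then have "int m dvd (level x - (level y + 1)) + (level y - (level x + 1))"
          using xy by (intro dvd_add) (simp_all add: cong_iff_dvd_diff)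
        then have "int m dvd - 2" by (simp add: algebra_simps)
        then show False using lev(2)[of 0] by (simp add: cong_iff_dvd_diff)
      qed
      then show ?thesis using eq card_tails[OF that(1)] by simp
    qed
    ultimately show "card (Field C \<inter> Field C') = radius"
    proof (cases "tails v \<inter> tails (step False w) = {}")
      case False then show ?thesis using key[OF v(1) w(1)] \<open>Field C \<inter> Field C' = _\<close> by simp
    next
      case True
      then have "tails w \<inter> tails (step False v) \<noteq> {}"
        using \<open>Field C \<inter> Field C' \<noteq> {}\<close> \<open>Field C \<inter> Field C' = _\<close> by blast
      then show ?thesis using key[OF w(1) v(1)] \<open>Field C \<inter> Field C' = _\<close>
        by (simp add: Int_commute Un_commute)
    qed
  qed
  ultimately show ?thesis unfolding tightly_attached_def by blast
qed

text \<open>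
  The map \<open>turn\<^sup>m\<close> is the shift of every row by \<open>m w\<close>. On the other hand, \<open>turn\<close> and the inner step commute
  up to the shift by \<open>r - 1 = m q\<close>. If this shift is a power of the former, the cycles are tightly attached.
\<close>
lemma tightness:
  "tightly_attached X \<or>
     (even m \<and> even (n div m) \<and>
       (\<exists>n\<^sub>1::nat. n\<^sub>1 > 2 \<and> n = 8 * n\<^sub>1 \<and> (even n\<^sub>1 \<or> \<not> squarefree n\<^sub>1)))"
proof -
  obtain c q d where p: "n = m * d" "2 < d" "t = c * int m" "r - 1 = int m * q"
    "0 \<le> c" "c < int d" "0 \<le> q" "q < int d"
    "int n dvd t * c - int m" "int n dvd t * q + (r - 1)"
    "int n dvd int m * (r - 1)" "int n dvd (r - 1)\<^sup>2" "\<not> int n dvd 2 * (r - 1)"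
    using parameters .
  have nd: "int n = int m * int d" using p(1) by simp
  have cancel: "int n dvd int m * a \<longleftrightarrow> int d dvd a" for a unfolding nd using m_pos by simp
  define M where "M = (\<Sum>l<m. int l)"
  have M2: "2 * M = int m * (int m - 1)"
  proof -
    have "2 * (\<Sum>l<k. int l) = int k * (int k - 1)" for k
      by (induction k) (simp_all add: algebra_simps)
    then show ?thesis by (simp add: M_def)
  qed
  define w where "w = 1 - c - q * M"
  have turn_m: "(turn ^^ m) (u i j) = u i (j + int m * w)" for i j
  proof -
    have "(turn ^^ m) (u i j) = u (i + (- 1) * int m) (j + turn_sum m i)"
      unfolding turn_pow by simp
    also have "\<dots> = u i (j + turn_sum m i - t)" unfolding u_wrap_mult by simp
    also have "\<dots> = u i (j + int m * w)"
    proof -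
      have "int n dvd (turn_sum m i - (int m + int m * i * (r - 1) - (r - 1) * M)) + i * (int m * (r - 1))"
        unfolding M_def by (rule dvd_add[OF turn_sum_linear dvd_mult[OF m_r]])
      also have "\<dots> = (j + turn_sum m i - t) - (j + int m * w)"
        unfolding p(4) w_def p(3) by (simp add: algebra_simps)
      finally show ?thesis by (simp add: u_same_row cong_iff_dvd_diff)
    qed
    finally show ?thesis .
  qed
  have turn_mk: "((turn ^^ m) ^^ k) (u i j) = u i (j + int k * (int m * w))" for k i j
    by (induction k) (simp_all add: turn_m algebra_simps)
  show ?thesis
  proof (cases "gcd w (int d) dvd q")
    case True
    then obtain q' where q': "q = gcd w (int d) * q'" by blast
    obtain a b where ab: "a * w + b * int d = gcd w (int d)" using bezout_int by blast
    \<comment> \<open>The number of times \<open>turn\<^sup>m\<close> has to be applied to shift by \<open>- (r - 1)\<close>.\<close>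
    define k where "k = nat ((- a * q') mod int d)"
    have "int k = (- a * q') mod int d" using p(2) by (simp add: k_def)
    then have "int d dvd int k - (- a * q')"
      using dvd_minus_mod[of "int d" "- a * q'"] by (simp only: dvd_diff_commute)
    then have "int d dvd (int k - (- a * q')) * w + int d * (b * q')" by (intro dvd_add dvd_mult2) simp_all
    also have "\<dots> = int k * w + (a * w + b * int d) * q'" by (simp add: algebra_simps)
    also have "\<dots> = int k * w + q" using ab q' by simp
    finally have "int n dvd int m * (int k * w + q)" using cancel by blast
    then have kw: "int n dvd int k * (int m * w) + (r - 1)" unfolding p(4) by (simp add: algebra_simps)
    have "step False (turn v) \<in> tails (step False v)" if v: "v \<in> V" for v
    proof -
      obtain i j where ij: "v = u i j" using V_E[OF v] .
      have "int n dvd (e i - (1 + i * (r - 1))) - (e (i - 1) - (1 + (i - 1) * (r - 1)))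
          + (int k * (int m * w) + (r - 1))"
        by (rule dvd_add[OF dvd_diff[OF e_linear e_linear] kw])
      then have "u (i - 1) (j + e i + e i + int k * (int m * w)) = u (i - 1) (j + e i + e (i - 1))"
        by (simp add: u_same_row cong_iff_dvd_diff algebra_simps)
      then have "step False (turn v) = ((turn ^^ m) ^^ k) (turn (step False v))"
        by (simp add: ij turn_u turn_mk)
      also have "\<dots> = (turn ^^ (Suc (m * k))) (step False v)"
        by (simp add: funpow_mult funpow_swap1)
      finally show ?thesis unfolding tails_alt by blast
    qed
    then show ?thesis using tightly_attachedI by blast
  next
    case False
    have mq: "int d dvd int m * q" using p(11) cancel p(4) by simp
    have cc: "int d dvd c * c - 1"
    proof -
      have "t * c - int m = int m * (c * c - 1)" by (simp add: p(3) algebra_simps)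
      then show ?thesis using p(9) cancel by metis
    qed
    have cq: "int d dvd (c + 1) * q"
    proof -
      have "t * q + (r - 1) = int m * ((c + 1) * q)" by (simp add: p(3,4) algebra_simps)
      then show ?thesis using p(10) cancel by metis
    qed
    have q2: "\<not> int d dvd 2 * q"
    proof -
      have "2 * (r - 1) = int m * (2 * q)" by (simp add: p(4))
      then show ?thesis using p(13) cancel by metis
    qed
    have w2: "2 * w = 2 * (1 - c) - q * int m * (int m - 1)"
    proof -
      have "2 * w = 2 * (1 - c) - q * (2 * M)" by (simp add: w_def algebra_simps)
      then show ?thesis unfolding M2 by (simp only: mult.assoc)
    qed
    from non_tight_parameters[OF m_pos _ mq cc cq q2 w2 False] p(2)
    have alt: "even (int m) \<and> even (int d) \<and> (int m = 4 \<and> int d = 4 \<or>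
      (\<exists>n\<^sub>1::nat. n\<^sub>1 > 2 \<and> int m * int d = 8 * int n\<^sub>1 \<and> (even n\<^sub>1 \<or> \<not> squarefree n\<^sub>1)))" by simp
    have "\<not> (m = 4 \<and> d = 4)"
    proof
      assume md: "m = 4 \<and> d = 4"
      then have "q \<in> {0, 1, 2, 3}" "c \<in> {0, 1, 2, 3}" using p(5-8) by auto
      then have "(q = 1 \<or> q = 3) \<and> c = 3"
        using q2 cq md by auto
      then show False using not_exceptional[of "r - 1"] md p(1,3,4) by auto
    qed
    then have "\<exists>n\<^sub>1::nat. n\<^sub>1 > 2 \<and> int m * int d = 8 * int n\<^sub>1 \<and> (even n\<^sub>1 \<or> \<not> squarefree n\<^sub>1)"
      using alt by auto
    then obtain n1 :: nat where n1: "n1 > 2" "int m * int d = 8 * int n1" "even n1 \<or> \<not> squarefree n1"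
      by blast
    have "n = 8 * n1" using n1(2) nd by (metis of_nat_eq_iff of_nat_mult of_nat_numeral)
    moreover have "n div m = d" using p(1) m3 by simp
    ultimately show ?thesis using n1 alt by auto
  qed
qed

end

section \<open>Cayley graphs\<close>

context class_II_coordinates begin

text \<open>
  The automorphisms that map outer arcs to outer arcs form a group, which acts semiregularly by
  \<open>aut_eqI\<close>. It contains \<open>\<rho>\<close> and \<open>\<sigma>\<close>, which generate a transitive subgroup. An element \<open>g\<close> of the
  latter corresponds to the vertex \<open>g (u 0 0)\<close>; products being read from left to right, the
  neighbour \<open>g (s (u 0 0))\<close> corresponds to the product of \<open>s\<close> and \<open>g\<close>.
\<close>
lemma is_cayley:
  assumes rho: "\<rho> \<in> automorphisms X" "\<And>i j. \<rho> (u i j) = u i (j + 1)"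
    and sigma: "\<sigma> \<in> automorphisms X" "\<And>i j. \<sigma> (u i j) = u (i + 1) (r * j)"
  shows "is_cayley_graph_for X (subgroup_generated (aut_group X) {\<rho>, \<sigma>})"
proof -
  let ?G = "aut_group X"
  let ?H = "subgroup_generated ?G {\<rho>, \<sigma>}"
  interpret G: group ?G by (rule group_aut_group)
  interpret H: group ?H by (rule G.group_subgroup_generated)
  let ?o = "u 0 0"
  define C where "C = {g \<in> automorphisms X. \<forall>v\<in>V. \<not> swaps g v}"
  have C: "g \<in> C \<longleftrightarrow> g \<in> automorphisms X \<and> (\<forall>v\<in>V. g (step True v) = step True (g v))" for g
    unfolding C_def swaps_def by simp
  have sub: "subgroup C ?G"
  proof (rule G.subgroupI)
    show "C \<subseteq> carrier ?G" unfolding C_def by auto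
    have "id \<in> C" unfolding C by (simp add: id_aut)
    then show "C \<noteq> {}" by blast
    fix g assume g: "g \<in> C"
    then have ga: "g \<in> automorphisms X" by (simp add: C)
    note p = aut_permutes[OF ga]
    have "Hilbert_Choice.inv g (step True v) = step True (Hilbert_Choice.inv g v)" if v: "v \<in> V" for v
    proof -
      obtain w where w: "w \<in> V" "g w = v" using aut_surj[OF ga v] .
      then have "step True v = g (step True w)" using g C by auto
      then show ?thesis using w permutes_inverses(2)[OF p] by auto
    qed
    then show "inv\<^bsub>?G\<^esub> g \<in> C" using inv_aut[OF ga] by (simp add: C aut_group_inv[OF ga])
    fix h assume h: "h \<in> C"
    then have ha: "h \<in> automorphisms X" by (simp add: C)
    then show "g \<otimes>\<^bsub>?G\<^esub> h \<in> C" using g h comp_aut[OF ha ga] unfolding C by simp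
  qed
  have "\<rho> \<in> C" unfolding C using rho by (auto elim!: V_E)
  moreover have "\<sigma> \<in> C" unfolding C using sigma by (auto elim!: V_E)
  ultimately have H_C: "carrier ?H \<subseteq> C"
    unfolding carrier_subgroup_generated
    by (intro G.generate_subgroup_incl[OF _ sub]) auto
  have H_aut: "h \<in> automorphisms X" if "h \<in> carrier ?H" for h using that H_C C by blast
  have rs: "\<rho> \<in> carrier ?H" "\<sigma> \<in> carrier ?H"
    using rho(1) sigma(1) by (auto simp: carrier_subgroup_generated intro: generate.incl)
  have H_comp: "g \<circ> h \<in> carrier ?H" if "g \<in> carrier ?H" "h \<in> carrier ?H" for g h
    using H.m_closed[OF that(2,1)] by simp
  have ex: "\<exists>h\<in>carrier ?H. h ?o = u (int i) (int j)" for i j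
  proof (induction j)
    case 0
    show ?case
    proof (induction i)
      case 0
      have "id \<in> carrier ?H" using H.one_closed by simp
      then show ?case by (intro bexI[of _ id]) simp_all
    next
      case (Suc i)
      then obtain h where "h \<in> carrier ?H" "h ?o = u (int i) 0" by auto
      then show ?case using H_comp[OF rs(2)] sigma(2)
        by (intro bexI[of _ "\<sigma> \<circ> h"]) (simp_all add: add.commute)
    qed
  next
    case (Suc j)
    then obtain h where "h \<in> carrier ?H" "h ?o = u (int i) (int j)" by auto
    then show ?case using H_comp[OF rs(1)] rho(2)
      by (intro bexI[of _ "\<rho> \<circ> h"]) (simp_all add: add.commute)
  qed
  have trans: "\<exists>h\<in>carrier ?H. h ?o = v" if v: "v \<in> V" for v
  proof -
    obtain i j where "i < m" "0 \<le> j" "j < int n" "v = u (int i) j" using v by (rule coords_E)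
    then show ?thesis using ex[of i "nat j"] by simp
  qed
  define \<phi> where "\<phi> h = h ?o" for h :: "'a \<Rightarrow> 'a"
  have bij: "bij_betw \<phi> (carrier ?H) V"
    unfolding bij_betw_def
  proof
    show "inj_on \<phi> (carrier ?H)"
    proof (rule inj_onI)
      fix g h assume gh: "g \<in> carrier ?H" "h \<in> carrier ?H" "\<phi> g = \<phi> h"
      have "swaps g ?o = swaps h ?o" using gh(1,2) H_C unfolding C_def by auto
      then show "g = h" using gh H_aut by (intro aut_eqI[of g h ?o]) (auto simp: \<phi>_def)
    qed
    show "\<phi> ` carrier ?H = V"
    proof (rule subset_antisym; rule subsetI)
      fix v assume "v \<in> V"
      then obtain h where "h \<in> carrier ?H" "h ?o = v" using trans by blast
      then show "v \<in> \<phi> ` carrier ?H" by (intro image_eqI[of _ _ h]) (simp_all add: \<phi>_def)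
    qed (use aut_in[OF H_aut] in \<open>auto simp: \<phi>_def\<close>)
  qed
  define S where "S = {h \<in> carrier ?H. (?o, h ?o) \<in> parcs X}"
  have sym: "(v, w) \<in> parcs X \<longleftrightarrow> (w, v) \<in> parcs X" for v w unfolding arcs by auto
  have inv_H: "inv\<^bsub>?H\<^esub> h = Hilbert_Choice.inv h" if "h \<in> carrier ?H" for h
    using G.inv_subgroup_generated[OF that] aut_group_inv[OF H_aut[OF that]] by simp
  have "\<forall>s\<in>S. inv\<^bsub>?H\<^esub> s \<in> S"
  proof
    fix h assume "h \<in> S"
    then have h: "h \<in> carrier ?H" "(?o, h ?o) \<in> parcs X" unfolding S_def by auto
    let ?i = "Hilbert_Choice.inv h"
    have i: "?i \<in> automorphisms X" using inv_aut[OF H_aut[OF h(1)]] .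
    have "(?i ?o, ?i (h ?o)) \<in> parcs X"
      using aut_arcs[OF i] h aut_in[OF H_aut[OF h(1)]] by simp
    then have "(?o, ?i ?o) \<in> parcs X"
      using permutes_inverses(2)[OF aut_permutes[OF H_aut[OF h(1)]]] sym by simp
    then show "inv\<^bsub>?H\<^esub> h \<in> S" using H.inv_closed[OF h(1)] unfolding S_def inv_H[OF h(1)] by simp
  qed
  moreover have "S \<subseteq> carrier ?H - {\<one>\<^bsub>?H\<^esub>}"
  proof -
    have "(?o, ?o) \<notin> parcs X" using antisym unfolding arcs by blast
    then show ?thesis unfolding S_def by auto
  qed
  moreover have "digraph_iso (with_proj X) (with_proj (cayley_graph ?H S))"
  proof (rule digraph_isoI[OF wf_X, of \<phi>])
    show "bij_betw \<phi> (pverts (cayley_graph ?H S)) V" using bij by (simp add: cayley_graph_def)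
    have SH: "S \<subseteq> carrier ?H" unfolding S_def by blast
    show "parcs (cayley_graph ?H S) \<subseteq> pverts (cayley_graph ?H S) \<times> pverts (cayley_graph ?H S)"
      using SH H.m_closed unfolding cayley_graph_def by auto
    have par: "parcs (cayley_graph ?H S) = {(g, g \<circ> h) | g h. g \<in> carrier ?H \<and> h \<in> S}"
      by (simp add: cayley_graph_def)
    show "map_prod \<phi> \<phi> ` parcs (cayley_graph ?H S) = parcs X"
    proof (rule subset_antisym; rule subsetI)
      fix x assume "x \<in> map_prod \<phi> \<phi> ` parcs (cayley_graph ?H S)"
      then obtain b where "x = map_prod \<phi> \<phi> b" "b \<in> parcs (cayley_graph ?H S)" by (rule imageE)
      then obtain g h where gh: "g \<in> carrier ?H" "h \<in> S" "x = (g ?o, g (h ?o))"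
        unfolding par by (auto simp: \<phi>_def)
      then have "(?o, h ?o) \<in> parcs X" "h \<in> carrier ?H" unfolding S_def by auto
      then show "x \<in> parcs X" using gh aut_arcs[OF H_aut[OF gh(1)]] aut_in[OF H_aut] by simp
    next
      fix x assume x: "x \<in> parcs X"
      obtain v w where vw: "x = (v, w)" by (cases x)
      have V: "v \<in> V" "w \<in> V" using x vw unfolding arcs D_step by auto
      obtain g where g: "g \<in> carrier ?H" "g ?o = v" using trans[OF V(1)] by blast
      obtain k where k: "k \<in> carrier ?H" "k ?o = w" using trans[OF V(2)] by blast
      let ?h = "Hilbert_Choice.inv g \<circ> k"
      note inv1 = permutes_inverses(1)[OF aut_permutes[OF H_aut[OF g(1)]]]
      have h: "?h \<in> carrier ?H" using H_comp[OF _ k(1)] H.inv_closed[OF g(1)] inv_H[OF g(1)] by simp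
      have gh: "g (?h ?o) = w" using k inv1 by simp
      have "(g ?o, g (?h ?o)) \<in> parcs X" using x vw g gh by simp
      then have "(?o, ?h ?o) \<in> parcs X" using aut_arcs[OF H_aut[OF g(1)]] aut_in[OF H_aut[OF h]] by simp
      then have "?h \<in> S" using h unfolding S_def by simp
      then have "(g, g \<circ> ?h) \<in> parcs (cayley_graph ?H S)" unfolding par using g(1) by blast
      moreover have "map_prod \<phi> \<phi> (g, g \<circ> ?h) = x" using g gh vw by (simp add: \<phi>_def)
      ultimately show "x \<in> map_prod \<phi> \<phi> ` parcs (cayley_graph ?H S)" by (metis imageI)
    qed
  qed
  ultimately show ?thesis unfolding is_cayley_graph_for_def by blast
qed

end

section \<open>Existence of coordinates\<close>

locale oriented_class_II = oriented_metacirculant X D n \<rho> \<sigma> r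
  for X :: "'a pair_pre_digraph" and D n \<rho> \<sigma> r +
  fixes m :: nat
  assumes orbits_cyclic: "cyclic_on ((`) \<sigma>) (vertex_orbits X \<rho>)"
    and card_orbits: "card (vertex_orbits X \<rho>) = m"
    and inner_degree: "v \<in> pverts X \<Longrightarrow> card {w \<in> orbit \<rho> v. (v, w) \<in> parcs X} = 2"
    and joined_card: "v \<in> pverts X \<Longrightarrow> card (joined_orbits X \<rho> (orbit \<rho> v)) = 2"
    and joined_degree: "v \<in> pverts X \<Longrightarrow> B \<in> joined_orbits X \<rho> (orbit \<rho> v) \<Longrightarrow>
        card {w \<in> B. (v, w) \<in> parcs X} = 1"
begin

text \<open>
  The neighbours of \<open>v\<close> in its orbit include \<open>\<rho>\<^sup>s v\<close> and \<open>\<rho>\<^sup>-\<^sup>s v\<close> for some \<open>s\<close>, and there are only two of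
  them. One of them is an out-neighbour if and only if the other one is an in-neighbour.
\<close>
lemma inner_out:
  assumes v: "v \<in> V"
  obtains s where "\<forall>w\<in>orbit \<rho> v. (v, w) \<in> D \<longleftrightarrow> w = R s v"
proof -
  let ?N = "{w \<in> orbit \<rho> v. (v, w) \<in> parcs X}"
  have D_R: "(R j v, v) \<in> D \<longleftrightarrow> (v, R (- j) v) \<in> D" for j
    using D_iff[OF R_aut, of v "R (- j) v" j] v by (simp add: R_R R_0)
  have in_orbit: "R j v \<in> orbit \<rho> v" for j using orbit_rho[OF v] by blast
  have "?N \<noteq> {}" using inner_degree[OF v] by (metis card.empty zero_neq_numeral)
  then obtain x where x: "x \<in> orbit \<rho> v" "(v, x) \<in> parcs X" by blast
  from x(1) obtain j where "x = R j v" unfolding orbit_rho[OF v] by blast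
  then have "(v, R j v) \<in> parcs X" using x(2) by simp
  then obtain s where s: "(v, R s v) \<in> D" using arcs D_R[of j] by blast
  then have s': "(R (- s) v, v) \<in> D" using D_R[of "- s"] by simp
  have "w = R s v" if w: "w \<in> orbit \<rho> v" "(v, w) \<in> D" for w
  proof (rule ccontr)
    assume "w \<noteq> R s v"
    moreover have "R (- s) v \<noteq> w" "R (- s) v \<noteq> R s v"
      using antisym[OF w(2)] antisym[OF s] s' by auto
    ultimately have "card {w, R s v, R (- s) v} = 3" by simp
    moreover have "{w, R s v, R (- s) v} \<subseteq> ?N" using w s s' in_orbit arcs by simp
    moreover have "finite ?N" using inner_degree[OF v] by (metis card.infinite zero_neq_numeral)
    ultimately have "3 \<le> card ?N" by (metis card_mono)
    then show False using inner_degree[OF v] by simp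
  qed
  then have "\<forall>w\<in>orbit \<rho> v. (v, w) \<in> D \<longleftrightarrow> w = R s v" using s by auto
  then show thesis by (rule that)
qed

lemma move_trans:
  assumes "v \<in> V" "w \<in> V"
  obtains j i where "move j i v = w"
proof -
  have orb: "orbit \<rho> x \<in> vertex_orbits X \<rho>" if "x \<in> V" for x
    unfolding vertex_orbits_def using that by blast
  have "vertex_orbits X \<rho> = orbit ((`) \<sigma>) (orbit \<rho> v)"
    using orbits_cyclic orb[OF assms(1)] unfolding cyclic_on_alldef by blast
  then obtain i where "orbit \<rho> w = ((`) \<sigma> ^^ i) (orbit \<rho> v)"
    using orb[OF assms(2)] unfolding orbit_altdef[of "(`) \<sigma>"] by blast
  then have "w \<in> orbit \<rho> ((\<sigma> ^^ i) v)" using orbit_sigma_pow[OF assms(1)] self_orbit by metis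
  then obtain j where "w = R j ((\<sigma> ^^ i) v)"
    using orbit_rho[of "(\<sigma> ^^ i) v"] assms(1) by auto
  then show thesis using that[of j i] by (simp add: move_def)
qed

lemma joined_iff:
  assumes "v \<in> V" "(v, w) \<in> parcs X"
  shows "orbit \<rho> w \<in> joined_orbits X \<rho> (orbit \<rho> v) \<longleftrightarrow> w \<notin> orbit \<rho> v"
proof -
  have "orbit \<rho> w \<noteq> orbit \<rho> v \<longleftrightarrow> w \<notin> orbit \<rho> v" using self_orbit orbit_eq by blast
  moreover have "orbit \<rho> w \<in> vertex_orbits X \<rho>"
    using arcs_V[OF assms(2)] unfolding vertex_orbits_def by blast
  ultimately show ?thesis unfolding joined_orbits_def using assms(2) self_orbit by blast
qed

lemma outer_unique:
  assumes "v \<in> V" "(v, w) \<in> parcs X" "(v, w') \<in> parcs X" "w \<notin> orbit \<rho> v" "orbit \<rho> w = orbit \<rho> w'"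
  shows "w = w'"
proof -
  have "card {x \<in> orbit \<rho> w. (v, x) \<in> parcs X} = 1"
    using joined_degree[OF assms(1)] joined_iff[OF assms(1,2)] assms(4) by blast
  then obtain y where y: "{x \<in> orbit \<rho> w. (v, x) \<in> parcs X} = {y}" by (rule card_1_singletonE)
  have "w \<in> {x \<in> orbit \<rho> w. (v, x) \<in> parcs X}" "w' \<in> {x \<in> orbit \<rho> w. (v, x) \<in> parcs X}"
    using self_orbit[of w] self_orbit[of w'] assms by simp_all
  then show ?thesis unfolding y by simp
qed

text \<open>
  If a neighbour \<open>w\<close> of \<open>v\<close> in another orbit is an in-neighbour, then an automorphism that maps \<open>w\<close> to \<open>v\<close>
  maps \<open>v\<close> to an out-neighbour in another orbit.
\<close>
lemma outer_out:
  assumes v: "v \<in> V"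
  obtains w where "(v, w) \<in> D" "w \<notin> orbit \<rho> v"
proof -
  have "joined_orbits X \<rho> (orbit \<rho> v) \<noteq> {}"
    using joined_card[OF v] by (metis card.empty zero_neq_numeral)
  then obtain B where B: "B \<in> joined_orbits X \<rho> (orbit \<rho> v)" by blast
  obtain w where "{x \<in> B. (v, x) \<in> parcs X} = {w}"
    using joined_degree[OF v B] by (rule card_1_singletonE)
  then have w: "w \<in> B" "(v, w) \<in> parcs X" by auto
  have "B \<in> vertex_orbits X \<rho>" "B \<noteq> orbit \<rho> v" using B unfolding joined_orbits_def by auto
  then have "w \<notin> orbit \<rho> v" using w(1) orbit_eq unfolding vertex_orbits_def by blast
  show thesis
  proof (cases "(v, w) \<in> D")
    case True then show thesis using that \<open>w \<notin> orbit \<rho> v\<close> by blast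
  next
    case False
    then have wv: "(w, v) \<in> D" using w(2) arcs by blast
    then have wV: "w \<in> V" using D_V by blast
    obtain j i where mw: "move j i w = v" using move_trans[OF wV v] .
    have "(v, move j i v) \<in> D" using invariant[OF move_aut wv, of j i] mw by simp
    moreover have "move j i v \<notin> orbit \<rho> v"
    proof
      assume "move j i v \<in> orbit \<rho> v"
      then have "v \<in> orbit \<rho> w" using move_orbit[OF v wV, of j i] mw by simp
      then have "orbit \<rho> v = orbit \<rho> w" by (rule orbit_eq)
      then show False using \<open>w \<notin> orbit \<rho> v\<close> self_orbit[of w] by simp
    qed
    ultimately show thesis by (rule that)
  qed
qed

lemma move_rho: "move j i \<circ> \<rho> = (\<rho> ^^ nat (r ^ i mod int n)) \<circ> move j i"
proof
  fix x
  show "(move j i \<circ> \<rho>) x = ((\<rho> ^^ nat (r ^ i mod int n)) \<circ> move j i) x"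
  proof (cases "x \<in> V")
    case True
    have "\<rho> x = R 1 x" using R_nat[OF True, of 1] by simp
    then have "move j i (\<rho> x) = R (r ^ i + j) ((\<sigma> ^^ i) x)"
      using True by (simp add: move_def sigma_pow_R R_R add.commute)
    also have "\<dots> = R (r ^ i) (move j i x)" using True by (simp add: move_def R_R)
    finally show ?thesis by (simp add: R_def)
  next
    case False
    then show ?thesis
      using aut_outside[OF move_aut] aut_outside[OF rho] aut_outside[OF funpow_aut[OF rho]] by simp
  qed
qed

end

text \<open>
  Here \<open>\<sigma>\<close> moves \<open>v\<^sub>0\<close> along its outer arc, so that the four neighbours of \<open>v\<^sub>0\<close> are two vertices of its
  orbit, \<open>\<sigma> v\<^sub>0\<close> and the preimage of \<open>v\<^sub>0\<close> under \<open>\<sigma>\<close>.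
\<close>
locale class_II_pair = oriented_metacirculant X D n \<rho> \<sigma> r
  for X :: "'a pair_pre_digraph" and D n \<rho> \<sigma> r +
  fixes m :: nat and s :: int and v\<^sub>0 :: 'a
  assumes m3: "3 \<le> m" and n3: "3 \<le> n"
    and card_orbits: "card (vertex_orbits X \<rho>) = m"
    and v0: "v\<^sub>0 \<in> pverts X"
    and out_v0: "(v\<^sub>0, w) \<in> D \<longleftrightarrow> w = R s v\<^sub>0 \<or> w = \<sigma> v\<^sub>0"
    and joined: "(v\<^sub>0, w) \<in> parcs X \<Longrightarrow> w \<in> orbit \<rho> v\<^sub>0 \<or> w = \<sigma> v\<^sub>0 \<or> \<sigma> w = v\<^sub>0"

text \<open>
  The new \<open>\<sigma>\<close> maps a vertex \<open>v\<close> to an out-neighbour \<open>w\<close> in another orbit. The preimage \<open>z\<close> of \<open>v\<close> is an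
  in-neighbour of \<open>v\<close>. It lies in neither of the orbits of \<open>v\<close> and \<open>w\<close>, as \<open>v\<close> has a single neighbour in
  the latter; so these are the two orbits joined to that of \<open>v\<close>.
\<close>
lemma (in oriented_class_II) class_II_pair_exists:
  obtains \<sigma>' r' s v\<^sub>0 where "class_II_pair X D n \<rho> \<sigma>' r' m s v\<^sub>0"
proof -
  have "vertex_orbits X \<rho> \<noteq> {}" using orbits_cyclic unfolding cyclic_on_alldef by blast
  then obtain v where v: "v \<in> V" unfolding vertex_orbits_def by blast
  obtain s where s: "\<forall>w\<in>orbit \<rho> v. (v, w) \<in> D \<longleftrightarrow> w = R s v" using inner_out[OF v] .
  obtain w where w: "(v, w) \<in> D" "w \<notin> orbit \<rho> v" using outer_out[OF v] .
  have wV: "w \<in> V" using w D_V by blast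
  obtain j i where ji: "move j i v = w" using move_trans[OF v wV] .
  let ?g = "move j i"
  obtain z where z: "z \<in> V" "?g z = v" using aut_surj[OF move_aut v] .
  have zv: "(z, v) \<in> D" using D_iff[OF move_aut z(1) v, of j i] z(2) ji w(1) by simp
  have z_out: "z \<notin> orbit \<rho> v"
  proof
    assume "z \<in> orbit \<rho> v"
    then obtain k where "z = R k v" using orbit_rho[OF v] by blast
    then have "v = R (j + r ^ i * k) ((\<sigma> ^^ i) v)" using z(2) v by (simp add: move_def sigma_pow_R R_R)
    then have "v \<in> orbit \<rho> w"
      using ji v orbit_rho[of "(\<sigma> ^^ i) v"] orbit_R[of "(\<sigma> ^^ i) v" j] by (auto simp: move_def)
    then show False using w(2) orbit_eq self_orbit by metis
  qed
  have nbr: "(v, w) \<in> parcs X" "(v, z) \<in> parcs X" using w zv arcs by auto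
  have diff: "orbit \<rho> w \<noteq> orbit \<rho> z"
  proof
    assume "orbit \<rho> w = orbit \<rho> z"
    then have "w = z" using outer_unique[OF v nbr w(2)] by blast
    then show False using zv w antisym by blast
  qed
  have joined_eq: "joined_orbits X \<rho> (orbit \<rho> v) = {orbit \<rho> w, orbit \<rho> z}"
  proof (rule sym, rule card_subset_eq)
    show "finite (joined_orbits X \<rho> (orbit \<rho> v))"
      using joined_card[OF v] by (metis card.infinite zero_neq_numeral)
    show "{orbit \<rho> w, orbit \<rho> z} \<subseteq> joined_orbits X \<rho> (orbit \<rho> v)"
      using joined_iff[OF v nbr(1)] joined_iff[OF v nbr(2)] w(2) z_out by blast
  qed (use diff joined_card[OF v] in simp)
  have outer: "x = w \<or> x = z" if "(v, x) \<in> parcs X" "x \<notin> orbit \<rho> v" for x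
    using joined_iff[OF v that(1)] that outer_unique[OF v that(1) nbr(1)]
      outer_unique[OF v that(1) nbr(2)] joined_eq by blast
  have "m \<ge> 3"
  proof -
    have "orbit \<rho> w \<noteq> orbit \<rho> v" "orbit \<rho> z \<noteq> orbit \<rho> v" using w(2) z_out self_orbit by metis+
    then have "card {orbit \<rho> v, orbit \<rho> w, orbit \<rho> z} = 3" using diff by simp
    moreover have "{orbit \<rho> v, orbit \<rho> w, orbit \<rho> z} \<subseteq> vertex_orbits X \<rho>"
      using v wV z(1) unfolding vertex_orbits_def by blast
    moreover have "finite (vertex_orbits X \<rho>)" unfolding vertex_orbits_def using finite_V by simp
    ultimately show ?thesis using card_orbits by (metis card_mono)
  qed
  have "n \<ge> 3"
  proof -
    have "(v, v) \<notin> parcs X" using antisym arcs by blast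
    then have sub: "{x \<in> orbit \<rho> v. (v, x) \<in> parcs X} \<subset> orbit \<rho> v" using self_orbit[of v] by blast
    have fin: "finite (orbit \<rho> v)" using orbit_card[OF v] n2 by (metis card.infinite not_numeral_le_zero)
    show ?thesis using psubset_card_mono[OF fin sub] inner_degree[OF v] orbit_card[OF v] by simp
  qed
  have "class_II_pair X D n \<rho> ?g (r ^ i mod int n) m s v"
  proof unfold_locales
    show "0 \<le> r ^ i mod int n" "r ^ i mod int n < int n" using n_pos by simp_all
    show "coprime (r ^ i mod int n) (int n)" using n2 r_coprime by simp
    show "?g \<circ> \<rho> = (\<rho> ^^ nat (r ^ i mod int n)) \<circ> ?g" by (rule move_rho)
    show "?g \<in> automorphisms X" by (rule move_aut)
    show "(v, x) \<in> D \<longleftrightarrow> x = oriented_metacirculant.R n \<rho> s v \<or> x = ?g v" for x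
    proof
      assume D: "(v, x) \<in> D"
      show "x = R s v \<or> x = ?g v"
      proof (cases "x \<in> orbit \<rho> v")
        case True then show ?thesis using s D by blast
      next
        case False
        then have "x = w \<or> x = z" using outer D arcs by blast
        then show ?thesis using zv D antisym ji by blast
      qed
    next
      assume "x = R s v \<or> x = ?g v"
      moreover have "R s v \<in> orbit \<rho> v" using orbit_rho[OF v] by blast
      ultimately show "(v, x) \<in> D" using s w(1) ji by auto
    qed
    show "x \<in> orbit \<rho> v \<or> x = ?g v \<or> ?g x = v" if "(v, x) \<in> parcs X" for x
      using outer[OF that] z(2) ji by blast
  qed (use \<open>3 \<le> m\<close> \<open>3 \<le> n\<close> v card_orbits rho orbit_card in simp_all)
  then show thesis by (rule that)
qed

context class_II_pair begin

definition vert :: "int \<Rightarrow> nat \<Rightarrow> 'a" where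
  "vert j i = move j i v\<^sub>0"

lemma vert_alt: "vert j i = R j ((\<sigma> ^^ i) v\<^sub>0)"
  by (simp add: vert_def move_def)

lemma vert_in [simp]: "vert j i \<in> V"
  using aut_in[OF move_aut v0] by (simp add: vert_def)

lemma out_vert: "(vert j i, w) \<in> D \<longleftrightarrow> w = vert (j + r ^ i * s) i \<or> w = vert j (Suc i)"
proof -
  let ?g = "move j i"
  have "(vert j i, w) \<in> D \<longleftrightarrow> (\<exists>w'. w = ?g w' \<and> (v\<^sub>0, w') \<in> D)"
  proof
    assume D: "(vert j i, w) \<in> D"
    then obtain w' where w': "w' \<in> V" "?g w' = w" using aut_surj[OF move_aut, of w] D_V by blast
    then show "\<exists>w'. w = ?g w' \<and> (v\<^sub>0, w') \<in> D" using D D_iff[OF move_aut v0 w'(1)] vert_def by auto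
  next
    assume "\<exists>w'. w = ?g w' \<and> (v\<^sub>0, w') \<in> D"
    then show "(vert j i, w) \<in> D" using invariant[OF move_aut] vert_def by auto
  qed
  also have "\<dots> \<longleftrightarrow> w = ?g (R s v\<^sub>0) \<or> w = ?g (\<sigma> v\<^sub>0)" unfolding out_v0 by blast
  also have "?g (R s v\<^sub>0) = vert (j + r ^ i * s) i"
    using v0 by (simp add: vert_alt move_def sigma_pow_R R_R)
  also have "?g (\<sigma> v\<^sub>0) = vert j (Suc i)"
    by (simp add: vert_alt move_def funpow_swap1)
  finally show ?thesis .
qed

lemma V_vert:
  assumes "v \<in> V"
  obtains j i where "v = vert j i"
proof -
  have "{vert j i | j i. True} = V"
  proof (rule connected_closed)
    show "{vert j i | j i. True} \<subseteq> V" by auto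
    show "vert 0 0 \<in> {vert j i | j i. True}" by blast
    fix v w assume "v \<in> {vert j i | j i. True}" and vw: "(v, w) \<in> parcs X"
    then obtain j i where v: "v = vert j i" by blast
    obtain w' where w': "w' \<in> V" "move j i w' = w" using aut_surj[OF move_aut] arcs_V[OF vw] by blast
    have "(v\<^sub>0, w') \<in> parcs X"
      using vw aut_arcs[OF move_aut v0 w'(1), of j i] w'(2) unfolding v vert_def by simp
    then consider "w' \<in> orbit \<rho> v\<^sub>0" | "w' = \<sigma> v\<^sub>0" | "\<sigma> w' = v\<^sub>0" using joined by blast
    then have "\<exists>j' i'. w' = vert j' i'"
    proof cases
      case 1
      then obtain j' where "w' = R j' v\<^sub>0" unfolding orbit_rho[OF v0] by blast
      then have "w' = vert j' 0" by (simp add: vert_alt)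
      then show ?thesis by blast
    next
      case 2
      then have "w' = vert 0 1" by (simp add: vert_alt R_0)
      then show ?thesis by blast
    next
      case 3
      obtain N where N: "0 < N" "(\<sigma> ^^ N) v\<^sub>0 = v\<^sub>0" by (rule sigma_period)
      have "\<sigma> ((\<sigma> ^^ (N - 1)) v\<^sub>0) = (\<sigma> ^^ (Suc (N - 1))) v\<^sub>0" by simp
      also have "\<dots> = \<sigma> w'" using N 3 by simp
      finally have "(\<sigma> ^^ (N - 1)) v\<^sub>0 = w'" by (simp only: aut_inj[OF sigma])
      then have "w' = vert 0 (N - 1)" by (auto simp add: vert_alt R_0)
      then show ?thesis by blast
    qed
    then obtain j' i' where "w' = vert j' i'" by blast
    then have "w = vert (j + r ^ i * j') (i + i')"
      using w'(2) move_move[OF v0] unfolding vert_def by simp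
    then show "w \<in> {vert j i | j i. True}" by blast
  qed
  then show thesis using assms that by blast
qed

text \<open>
  Every arc lies on a directed cycle, of inner arcs or of outer arcs. So a set that is closed under
  out-neighbours is closed under in-neighbours too.
\<close>
lemma out_closed:
  assumes "S \<subseteq> V" "x \<in> S" "\<And>v w. v \<in> S \<Longrightarrow> (v, w) \<in> D \<Longrightarrow> w \<in> S"
  shows "S = V"
proof (rule connected_closed[OF assms(1,2)])
  fix v w assume v: "v \<in> S" and "(v, w) \<in> parcs X"
  then consider "(v, w) \<in> D" | "(w, v) \<in> D" using arcs by blast
  then show "w \<in> S"
  proof cases
    case 1 then show ?thesis using assms(3) v by blast
  next
    case 2
    obtain j i where w: "w = vert j i" using V_vert D_V 2 by blast
    with 2 consider "v = vert (j + r ^ i * s) i" | "v = vert j (Suc i)" using out_vert by blast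
    then show ?thesis
    proof cases
      case 1
      have "vert (j + int (Suc k) * (r ^ i * s)) i \<in> S" for k
      proof (induction k)
        case (Suc k)
        have "(vert (j + int (Suc k) * (r ^ i * s)) i, vert (j + int (Suc k) * (r ^ i * s) + r ^ i * s) i) \<in> D"
          using out_vert by blast
        then have "vert (j + int (Suc k) * (r ^ i * s) + r ^ i * s) i \<in> S" using assms(3) Suc by blast
        then show ?case by (simp add: algebra_simps)
      qed (use v 1 in simp)
      from this[of "n - 1"] have "vert (j + int n * (r ^ i * s)) i \<in> S" using n3 by simp
      moreover have "vert (j + int n * (r ^ i * s)) i = vert j i"
        unfolding vert_alt using R_eq v0 by (simp add: cong_def)
      ultimately show ?thesis using w by simp
    next
      case 2
      have "vert j (i + Suc k) \<in> S" for k
      proof (induction k)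
        case (Suc k)
        have "(vert j (i + Suc k), vert j (Suc (i + Suc k))) \<in> D" using out_vert by blast
        then have "vert j (Suc (i + Suc k)) \<in> S" using assms(3) Suc by blast
        then show ?case by simp
      qed (use v 2 in simp)
      moreover obtain N where N: "0 < N" "(\<sigma> ^^ N) v\<^sub>0 = v\<^sub>0" by (rule sigma_period)
      ultimately have "vert j (i + Suc (N - 1)) \<in> S" by blast
      moreover have "vert j (i + Suc (N - 1)) = vert j i"
        using N by (simp add: vert_alt funpow_add)
      ultimately show ?thesis using w by simp
    qed
  qed
qed

lemma orbit_vert: "orbit \<rho> (vert j i) = ((`) \<sigma> ^^ i) (orbit \<rho> v\<^sub>0)"
  using v0 by (simp add: vert_alt orbit_R orbit_sigma_pow)

lemma orbits_cycle:
  "orbit \<rho> v\<^sub>0 \<in> orbit ((`) \<sigma>) (orbit \<rho> v\<^sub>0)"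
  "vertex_orbits X \<rho> = orbit ((`) \<sigma>) (orbit \<rho> v\<^sub>0)"
proof -
  obtain N where N: "0 < N" "(\<sigma> ^^ N) v\<^sub>0 = v\<^sub>0" by (rule sigma_period)
  then show 1: "orbit \<rho> v\<^sub>0 \<in> orbit ((`) \<sigma>) (orbit \<rho> v\<^sub>0)"
    unfolding orbit_altdef[of "(`) \<sigma>"] using orbit_sigma_pow[OF v0, of N] by (intro CollectI exI[of _ N]) simp
  show "vertex_orbits X \<rho> = orbit ((`) \<sigma>) (orbit \<rho> v\<^sub>0)"
  proof (rule subset_antisym; rule subsetI)
    fix B assume "B \<in> vertex_orbits X \<rho>"
    then obtain v where v: "v \<in> V" "B = orbit \<rho> v" unfolding vertex_orbits_def by blast
    obtain j i where "v = vert j i" using V_vert[OF v(1)] .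
    then have "B = ((`) \<sigma> ^^ i) (orbit \<rho> v\<^sub>0)" using v(2) orbit_vert by simp
    then show "B \<in> orbit ((`) \<sigma>) (orbit \<rho> v\<^sub>0)" using funpow_in_orbit[OF 1] by simp
  next
    fix B assume "B \<in> orbit ((`) \<sigma>) (orbit \<rho> v\<^sub>0)"
    then obtain i where "B = ((`) \<sigma> ^^ i) (orbit \<rho> v\<^sub>0)" unfolding orbit_altdef by blast
    then have "B = orbit \<rho> ((\<sigma> ^^ i) v\<^sub>0)" using orbit_sigma_pow[OF v0] by simp
    then show "B \<in> vertex_orbits X \<rho>" unfolding vertex_orbits_def using v0 by simp
  qed
qed

lemma cyclic_on_orbits: "cyclic_on (\<lambda>B. \<sigma> ` B) (vertex_orbits X \<rho>)"
  by (rule cyclic_on_singleI[of "orbit \<rho> v\<^sub>0"]) (use orbits_cycle in simp_all)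

lemma vert_orbit_eq: "orbit \<rho> (vert j i) = orbit \<rho> (vert j' i') \<longleftrightarrow> [i = i'] (mod m)"
  unfolding orbit_vert using funpow_eq_iff_cong[OF orbits_cycle(1)] orbits_cycle(2) card_orbits by simp

text \<open>
  The parameter \<open>t\<close> of the coordinates: \<open>\<sigma>\<^sup>m\<close> maps each orbit to itself and acts on that of \<open>v\<^sub>0\<close>, up to
  powers of \<open>r\<close>, as a shift.
\<close>
definition wrap :: int where
  "wrap = (SOME t. (\<sigma> ^^ m) v\<^sub>0 = R t v\<^sub>0)"

lemma wrap: "(\<sigma> ^^ m) v\<^sub>0 = R wrap v\<^sub>0"
proof -
  have "orbit \<rho> (vert 0 m) = orbit \<rho> (vert 0 0)" unfolding vert_orbit_eq by (simp add: cong_def)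
  moreover have "vert 0 m \<in> orbit \<rho> (vert 0 m)"
    by (rule permutation_self_in_orbit[OF aut_permutation[OF rho]])
  ultimately have "vert 0 m \<in> orbit \<rho> v\<^sub>0" by (simp add: vert_alt R_0)
  then have "\<exists>t. (\<sigma> ^^ m) v\<^sub>0 = R t v\<^sub>0" unfolding orbit_rho[OF v0] by (simp add: vert_alt R_0)
  then show ?thesis unfolding wrap_def by (rule someI_ex)
qed

lemma vert_wrap: "vert 0 m = vert wrap 0"
  by (simp add: vert_alt R_0 wrap)

lemma vert_same_row: "vert j i = vert j' i \<longleftrightarrow> [j = j'] (mod int n)"
  unfolding vert_alt using R_eq v0 by simp

text \<open>
  The vertex \<open>\<sigma>\<^sup>m v\<^sub>0\<close> has two descriptions, and each of them describes its inner and its outer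
  out-neighbour.
\<close>
lemma wrap_facts: "int n dvd wrap * r - wrap" "int n dvd r ^ m * s - s"
proof -
  have out: "(vert 0 m, w) \<in> D \<longleftrightarrow> (vert wrap 0, w) \<in> D" for w by (simp add: vert_wrap)
  have *: "w = vert (r ^ m * s) m \<or> w = vert 0 (Suc m) \<longleftrightarrow> w = vert (wrap + s) 0 \<or> w = vert wrap 1" for w
    using out[of w] unfolding out_vert by simp
  have m1: "orbit \<rho> (vert j (Suc m)) = orbit \<rho> (vert j' 1)"
    "orbit \<rho> (vert j m) = orbit \<rho> (vert j' 0)"
    "orbit \<rho> (vert j 1) \<noteq> orbit \<rho> (vert j' 0)" for j j'
    unfolding vert_orbit_eq using m3 by (auto simp: cong_def mod_Suc)
  have "vert 0 (Suc m) \<noteq> vert (wrap + s) 0" using m1(1,3) by metis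
  then have 1: "vert 0 (Suc m) = vert wrap 1" using * by blast
  have "vert (r ^ m * s) m \<noteq> vert wrap 1" using m1(2,3) by metis
  then have 2: "vert (r ^ m * s) m = vert (wrap + s) 0" using * by blast
  have "\<sigma> (vert 0 m) = vert 0 (Suc m)" by (simp add: vert_alt R_0)
  moreover have "\<sigma> (vert wrap 0) = vert (r * wrap) 1" using v0 by (simp add: vert_alt sigma_R)
  ultimately have "vert (r * wrap) 1 = vert wrap 1" using 1 vert_wrap by simp
  then show "int n dvd wrap * r - wrap" unfolding vert_same_row by (simp add: cong_iff_dvd_diff mult.commute)
  have "vert (r ^ m * s) m = R (r ^ m * s) (vert 0 m)" using v0 by (simp add: vert_alt R_R)
  also have "\<dots> = vert (r ^ m * s + wrap) 0" using v0 by (simp add: vert_wrap) (simp add: vert_alt R_R)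
  finally have "[r ^ m * s + wrap = wrap + s] (mod int n)" using 2 vert_same_row[of "wrap + s" 0 "r ^ m * s + wrap"] by (simp add: cong_sym)
  then show "int n dvd r ^ m * s - s" by (simp add: cong_iff_dvd_diff algebra_simps)
qed

lemma wrap_r_pow: "[r ^ i * wrap = wrap] (mod int n)"
proof (induction i)
  case (Suc i)
  have "int n dvd r ^ i * (wrap * r - wrap) + (r ^ i * wrap - wrap)"
    using wrap_facts(1) Suc by (intro dvd_add) (simp_all add: cong_iff_dvd_diff)
  then show ?case by (simp add: cong_iff_dvd_diff algebra_simps)
qed simp

lemma sigma_pow_wrap: "(\<sigma> ^^ (i + m * k)) v\<^sub>0 = vert (int k * wrap) i"
proof (induction k)
  case (Suc k)
  have "i + m * Suc k = (i + m * k) + m" by simp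
  then have "(\<sigma> ^^ (i + m * Suc k)) v\<^sub>0 = (\<sigma> ^^ (i + m * k)) ((\<sigma> ^^ m) v\<^sub>0)"
    by (simp only: funpow_add comp_apply)
  also have "\<dots> = R (r ^ (i + m * k) * wrap) (vert (int k * wrap) i)"
    using v0 Suc by (simp add: wrap sigma_pow_R)
  also have "\<dots> = R wrap (vert (int k * wrap) i)"
    using R_eq[OF vert_in] wrap_r_pow by blast
  also have "\<dots> = vert (int (Suc k) * wrap) i"
    using v0 by (simp add: vert_alt R_R algebra_simps)
  finally show ?case .
qed (simp add: vert_alt R_0)

lemma vert_normal: "vert j i = vert (j + int (i div m) * wrap) (i mod m)"
proof -
  have "vert j i = R j ((\<sigma> ^^ (i mod m + m * (i div m))) v\<^sub>0)" by (simp add: vert_alt)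
  also have "\<dots> = vert (j + int (i div m) * wrap) (i mod m)"
    unfolding sigma_pow_wrap using v0 by (simp add: vert_alt R_R)
  finally show ?thesis .
qed

text \<open>
  The vertices whose coordinate \<open>j\<close> satisfies \<open>(r\<^sup>m - 1) j = 0\<close> are closed under out-neighbours, since
  \<open>(r\<^sup>m - 1) s = 0\<close>; so \<open>j = 1\<close> is among the coordinates, up to multiples of the shift by \<open>\<sigma>\<^sup>m\<close>.
\<close>
lemma r_power: "[r ^ m = 1] (mod int n)"
proof -
  let ?S = "{vert j i | j i. int n dvd (r ^ m - 1) * j}"
  have "?S = V"
  proof (rule out_closed)
    show "vert 0 0 \<in> ?S" by (intro CollectI exI[of _ 0] conjI) simp_all
    fix v w assume "v \<in> ?S" and D: "(v, w) \<in> D"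
    then obtain j i where v: "v = vert j i" "int n dvd (r ^ m - 1) * j" by blast
    have "int n dvd (r ^ m - 1) * j + r ^ i * (r ^ m * s - s)"
      by (rule dvd_add[OF v(2) dvd_mult[OF wrap_facts(2)]])
    then have "int n dvd (r ^ m - 1) * (j + r ^ i * s)" by (simp add: algebra_simps)
    moreover have "w = vert (j + r ^ i * s) i \<or> w = vert j (Suc i)" using D v(1) out_vert by simp
    ultimately show "w \<in> ?S" using v(2) by blast
  qed auto
  then have "vert 1 0 \<in> ?S" by simp
  then obtain j i where ji: "vert 1 0 = vert j i" "int n dvd (r ^ m - 1) * j" by blast
  have "[0 = i] (mod m)" using arg_cong[OF ji(1), of "orbit \<rho>"] unfolding vert_orbit_eq .
  then have "i mod m = 0" by (simp add: cong_def)
  then have "vert 1 0 = vert (j + int (i div m) * wrap) 0" using ji(1) vert_normal[of j i] by simp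
  then have "int n dvd 1 - (j + int (i div m) * wrap)" unfolding vert_same_row cong_iff_dvd_diff .
  moreover have w: "int n dvd (r ^ m - 1) * wrap"
    using wrap_r_pow[of m] by (simp add: cong_iff_dvd_diff algebra_simps)
  ultimately have "int n dvd (r ^ m - 1) * (1 - (j + int (i div m) * wrap)) + (r ^ m - 1) * j
      + int (i div m) * ((r ^ m - 1) * wrap)"
    using dvd_add[OF dvd_add[OF dvd_mult ji(2)] dvd_mult[OF w]] by blast
  then show ?thesis by (simp add: cong_iff_dvd_diff algebra_simps)
qed

text \<open>
  Row numbers in the range from 0 to \<open>m - 1\<close> are used as exponents of \<open>\<sigma>\<close>; the quotient by \<open>m\<close> becomes a
  shift.
\<close>
definition coord :: "int \<Rightarrow> int \<Rightarrow> 'a" where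
  "coord i j = vert (j + wrap * (i div int m)) (nat (i mod int m))"

lemma m_pos: "int m > 0" using m3 by simp

lemma coord_nat: "coord (int i) j = vert j i"
proof -
  have "nat (int i mod int m) = i mod m" by (simp add: nat_mod_distrib)
  then have "coord (int i) j = vert (j + int (i div m) * wrap) (i mod m)"
    by (simp add: coord_def mult.commute zdiv_int)
  then show ?thesis by (simp only: vert_normal[of j i])
qed

lemma coord_eq: "coord i j = coord i' j' \<longleftrightarrow> (\<exists>k. i' = i + k * int m \<and> [j = j' + wrap * k] (mod int n))"
proof
  assume *: "coord i j = coord i' j'"
  have "[nat (i mod int m) = nat (i' mod int m)] (mod m)"
    using arg_cong[OF *, of "orbit \<rho>"] unfolding coord_def vert_orbit_eq .
  moreover have "nat (l mod int m) < m" for l using m_pos by (simp add: nat_less_iff)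
  ultimately have "nat (i mod int m) = nat (i' mod int m)" by (simp add: cong_def)
  then have rows: "i mod int m = i' mod int m" using m_pos by (simp add: eq_nat_nat_iff)
  then have "int n dvd (j + wrap * (i div int m)) - (j' + wrap * (i' div int m))"
    using * unfolding coord_def by (simp add: vert_same_row cong_iff_dvd_diff)
  moreover have "i' = i + (i' div int m - i div int m) * int m"
  proof -
    have "i' - i = int m * (i' div int m) - int m * (i div int m)"
      using rows minus_mod_eq_mult_div[of i "int m"] minus_mod_eq_mult_div[of i' "int m"] by linarith
    also have "\<dots> = (i' div int m - i div int m) * int m" by (simp add: algebra_simps)
    finally show ?thesis by simp
  qed
  ultimately show "\<exists>k. i' = i + k * int m \<and> [j = j' + wrap * k] (mod int n)"
    by (intro exI[of _ "i' div int m - i div int m"]) (simp add: cong_iff_dvd_diff algebra_simps)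
next
  assume "\<exists>k. i' = i + k * int m \<and> [j = j' + wrap * k] (mod int n)"
  then obtain k where k: "i' = i + k * int m" "[j = j' + wrap * k] (mod int n)" by blast
  have "[j + wrap * (i div int m) = j' + wrap * (i div int m + k)] (mod int n)"
    using cong_add[OF k(2) cong_refl[of "wrap * (i div int m)"]] by (simp add: algebra_simps)
  then show "coord i j = coord i' j'"
    using m_pos unfolding coord_def by (simp add: k(1) vert_same_row add.commute)
qed

lemma coord_wrap: "coord (i + k * int m) j = coord i (j + wrap * k)"
  unfolding coord_eq by (rule exI[of _ "- k"]) simp

lemma coord_reduce:
  obtains a k where "i = int a + k * int m" "\<forall>j. coord i j = vert (j + wrap * k) a"
    "\<forall>j. coord (i + 1) j = vert (j + wrap * k) (Suc a)"
proof -
  define a where "a = nat (i mod int m)"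
  define k where "k = i div int m"
  have i: "i = int a + k * int m" using m_pos by (simp add: a_def k_def)
  have 1: "coord i j = vert (j + wrap * k) a" for j
    unfolding i coord_wrap coord_nat ..
  have "i + 1 = int (Suc a) + k * int m" using i by simp
  then have 2: "coord (i + 1) j = vert (j + wrap * k) (Suc a)" for j
    by (simp only: coord_wrap coord_nat)
  show thesis using that i 1 2 by blast
qed

lemma row_power_nat: "[row_power m r (int a) = r ^ a] (mod int n)"
proof -
  have "[(r ^ m) ^ (a div m) * r ^ (a mod m) = 1 ^ (a div m) * r ^ (a mod m)] (mod int n)"
    by (intro cong_scalar_right cong_pow r_power)
  then have "[r ^ a = r ^ (a mod m)] (mod int n)"
    by (simp flip: power_mult power_add)
  then show ?thesis by (simp add: row_power_def nat_mod_distrib cong_sym)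
qed

lemma out_arcs_coord: "out_arcs_of m r s coord = D"
proof (rule subset_antisym; rule subsetI)
  fix x assume "x \<in> out_arcs_of m r s coord"
  then consider i j where "x = (coord i j, coord (i + 1) j)"
    | i j where "x = (coord i j, coord i (j + s * row_power m r i))"
    unfolding out_arcs_of_def by blast
  then show "x \<in> D"
  proof cases
    case (1 i j)
    obtain a k where "i = int a + k * int m" "\<forall>j. coord i j = vert (j + wrap * k) a"
      "\<forall>j. coord (i + 1) j = vert (j + wrap * k) (Suc a)" by (rule coord_reduce[of i])
    then show ?thesis using 1 out_vert by simp
  next
    case (2 i j)
    obtain a k where ak: "i = int a + k * int m" "\<forall>j. coord i j = vert (j + wrap * k) a"
      "\<forall>j. coord (i + 1) j = vert (j + wrap * k) (Suc a)" by (rule coord_reduce[of i])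
    have "row_power m r i = row_power m r (int a)" unfolding ak(1) by (simp add: row_power_def)
    then have "int n dvd s * (row_power m r i - r ^ a)"
      using row_power_nat[of a] by (simp add: cong_iff_dvd_diff)
    then have "coord i (j + s * row_power m r i) = vert (j + wrap * k + r ^ a * s) a"
      using ak(2) by (simp add: vert_same_row cong_iff_dvd_diff algebra_simps)
    then show ?thesis using 2 out_vert ak(2) by simp
  qed
next
  fix x assume x: "x \<in> D"
  obtain v w where vw: "x = (v, w)" by (cases x)
  obtain j i where v: "v = vert j i" using V_vert D_V x vw by blast
  then consider "w = vert (j + r ^ i * s) i" | "w = vert j (Suc i)" using x vw out_vert by blast
  then show "x \<in> out_arcs_of m r s coord"
  proof cases
    case 1
    have "int n dvd s * (row_power m r (int i) - r ^ i)"
      using row_power_nat[of i] by (simp add: cong_iff_dvd_diff)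
    then have "vert (j + r ^ i * s) i = vert (j + s * row_power m r (int i)) i"
      unfolding vert_same_row by (simp add: cong_iff_dvd_diff algebra_simps dvd_diff_commute)
    then have "x = (coord (int i) j, coord (int i) (j + s * row_power m r (int i)))"
      using vw v 1 by (simp only: coord_nat)
    then show ?thesis unfolding out_arcs_of_def by blast
  next
    case 2
    have "vert j (Suc i) = coord (int i + 1) j" using coord_nat[of "Suc i" j] by (simp add: add.commute)
    then have "x = (coord (int i) j, coord (int i + 1) j)"
      using vw v 2 by (simp only: coord_nat)
    then show ?thesis unfolding out_arcs_of_def by blast
  qed
qed

lemma rho_coord: "\<rho> (coord i j) = coord i (j + 1)"
proof -
  have "\<rho> v = R 1 v" if "v \<in> V" for v using R_nat[OF that, of 1] by simp
  then show ?thesis using v0 by (simp add: coord_def vert_alt R_R algebra_simps)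
qed

lemma sigma_coord: "\<sigma> (coord i j) = coord (i + 1) (r * j)"
proof -
  obtain a k where ak: "i = int a + k * int m" "\<forall>j. coord i j = vert (j + wrap * k) a"
    "\<forall>j. coord (i + 1) j = vert (j + wrap * k) (Suc a)" by (rule coord_reduce[of i])
  have "\<sigma> (coord i j) = vert (r * (j + wrap * k)) (Suc a)"
    using v0 by (simp add: ak(2) vert_alt sigma_R)
  also have "\<dots> = vert (r * j + wrap * k) (Suc a)"
  proof -
    have "int n dvd k * (wrap * r - wrap)" using wrap_facts(1) by (rule dvd_mult)
    then show ?thesis unfolding vert_same_row by (simp add: cong_iff_dvd_diff algebra_simps)
  qed
  finally show ?thesis by (simp add: ak(3))
qed

lemma coordinates: "class_II_coordinates X m n r s wrap coord"
proof (intro class_II_coordinates.intro class_II_coordinates_axioms.intro)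
  show "half_arc_orientation X (out_arcs_of m r s coord)"
    unfolding out_arcs_coord by unfold_locales
  show "[wrap * (r - 1) = 0] (mod int n)"
    using wrap_facts(1) by (simp add: cong_iff_dvd_diff algebra_simps)
  show "V = {coord i j | i j. True}"
  proof (rule subset_antisym; rule subsetI)
    fix v assume "v \<in> V"
    then obtain j i where "v = vert j i" by (rule V_vert)
    then have "v = coord (int i) j" by (simp add: coord_nat)
    then show "v \<in> {coord i j | i j. True}" by blast
  qed (auto simp: coord_def)
  fix S i j
  assume S: "coord 0 0 \<in> S" "\<And>i j. coord i j \<in> S \<Longrightarrow> coord (i + 1) j \<in> S"
    "\<And>i j. coord i j \<in> S \<Longrightarrow> coord i (j + s * row_power m r i) \<in> S"
  have "S \<inter> V = V"
  proof (rule out_closed)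
    show "coord 0 0 \<in> S \<inter> V" using S(1) by (simp add: coord_def)
    fix v w assume v: "v \<in> S \<inter> V" and "(v, w) \<in> D"
    then have "(v, w) \<in> out_arcs_of m r s coord" by (simp only: out_arcs_coord)
    then have "w \<in> S" using v S(2,3) unfolding out_arcs_of_def by auto
    then show "w \<in> S \<inter> V" using D_V \<open>(v, w) \<in> D\<close> by blast
  qed simp
  moreover have "coord i j \<in> V" by (simp add: coord_def)
  ultimately show "coord i j \<in> S" by blast
next
  show "3 \<le> m" "3 \<le> n" by (rule m3 n3)+
  show "coprime r (int n)" "[r ^ m = 1] (mod int n)" by (rule r_coprime r_power)+
  show "coord i j = coord i' j' \<longleftrightarrow> (\<exists>k. i' = i + k * int m \<and> [j = j' + wrap * k] (mod int n))"
    for i j i' j' by (rule coord_eq)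
qed

end

lemma oriented_class_II_exists:
  assumes "class_II_rel X m n \<rho> \<sigma>"
  obtains D r where "oriented_class_II X D n \<rho> \<sigma> r m"
proof -
  have wm: "weak_metacirculant_rel X m n \<rho> \<sigma>" and hat: "connected_quartic_hat_graph X"
    and deg: "\<forall>B\<in>vertex_orbits X \<rho>. (\<forall>v\<in>B. card {w \<in> B. (v, w) \<in> parcs X} = 2) \<and>
      card (joined_orbits X \<rho> B) = 2 \<and>
      (\<forall>B'\<in>joined_orbits X \<rho> B. \<forall>v\<in>B. card {w \<in> B'. (v, w) \<in> parcs X} = 1)"
    using assms unfolding class_II_rel_def by blast+
  have orb: "orbit \<rho> v \<in> vertex_orbits X \<rho>" if "v \<in> pverts X" for v
    unfolding vertex_orbits_def using that by blast
  have sr: "2 \<le> n" "\<rho> \<in> automorphisms X" "card (vertex_orbits X \<rho>) = m"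
    "\<And>v. v \<in> pverts X \<Longrightarrow> card (orbit \<rho> v) = n" and sigma: "\<sigma> \<in> automorphisms X"
    and cyc: "cyclic_on ((`) \<sigma>) (vertex_orbits X \<rho>)"
    using wm orb unfolding weak_metacirculant_rel_def semiregular_def by auto
  obtain r where r: "0 \<le> r" "r < int n" "coprime r (int n)" "\<sigma> \<circ> \<rho> = (\<rho> ^^ nat r) \<circ> \<sigma>"
    using wm conjugation_iff[OF sr(2) sigma] unfolding weak_metacirculant_rel_def by auto
  obtain D where "half_arc_orientation X D" using hat_orientation[OF hat] .
  then interpret oriented_metacirculant X D n \<rho> \<sigma> r
    by (intro oriented_metacirculant.intro oriented_metacirculant_axioms.intro)
      (use sr sigma r in simp_all)
  have "card {w \<in> orbit \<rho> v. (v, w) \<in> parcs X} = 2" "card (joined_orbits X \<rho> (orbit \<rho> v)) = 2"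
    if "v \<in> V" for v using deg orb[OF that] self_orbit by blast+
  moreover have "card {w \<in> B. (v, w) \<in> parcs X} = 1"
    if "v \<in> V" "B \<in> joined_orbits X \<rho> (orbit \<rho> v)" for v B
    using deg orb[OF that(1)] self_orbit that(2) by blast
  ultimately have "oriented_class_II X D n \<rho> \<sigma> r m"
    by unfold_locales (use cyc sr(3) in simp_all)
  then show thesis by (rule that)
qed

section \<open>The theorem\<close>

theorem theorem5p1:
  fixes X :: "'a pair_pre_digraph" and m n :: nat
  assumes "class_II X m n"
  shows
    "(\<exists>\<rho> \<sigma>. class_II_rel X m n \<rho> \<sigma> \<and>
        is_cayley_graph_for X (subgroup_generated (aut_group X) {\<rho>, \<sigma>})) \<and>
     (\<forall>v\<in>pverts X. vertex_stabilizer X v \<cong> integer_mod_group 2) \<and>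
     m dvd n \<and> n div m > 2 \<and>
     (\<exists>r t :: int. y_params m n r t \<and>
        digraph_iso (with_proj X) (with_proj (y_graph m n r t)) \<and>
        [r ^ m = 1] (mod int n) \<and>
        [int m * (r - 1) = 0] (mod int n) \<and>
        [t * (r - 1) = 0] (mod int n) \<and>
        [(r - 1)\<^sup>2 = 0] (mod int n) \<and>
        generate (integer_mod_group n) {int m mod int n} = generate (integer_mod_group n) {t} \<and>
        (\<exists>!c. c \<in> {0..<int (n div m)} \<and>
           [t = c * int m] (mod int n) \<and> [int m = c * t] (mod int n)) \<and>
        (\<exists>!a. a \<in> {0..<int (n div m)} \<and>
           [a * t = - a * int m] (mod int n) \<and> [- a * int m = r - 1] (mod int n))) \<and>
     (tightly_attached X \<or>
        (even m \<and> even (n div m) \<and>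
         (\<exists>n\<^sub>1 :: nat. n\<^sub>1 > 2 \<and> n = 8 * n\<^sub>1 \<and> (even n\<^sub>1 \<or> \<not> squarefree n\<^sub>1))))"
proof -
  obtain \<rho> \<sigma>\<^sub>0 where rel: "class_II_rel X m n \<rho> \<sigma>\<^sub>0"
    using assms unfolding class_II_def by blast
  obtain D r\<^sub>0 where "oriented_class_II X D n \<rho> \<sigma>\<^sub>0 r\<^sub>0 m"
    using oriented_class_II_exists[OF rel] .
  then obtain \<sigma> r s v\<^sub>0 where "class_II_pair X D n \<rho> \<sigma> r m s v\<^sub>0"
    by (rule oriented_class_II.class_II_pair_exists)
  then interpret P: class_II_pair X D n \<rho> \<sigma> r m s v\<^sub>0 .
  interpret C: class_II_coordinates X m n r s P.wrap P.coord by (rule P.coordinates)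
  have "\<exists>r\<in>{0..<int n}. coprime r (int n) \<and>
      inv\<^bsub>aut_group X\<^esub> \<sigma> \<otimes>\<^bsub>aut_group X\<^esub> \<rho> \<otimes>\<^bsub>aut_group X\<^esub> \<sigma> = \<rho> [^]\<^bsub>aut_group X\<^esub> r"
    using conjugation_iff[OF P.rho P.sigma P.r_range(1)] P.sigma_rho P.r_range P.r_coprime by auto
  then have rel': "class_II_rel X m n \<rho> \<sigma>"
    using rel P.sigma P.cyclic_on_orbits unfolding class_II_rel_def weak_metacirculant_rel_def by blast
  have cayley: "is_cayley_graph_for X (subgroup_generated (aut_group X) {\<rho>, \<sigma>})"
    by (rule C.is_cayley[OF P.rho P.rho_coord P.sigma P.sigma_coord])
  obtain u t where N: "class_II_coordinates X m n r 1 t u" "0 \<le> t" "t < int n"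
    using C.rescale .
  interpret N: class_II_normalised X m n r t u
    using N P.r_range unfolding class_II_normalised_def class_II_normalised_axioms_def by blast
  obtain c q d where p: "n = m * d" "2 < d" "t = c * int m" "r - 1 = int m * q"
    "0 \<le> c" "c < int d" "0 \<le> q" "q < int d"
    "int n dvd t * c - int m" "int n dvd t * q + (r - 1)"
    "int n dvd int m * (r - 1)" "int n dvd (r - 1)\<^sup>2" "\<not> int n dvd 2 * (r - 1)"
    using N.parameters .
  have d: "n div m = d" using p(1) N.m3 by simp
  have nd: "int n = int m * int d" using p(1) by simp
  have cancel: "int n dvd int m * a \<longleftrightarrow> int d dvd a" for a unfolding nd using N.m_pos by simp
  have unique: "a = b" if "a \<in> {0..<int d}" "b \<in> {0..<int d}" "int n dvd int m * (a - b)" for a b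
  proof -
    have "a mod int d = b mod int d" using that(3) unfolding cancel by (simp add: mod_eq_dvd_iff)
    then show ?thesis using that(1,2) by simp
  qed
  have cm: "[int m = c * t] (mod int n)"
    using p(9) by (simp add: cong_iff_dvd_diff dvd_diff_commute mult.commute)
  have params: "y_params m n r t"
    unfolding y_params_def using N.m3 N.n3 N.r_range N.r_coprime N.r_power N.t_range N.t_r by simp
  have gen: "generate (integer_mod_group n) {int m mod int n} = generate (integer_mod_group n) {t}"
  proof (rule generate_integer_mod_group_eq)
    show "[int m mod int n = c * t] (mod int n)" using cm by (simp add: cong_def)
    show "[t = c * (int m mod int n)] (mod int n)" by (simp add: cong_def p(3) mod_mult_right_eq)
  qed (use N.n_pos N.t_range in simp_all)
  have ex_c: "\<exists>!c. c \<in> {0..<int (n div m)} \<and> [t = c * int m] (mod int n) \<and> [int m = c * t] (mod int n)"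
    unfolding d
  proof (rule ex1I[of _ c])
    show "c \<in> {0..<int d} \<and> [t = c * int m] (mod int n) \<and> [int m = c * t] (mod int n)"
      using p(3,5,6) cm by simp
    fix c' assume "c' \<in> {0..<int d} \<and> [t = c' * int m] (mod int n) \<and> [int m = c' * t] (mod int n)"
    then have "c' \<in> {0..<int d}" "int n dvd int m * (c - c')"
      using p(3) by (simp_all add: cong_iff_dvd_diff algebra_simps)
    then show "c' = c" using unique[of c c'] p(5,6) by simp
  qed
  have ex_a: "\<exists>!a. a \<in> {0..<int (n div m)} \<and> [a * t = - a * int m] (mod int n) \<and>
      [- a * int m = r - 1] (mod int n)"
    unfolding d
  proof (rule ex1I[of _ "(- q) mod int d"])
    define a where "a = (- q) mod int d"
    define l where "l = (- q) div int d"
    have a: "a = - q - int d * l" unfolding a_def l_def by (simp add: minus_div_mult_eq_mod mult.commute minus_mult_div_eq_mod)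
    have "- a * int m - (r - 1) = int n * l" by (simp add: a nd p(4) algebra_simps)
    then have 1: "[- a * int m = r - 1] (mod int n)" by (simp add: cong_iff_dvd_diff)
    have "a * t - (r - 1) = (- 1) * (t * q + (r - 1)) - int n * (l * c)"
      by (simp add: a nd p(3) algebra_simps)
    moreover have "int n dvd (- 1) * (t * q + (r - 1)) - int n * (l * c)"
      by (rule dvd_diff[OF dvd_mult[OF p(10)] dvd_triv_left])
    ultimately have "[a * t = r - 1] (mod int n)" unfolding cong_iff_dvd_diff by (simp only:)
    then have "[a * t = - a * int m] (mod int n)" using 1 by (metis cong_sym cong_trans)
    then show "(- q) mod int d \<in> {0..<int d} \<and> [(- q) mod int d * t = - ((- q) mod int d) * int m] (mod int n) \<and>
        [- ((- q) mod int d) * int m = r - 1] (mod int n)"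
      using 1 p(2) unfolding a_def by simp
    fix b assume b: "b \<in> {0..<int d} \<and> [b * t = - b * int m] (mod int n) \<and> [- b * int m = r - 1] (mod int n)"
    then have "[- b * int m = r - 1] (mod int n)" by blast
    with 1 have "int n dvd (- a * int m - (r - 1)) - (- b * int m - (r - 1))"
      unfolding cong_iff_dvd_diff by (rule dvd_diff)
    then have "int n dvd int m * (b - a)" by (simp add: algebra_simps)
    moreover have "a \<in> {0..<int d}" using p(2) by (simp add: a_def)
    ultimately show "b = (- q) mod int d" using unique[of b a] b unfolding a_def by blast
  qed
  have "\<exists>r t. y_params m n r t \<and>
        digraph_iso (with_proj X) (with_proj (y_graph m n r t)) \<and>
        [r ^ m = 1] (mod int n) \<and>
        [int m * (r - 1) = 0] (mod int n) \<and>
        [t * (r - 1) = 0] (mod int n) \<and>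
        [(r - 1)\<^sup>2 = 0] (mod int n) \<and>
        generate (integer_mod_group n) {int m mod int n} = generate (integer_mod_group n) {t} \<and>
        (\<exists>!c. c \<in> {0..<int (n div m)} \<and>
           [t = c * int m] (mod int n) \<and> [int m = c * t] (mod int n)) \<and>
        (\<exists>!a. a \<in> {0..<int (n div m)} \<and>
           [a * t = - a * int m] (mod int n) \<and> [- a * int m = r - 1] (mod int n))"
    using params N.y_iso N.r_power p(11,12) N.t_r gen ex_c ex_a
    by (intro exI[of _ r] exI[of _ t] conjI) (simp_all add: cong_0_iff)
  then show ?thesis
    using rel' cayley C.stabilizer_iso p(1,2) d N.tightness by auto
qed

end
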